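(* Let $\mathbb{B},\mathbb{C},\mathbb{D},\mathbb{E}$ be categories with pullbacks, let $S:\mathbb{B}\to\mathbb{C}$, $Z:\mathbb{B}\to\mathbb{D}$, $F:\mathbb{C}\to\mathbb{E}$, $G:\mathbb{D}\to\mathbb{E}$ be pullback preserving functors, and assume that there is a natural isomorphism $FS\cong GZ$ which exhibits $\mathbb{B}$ (with projections $S$ and $Z$) as a pseudopullback of $F$ along $G$. If $p$ is a morphism of $\mathbb{B}$ such that $S(p)$ and $Z(p)$ are of effective descent and $FS(p)$ is a descent morphism, then $p$ is of effective descent.
   Context: Pseudopullback is meant in the bicategorical sense: the canonical functor from $\mathbb{B}$ to the category of triples $(c,d,\theta)$, with $c\in\mathbb{C}$, $d\in\mathbb{D}$ and $\theta:F(c)\cong G(d)$ an isomorphism in $\mathbb{E}$, is an equivalence of categories. Let $\dot\Delta$ be the category of finite ordinals and order preserving maps, and $\Delta$ its full subcategory of nonempty finite ordinals. Let $\mathbb{X}$ be a category with pullbacks and consider the basic fibration $(\ )^*:\mathbb{X}^{\mathrm{op}}\to\mathsf{CAT}$, i.e. the pseudofunctor with $B\mapsto\mathbb{X}/B$ and with $p^*:\mathbb{X}/B\to\mathbb{X}/E$ given by pullback along $p:E\to B$. For a morphism $p:E\to B$ of $\mathbb{X}$, let $\mathcal{D}_p:\dot\Delta^{\mathrm{op}}\to\mathbb{X}$ be the diagram sending $\mathsf{0}$ to $B$, $\mathsf{1}$ to $E$, $\mathsf{2}$ to $E\times_B E$, $\mathsf{3}$ to $E\times_BE\times_BE$, etc.,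 given by $p$, the iterated pullbacks of $p$ along itself, the projections and the diagonal morphisms. Let $\mathcal{A}_p:=(\ )^*\circ\mathcal{D}_p:\dot\Delta\to\mathsf{CAT}$. The descent category of $p$ is the category of pseudonatural transformations from the constant pseudofunctor at the terminal category to $\mathcal{A}_p|_\Delta:\Delta\to\mathsf{CAT}$ (and modifications). There is a canonical comparison functor from $\mathbb{X}/B=\mathcal{A}_p(\mathsf{0})$ to the descent category, induced by the functors $\mathcal{A}_p(\mathsf{0}\to\mathsf{n})$. The morphism $p$ is of effective descent (resp. a descent morphism) if this comparison functor is an equivalence (resp. fully faithful). *)

theory Defs
  imports "HOL-Library.FuncSet"
begin

section \<open>Categories, functors, natural transformations\<close>

record ('o, 'a) cat =
  Obj :: "'o set"
  Arr :: "'a set"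
  Dom :: "'a \<Rightarrow> 'o"
  Cod :: "'a \<Rightarrow> 'o"
  Ide :: "'o \<Rightarrow> 'a"
  Cmp :: "'a \<Rightarrow> 'a \<Rightarrow> 'a" (infixr "\<cdot>\<index>" 70)

definition hom :: "('o, 'a) cat \<Rightarrow> 'o \<Rightarrow> 'o \<Rightarrow> 'a set" where
  "hom C x y = {f \<in> Arr C. Dom C f = x \<and> Cod C f = y}"

text \<open>The value of \<^term>\<open>Cmp\<close> on non-composable pairs is irrelevant.\<close>

locale category =
  fixes C :: "('o, 'a) cat" (structure)
  assumes Dom_Obj: "f \<in> Arr C \<Longrightarrow> Dom C f \<in> Obj C"
    and Cod_Obj: "f \<in> Arr C \<Longrightarrow> Cod C f \<in> Obj C"
    and Ide_hom: "x \<in> Obj C \<Longrightarrow> Ide C x \<in> hom C x x"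
    and Cmp_hom: "f \<in> hom C x y \<Longrightarrow> g \<in> hom C y z \<Longrightarrow> g \<cdot> f \<in> hom C x z"
    and Cmp_Ide: "f \<in> hom C x y \<Longrightarrow> f \<cdot> Ide C x = f"
    and Ide_Cmp: "f \<in> hom C x y \<Longrightarrow> Ide C y \<cdot> f = f"
    and Cmp_assoc: "f \<in> hom C w x \<Longrightarrow> g \<in> hom C x y \<Longrightarrow> h \<in> hom C y z \<Longrightarrow>
      (h \<cdot> g) \<cdot> f = h \<cdot> (g \<cdot> f)"

definition iso :: "('o, 'a) cat \<Rightarrow> 'a \<Rightarrow> bool" where
  "iso C f \<longleftrightarrow> f \<in> Arr C \<and>
     (\<exists>g \<in> hom C (Cod C f) (Dom C f).
        g \<cdot>\<^bsub>C\<^esub> f = Ide C (Dom C f) \<and> f \<cdot>\<^bsub>C\<^esub> g = Ide C (Cod C f))"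

definition opp :: "('o, 'a) cat \<Rightarrow> ('o, 'a) cat" where
  "opp C = \<lparr>Obj = Obj C, Arr = Arr C, Dom = Cod C, Cod = Dom C, Ide = Ide C,
            Cmp = (\<lambda>g f. f \<cdot>\<^bsub>C\<^esub> g)\<rparr>"

definition full_subcategory :: "('o, 'a) cat \<Rightarrow> 'o set \<Rightarrow> ('o, 'a) cat" where
  "full_subcategory C U =
     C\<lparr>Obj := Obj C \<inter> U, Arr := {f \<in> Arr C. Dom C f \<in> U \<and> Cod C f \<in> U}\<rparr>"

definition terminal_cat :: "(unit, unit) cat" where
  "terminal_cat = \<lparr>Obj = UNIV, Arr = UNIV, Dom = (\<lambda>_. ()), Cod = (\<lambda>_. ()),
                   Ide = (\<lambda>_. ()), Cmp = (\<lambda>_ _. ())\<rparr>"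

record ('o, 'a, 'p, 'b) funct =
  FOb :: "'o \<Rightarrow> 'p"
  FAr :: "'a \<Rightarrow> 'b"

definition is_functor :: "('o, 'a) cat \<Rightarrow> ('p, 'b) cat \<Rightarrow> ('o, 'a, 'p, 'b) funct \<Rightarrow> bool" where
  "is_functor C D F \<longleftrightarrow> category C \<and> category D \<and>
     (\<forall>x \<in> Obj C. FOb F x \<in> Obj D) \<and>
     (\<forall>f \<in> Arr C. FAr F f \<in> hom D (FOb F (Dom C f)) (FOb F (Cod C f))) \<and>
     (\<forall>x \<in> Obj C. FAr F (Ide C x) = Ide D (FOb F x)) \<and>
     (\<forall>f \<in> Arr C. \<forall>g \<in> Arr C. Cod C f = Dom C g \<longrightarrow>
        FAr F (g \<cdot>\<^bsub>C\<^esub> f) = FAr F g \<cdot>\<^bsub>D\<^esub> FAr F f)"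

definition id_funct :: "('o, 'a, 'o, 'a) funct" where
  "id_funct = \<lparr>FOb = (\<lambda>x. x), FAr = (\<lambda>f. f)\<rparr>"

definition comp_funct ::
    "('p, 'b, 'q, 'c) funct \<Rightarrow> ('o, 'a, 'p, 'b) funct \<Rightarrow> ('o, 'a, 'q, 'c) funct"
    (infixr "\<circ>\<^sub>F" 75) where
  "G \<circ>\<^sub>F F = \<lparr>FOb = FOb G \<circ> FOb F, FAr = FAr G \<circ> FAr F\<rparr>"

definition nat_trans ::
    "('o, 'a) cat \<Rightarrow> ('p, 'b) cat \<Rightarrow> ('o, 'a, 'p, 'b) funct \<Rightarrow> ('o, 'a, 'p, 'b) funct
      \<Rightarrow> ('o \<Rightarrow> 'b) \<Rightarrow> bool" where
  "nat_trans C D F G \<tau> \<longleftrightarrow> is_functor C D F \<and> is_functor C D G \<and>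
     (\<forall>x \<in> Obj C. \<tau> x \<in> hom D (FOb F x) (FOb G x)) \<and>
     (\<forall>f \<in> Arr C. \<tau> (Cod C f) \<cdot>\<^bsub>D\<^esub> FAr F f = FAr G f \<cdot>\<^bsub>D\<^esub> \<tau> (Dom C f))"

definition nat_iso ::
    "('o, 'a) cat \<Rightarrow> ('p, 'b) cat \<Rightarrow> ('o, 'a, 'p, 'b) funct \<Rightarrow> ('o, 'a, 'p, 'b) funct
      \<Rightarrow> ('o \<Rightarrow> 'b) \<Rightarrow> bool" where
  "nat_iso C D F G \<tau> \<longleftrightarrow> nat_trans C D F G \<tau> \<and> (\<forall>x \<in> Obj C. iso D (\<tau> x))"

definition fully_faithful ::
    "('o, 'a) cat \<Rightarrow> ('p, 'b) cat \<Rightarrow> ('o, 'a, 'p, 'b) funct \<Rightarrow> bool" where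
  "fully_faithful C D F \<longleftrightarrow> is_functor C D F \<and>
     (\<forall>x \<in> Obj C. \<forall>y \<in> Obj C. bij_betw (FAr F) (hom C x y) (hom D (FOb F x) (FOb F y)))"

definition is_equivalence ::
    "('o, 'a) cat \<Rightarrow> ('p, 'b) cat \<Rightarrow> ('o, 'a, 'p, 'b) funct \<Rightarrow> bool" where
  "is_equivalence C D F \<longleftrightarrow> is_functor C D F \<and>
     (\<exists>G. is_functor D C G \<and>
        (\<exists>\<eta>. nat_iso C C id_funct (G \<circ>\<^sub>F F) \<eta>) \<and>
        (\<exists>\<epsilon>. nat_iso D D (F \<circ>\<^sub>F G) id_funct \<epsilon>))"


section \<open>Pullbacks\<close>

text \<open>\<open>is_pullback X f g u v\<close>: the square with \<open>f \<cdot> u = g \<cdot> v\<close> is a pullback; \<open>u\<close> is the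
  projection to the domain of \<open>f\<close> and \<open>v\<close> the projection to the domain of \<open>g\<close>.\<close>

definition is_pullback :: "('o, 'a) cat \<Rightarrow> 'a \<Rightarrow> 'a \<Rightarrow> 'a \<Rightarrow> 'a \<Rightarrow> bool" where
  "is_pullback X f g u v \<longleftrightarrow>
     f \<in> Arr X \<and> g \<in> Arr X \<and> Cod X f = Cod X g \<and>
     u \<in> hom X (Dom X u) (Dom X f) \<and> v \<in> hom X (Dom X u) (Dom X g) \<and>
     f \<cdot>\<^bsub>X\<^esub> u = g \<cdot>\<^bsub>X\<^esub> v \<and>
     (\<forall>w \<in> Obj X. \<forall>s \<in> hom X w (Dom X f). \<forall>t \<in> hom X w (Dom X g).
        f \<cdot>\<^bsub>X\<^esub> s = g \<cdot>\<^bsub>X\<^esub> t \<longrightarrow>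
        (\<exists>!h. h \<in> hom X w (Dom X u) \<and> u \<cdot>\<^bsub>X\<^esub> h = s \<and> v \<cdot>\<^bsub>X\<^esub> h = t))"

definition has_pullbacks :: "('o, 'a) cat \<Rightarrow> bool" where
  "has_pullbacks X \<longleftrightarrow>
     (\<forall>f \<in> Arr X. \<forall>g \<in> Arr X. Cod X f = Cod X g \<longrightarrow> (\<exists>u v. is_pullback X f g u v))"

definition preserves_pullbacks ::
    "('o, 'a) cat \<Rightarrow> ('p, 'b) cat \<Rightarrow> ('o, 'a, 'p, 'b) funct \<Rightarrow> bool" where
  "preserves_pullbacks C D F \<longleftrightarrow>
     (\<forall>f g u v. is_pullback C f g u v \<longrightarrow>
        is_pullback D (FAr F f) (FAr F g) (FAr F u) (FAr F v))"

text \<open>Pullbacks are chosen once and for all by Hilbert choice; \<open>pb1\<close> and \<open>pb2\<close> are the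
  projections, and \<open>pb_lift X f g s t\<close> is the arrow into the chosen pullback induced by \<open>s\<close>
  and \<open>t\<close>.\<close>

definition pb :: "('o, 'a) cat \<Rightarrow> 'a \<Rightarrow> 'a \<Rightarrow> 'a \<times> 'a" where
  "pb X f g = (SOME (u, v). is_pullback X f g u v)"

definition pb1 :: "('o, 'a) cat \<Rightarrow> 'a \<Rightarrow> 'a \<Rightarrow> 'a" where
  "pb1 X f g = fst (pb X f g)"

definition pb2 :: "('o, 'a) cat \<Rightarrow> 'a \<Rightarrow> 'a \<Rightarrow> 'a" where
  "pb2 X f g = snd (pb X f g)"

definition pb_lift :: "('o, 'a) cat \<Rightarrow> 'a \<Rightarrow> 'a \<Rightarrow> 'a \<Rightarrow> 'a \<Rightarrow> 'a" where
  "pb_lift X f g s t =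
     (THE h. h \<in> hom X (Dom X s) (Dom X (pb1 X f g)) \<and>
             pb1 X f g \<cdot>\<^bsub>X\<^esub> h = s \<and> pb2 X f g \<cdot>\<^bsub>X\<^esub> h = t)"


section \<open>Pseudofunctors into CAT\<close>

text \<open>The comparison isomorphisms are given by their components:
  \<open>PUnit P k : id \<Rightarrow> P(id\<^sub>k)\<close> and \<open>PMult P g f : P(g) P(f) \<Rightarrow> P(g f)\<close>.\<close>

record ('k, 'm, 'o, 'a) psfunct =
  PObj :: "'k \<Rightarrow> ('o, 'a) cat"
  PArr :: "'m \<Rightarrow> ('o, 'a, 'o, 'a) funct"
  PUnit :: "'k \<Rightarrow> 'o \<Rightarrow> 'a"
  PMult :: "'m \<Rightarrow> 'm \<Rightarrow> 'o \<Rightarrow> 'a"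

definition is_pseudofunctor :: "('k, 'm) cat \<Rightarrow> ('k, 'm, 'o, 'a) psfunct \<Rightarrow> bool" where
  "is_pseudofunctor K P \<longleftrightarrow> category K \<and>
     (\<forall>k \<in> Obj K. category (PObj P k)) \<and>
     (\<forall>f \<in> Arr K. is_functor (PObj P (Dom K f)) (PObj P (Cod K f)) (PArr P f)) \<and>
     (\<forall>k \<in> Obj K. nat_iso (PObj P k) (PObj P k) id_funct (PArr P (Ide K k)) (PUnit P k)) \<and>
     (\<forall>f \<in> Arr K. \<forall>g \<in> Arr K. Cod K f = Dom K g \<longrightarrow>
        nat_iso (PObj P (Dom K f)) (PObj P (Cod K g))
          (PArr P g \<circ>\<^sub>F PArr P f) (PArr P (g \<cdot>\<^bsub>K\<^esub> f)) (PMult P g f)) \<and>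
     (\<forall>f \<in> Arr K. \<forall>x \<in> Obj (PObj P (Dom K f)).
        PMult P f (Ide K (Dom K f)) x
            \<cdot>\<^bsub>PObj P (Cod K f)\<^esub> FAr (PArr P f) (PUnit P (Dom K f) x)
          = Ide (PObj P (Cod K f)) (FOb (PArr P f) x) \<and>
        PMult P (Ide K (Cod K f)) f x
            \<cdot>\<^bsub>PObj P (Cod K f)\<^esub> PUnit P (Cod K f) (FOb (PArr P f) x)
          = Ide (PObj P (Cod K f)) (FOb (PArr P f) x)) \<and>
     (\<forall>f \<in> Arr K. \<forall>g \<in> Arr K. \<forall>h \<in> Arr K. Cod K f = Dom K g \<longrightarrow> Cod K g = Dom K h \<longrightarrow>
        (\<forall>x \<in> Obj (PObj P (Dom K f)).
           PMult P h (g \<cdot>\<^bsub>K\<^esub> f) x \<cdot>\<^bsub>PObj P (Cod K h)\<^esub> FAr (PArr P h) (PMult P g f x)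
             = PMult P (h \<cdot>\<^bsub>K\<^esub> g) f x \<cdot>\<^bsub>PObj P (Cod K h)\<^esub> PMult P h g (FOb (PArr P f) x)))"

definition const_ps :: "('o, 'a) cat \<Rightarrow> ('k, 'm, 'o, 'a) psfunct" where
  "const_ps C = \<lparr>PObj = (\<lambda>_. C), PArr = (\<lambda>_. id_funct),
                 PUnit = (\<lambda>_. Ide C), PMult = (\<lambda>_ _. Ide C)\<rparr>"

definition ps_precomp ::
    "('k, 'm, 'o, 'a) psfunct \<Rightarrow> ('j, 'l, 'k, 'm) funct \<Rightarrow> ('j, 'l, 'o, 'a) psfunct" where
  "ps_precomp P F = \<lparr>PObj = (\<lambda>j. PObj P (FOb F j)), PArr = (\<lambda>f. PArr P (FAr F f)),
                     PUnit = (\<lambda>j. PUnit P (FOb F j)),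
                     PMult = (\<lambda>g f. PMult P (FAr F g) (FAr F f))\<rparr>"

text \<open>A pseudonatural transformation \<open>\<alpha> : P \<Rightarrow> Q\<close> has functors \<open>\<alpha>\<^sub>k : P(k) \<rightarrow> Q(k)\<close> (\<open>NOb\<close>) and
  invertible 2-cells \<open>\<alpha>\<^sub>f : Q(f) \<alpha>\<^sub>j \<Rightarrow> \<alpha>\<^sub>k P(f)\<close> (\<open>NAr\<close>) for \<open>f : j \<rightarrow> k\<close>.  All data are required to
  be \<^const>\<open>extensional\<close>, so that equality of transformations and of modifications is equality
  on the actual domains.\<close>

record ('k, 'm, 'o, 'a, 'p, 'b) psnat =
  NOb :: "'k \<Rightarrow> ('o, 'a, 'p, 'b) funct"
  NAr :: "'m \<Rightarrow> 'o \<Rightarrow> 'b"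

definition is_psnat ::
    "('k, 'm) cat \<Rightarrow> ('k, 'm, 'o, 'a) psfunct \<Rightarrow> ('k, 'm, 'p, 'b) psfunct
      \<Rightarrow> ('k, 'm, 'o, 'a, 'p, 'b) psnat \<Rightarrow> bool" where
  "is_psnat K P Q \<alpha> \<longleftrightarrow>
     NOb \<alpha> \<in> extensional (Obj K) \<and> NAr \<alpha> \<in> extensional (Arr K) \<and>
     (\<forall>k \<in> Obj K. is_functor (PObj P k) (PObj Q k) (NOb \<alpha> k) \<and>
        FOb (NOb \<alpha> k) \<in> extensional (Obj (PObj P k)) \<and>
        FAr (NOb \<alpha> k) \<in> extensional (Arr (PObj P k))) \<and>
     (\<forall>f \<in> Arr K.
        nat_iso (PObj P (Dom K f)) (PObj Q (Cod K f))
          (PArr Q f \<circ>\<^sub>F NOb \<alpha> (Dom K f)) (NOb \<alpha> (Cod K f) \<circ>\<^sub>F PArr P f) (NAr \<alpha> f) \<and>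
        NAr \<alpha> f \<in> extensional (Obj (PObj P (Dom K f)))) \<and>
     (\<forall>k \<in> Obj K. \<forall>x \<in> Obj (PObj P k).
        NAr \<alpha> (Ide K k) x \<cdot>\<^bsub>PObj Q k\<^esub> PUnit Q k (FOb (NOb \<alpha> k) x)
          = FAr (NOb \<alpha> k) (PUnit P k x)) \<and>
     (\<forall>f \<in> Arr K. \<forall>g \<in> Arr K. Cod K f = Dom K g \<longrightarrow>
        (\<forall>x \<in> Obj (PObj P (Dom K f)).
           NAr \<alpha> (g \<cdot>\<^bsub>K\<^esub> f) x \<cdot>\<^bsub>PObj Q (Cod K g)\<^esub> PMult Q g f (FOb (NOb \<alpha> (Dom K f)) x)
             = FAr (NOb \<alpha> (Cod K g)) (PMult P g f x)
                 \<cdot>\<^bsub>PObj Q (Cod K g)\<^esub> NAr \<alpha> g (FOb (PArr P f) x)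
                 \<cdot>\<^bsub>PObj Q (Cod K g)\<^esub> FAr (PArr Q g) (NAr \<alpha> f x)))"

definition is_modification ::
    "('k, 'm) cat \<Rightarrow> ('k, 'm, 'o, 'a) psfunct \<Rightarrow> ('k, 'm, 'p, 'b) psfunct
      \<Rightarrow> ('k, 'm, 'o, 'a, 'p, 'b) psnat \<Rightarrow> ('k, 'm, 'o, 'a, 'p, 'b) psnat
      \<Rightarrow> ('k \<Rightarrow> 'o \<Rightarrow> 'b) \<Rightarrow> bool" where
  "is_modification K P Q \<alpha> \<beta> \<Gamma> \<longleftrightarrow>
     \<Gamma> \<in> extensional (Obj K) \<and>
     (\<forall>k \<in> Obj K. nat_trans (PObj P k) (PObj Q k) (NOb \<alpha> k) (NOb \<beta> k) (\<Gamma> k) \<and>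
        \<Gamma> k \<in> extensional (Obj (PObj P k))) \<and>
     (\<forall>f \<in> Arr K. \<forall>x \<in> Obj (PObj P (Dom K f)).
        \<Gamma> (Cod K f) (FOb (PArr P f) x) \<cdot>\<^bsub>PObj Q (Cod K f)\<^esub> NAr \<alpha> f x
          = NAr \<beta> f x \<cdot>\<^bsub>PObj Q (Cod K f)\<^esub> FAr (PArr Q f) (\<Gamma> (Dom K f) x))"

definition psnat_cat ::
    "('k, 'm) cat \<Rightarrow> ('k, 'm, 'o, 'a) psfunct \<Rightarrow> ('k, 'm, 'p, 'b) psfunct \<Rightarrow>
      (('k, 'm, 'o, 'a, 'p, 'b) psnat,
       ('k, 'm, 'o, 'a, 'p, 'b) psnat \<times> ('k \<Rightarrow> 'o \<Rightarrow> 'b) \<times> ('k, 'm, 'o, 'a, 'p, 'b) psnat) cat"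
  where
  "psnat_cat K P Q =
     \<lparr>Obj = {\<alpha>. is_psnat K P Q \<alpha>},
      Arr = {(\<alpha>, \<Gamma>, \<beta>). is_psnat K P Q \<alpha> \<and> is_psnat K P Q \<beta> \<and> is_modification K P Q \<alpha> \<beta> \<Gamma>},
      Dom = (\<lambda>(\<alpha>, _, _). \<alpha>),
      Cod = (\<lambda>(_, _, \<beta>). \<beta>),
      Ide = (\<lambda>\<alpha>. (\<alpha>, (\<lambda>k \<in> Obj K. \<lambda>x \<in> Obj (PObj P k). Ide (PObj Q k) (FOb (NOb \<alpha> k) x)), \<alpha>)),
      Cmp = (\<lambda>(_, \<Delta>, \<gamma>) (\<alpha>, \<Gamma>, _).
               (\<alpha>, (\<lambda>k \<in> Obj K. \<lambda>x \<in> Obj (PObj P k). \<Delta> k x \<cdot>\<^bsub>PObj Q k\<^esub> \<Gamma> k x), \<gamma>))\<rparr>"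


section \<open>The basic fibration\<close>

text \<open>Objects of \<open>X/B\<close> are arrows of \<open>X\<close> with codomain \<open>B\<close>; an arrow \<open>(f, h, g)\<close> is \<open>h : f \<rightarrow> g\<close>.\<close>

definition slice :: "('o, 'a) cat \<Rightarrow> 'o \<Rightarrow> ('a, 'a \<times> 'a \<times> 'a) cat" where
  "slice X B =
     \<lparr>Obj = {f \<in> Arr X. Cod X f = B},
      Arr = {(f, h, g). f \<in> Arr X \<and> Cod X f = B \<and> g \<in> Arr X \<and> Cod X g = B \<and>
                        h \<in> hom X (Dom X f) (Dom X g) \<and> g \<cdot>\<^bsub>X\<^esub> h = f},
      Dom = (\<lambda>(f, _, _). f),
      Cod = (\<lambda>(_, _, g). g),
      Ide = (\<lambda>f. (f, Ide X (Dom X f), f)),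
      Cmp = (\<lambda>(_, k, g) (f, h, _). (f, k \<cdot>\<^bsub>X\<^esub> h, g))\<rparr>"

definition pullback_funct ::
    "('o, 'a) cat \<Rightarrow> 'a \<Rightarrow> ('a, 'a \<times> 'a \<times> 'a, 'a, 'a \<times> 'a \<times> 'a) funct" where
  "pullback_funct X p =
     \<lparr>FOb = (\<lambda>f. pb1 X p f),
      FAr = (\<lambda>(f, h, g).
        (pb1 X p f, pb_lift X p g (pb1 X p f) (h \<cdot>\<^bsub>X\<^esub> pb2 X p f), pb1 X p g))\<rparr>"

text \<open>A pseudofunctor on \<^term>\<open>opp X\<close>: \<open>PMult q p\<close> is the isomorphism \<open>q\<^sup>* p\<^sup>* \<cong> (p q)\<^sup>*\<close>.\<close>

definition basic_fibration :: "('o, 'a) cat \<Rightarrow> ('o, 'a, 'a, 'a \<times> 'a \<times> 'a) psfunct" where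
  "basic_fibration X =
     \<lparr>PObj = slice X,
      PArr = pullback_funct X,
      PUnit = (\<lambda>B f. (f, pb_lift X (Ide X B) f f (Ide X (Dom X f)), pb1 X (Ide X B) f)),
      PMult = (\<lambda>q p f.
        (pb1 X q (pb1 X p f),
         pb_lift X (p \<cdot>\<^bsub>X\<^esub> q) f (pb1 X q (pb1 X p f)) (pb2 X p f \<cdot>\<^bsub>X\<^esub> pb2 X q (pb1 X p f)),
         pb1 X (p \<cdot>\<^bsub>X\<^esub> q) f))\<rparr>"


section \<open>Finite ordinals and the descent category\<close>

text \<open>\<open>Delta_dot\<close> is the category of finite ordinals \<open>n = {0,\<dots>,n-1}\<close> (including \<open>0\<close>).\<close>

definition Delta_dot :: "(nat, nat \<times> (nat \<Rightarrow> nat) \<times> nat) cat" where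
  "Delta_dot =
     \<lparr>Obj = UNIV,
      Arr = {(m, f, n). f \<in> {..<m} \<rightarrow>\<^sub>E {..<n} \<and> mono_on {..<m} f},
      Dom = (\<lambda>(m, _, _). m),
      Cod = (\<lambda>(_, _, n). n),
      Ide = (\<lambda>n. (n, (\<lambda>i \<in> {..<n}. i), n)),
      Cmp = (\<lambda>(_, g, n) (m, f, _). (m, compose {..<m} g f, n))\<rparr>"

definition Delta :: "(nat, nat \<times> (nat \<Rightarrow> nat) \<times> nat) cat" where
  "Delta = full_subcategory Delta_dot {n. n \<noteq> 0}"

definition from_zero :: "nat \<Rightarrow> nat \<times> (nat \<Rightarrow> nat) \<times> nat" where
  "from_zero n = (0, (\<lambda>i \<in> {..<0}. i), n)"

text \<open>\<open>pow_leg X p n\<close> is the structure map to \<open>B\<close> of the \<open>n\<close>-fold iterated pullback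
  \<open>E \<times>\<^sub>B \<dots> \<times>\<^sub>B E\<close> of \<open>p : E \<rightarrow> B\<close>, and \<open>pow_proj X p n i\<close> (for \<open>i < n\<close>) its \<open>i\<close>-th projection to \<open>E\<close>.\<close>

fun pow_leg :: "('o, 'a) cat \<Rightarrow> 'a \<Rightarrow> nat \<Rightarrow> 'a" where
  "pow_leg X p 0 = Ide X (Cod X p)"
| "pow_leg X p (Suc 0) = p"
| "pow_leg X p (Suc (Suc n)) = pow_leg X p (Suc n) \<cdot>\<^bsub>X\<^esub> pb1 X (pow_leg X p (Suc n)) p"

fun pow_proj :: "('o, 'a) cat \<Rightarrow> 'a \<Rightarrow> nat \<Rightarrow> nat \<Rightarrow> 'a" where
  "pow_proj X p 0 i = undefined"
| "pow_proj X p (Suc 0) i = Ide X (Dom X p)"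
| "pow_proj X p (Suc (Suc n)) i =
     (if i = Suc n then pb2 X (pow_leg X p (Suc n)) p
      else pow_proj X p (Suc n) i \<cdot>\<^bsub>X\<^esub> pb1 X (pow_leg X p (Suc n)) p)"

text \<open>\<open>D\<^sub>p : Delta_dot\<^sup>o\<^sup>p \<rightarrow> X\<close>.  A map \<open>\<phi> : m \<rightarrow> n\<close> is sent to the arrow from the \<open>n\<close>-fold to the
  \<open>m\<close>-fold power over \<open>B\<close> whose \<open>i\<close>-th coordinate is the \<open>\<phi>(i)\<close>-th projection; these are the maps
  built from \<open>p\<close>, projections and diagonals.\<close>

definition diagram ::
    "('o, 'a) cat \<Rightarrow> 'a \<Rightarrow> (nat, nat \<times> (nat \<Rightarrow> nat) \<times> nat, 'o, 'a) funct" where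
  "diagram X p =
     \<lparr>FOb = (\<lambda>n. Dom X (pow_leg X p n)),
      FAr = (\<lambda>(m, \<phi>, n).
        (THE h. h \<in> hom X (Dom X (pow_leg X p n)) (Dom X (pow_leg X p m)) \<and>
                pow_leg X p m \<cdot>\<^bsub>X\<^esub> h = pow_leg X p n \<and>
                (\<forall>i < m. pow_proj X p m i \<cdot>\<^bsub>X\<^esub> h = pow_proj X p n (\<phi> i))))\<rparr>"

text \<open>\<open>A\<^sub>p : Delta_dot \<rightarrow> CAT\<close>; the data of \<open>D\<^sub>p : Delta_dot\<^sup>o\<^sup>p \<rightarrow> X\<close> are also those of a functor
  \<open>Delta_dot \<rightarrow> X\<^sup>o\<^sup>p\<close>, along which the basic fibration is restricted.\<close>

definition descent_ps ::
    "('o, 'a) cat \<Rightarrow> 'a \<Rightarrow> (nat, nat \<times> (nat \<Rightarrow> nat) \<times> nat, 'a, 'a \<times> 'a \<times> 'a) psfunct" where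
  "descent_ps X p = ps_precomp (basic_fibration X) (diagram X p)"

type_synonym ('p, 'b) desc_obj =
  "(nat, nat \<times> (nat \<Rightarrow> nat) \<times> nat, unit, unit, 'p, 'b) psnat"

type_synonym ('p, 'b) desc_arr =
  "('p, 'b) desc_obj \<times> (nat \<Rightarrow> unit \<Rightarrow> 'b) \<times> ('p, 'b) desc_obj"

text \<open>Restriction to \<open>Delta\<close> is precomposition with the inclusion \<open>Delta \<rightarrow> Delta_dot\<close>, whose data
  are those of \<^const>\<open>id_funct\<close>.\<close>

definition desc_cat ::
    "(nat, nat \<times> (nat \<Rightarrow> nat) \<times> nat, 'p, 'b) psfunct
      \<Rightarrow> (('p, 'b) desc_obj, ('p, 'b) desc_arr) cat" where
  "desc_cat A = psnat_cat Delta (const_ps terminal_cat) (ps_precomp A id_funct)"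

text \<open>The comparison \<open>A(0) \<rightarrow> desc_cat A\<close> sends \<open>x\<close> to the family \<open>A(0 \<rightarrow> n)(x)\<close>, with
  \<open>A(\<phi>) A(0 \<rightarrow> m)(x) \<cong> A(0 \<rightarrow> n)(x)\<close>, for \<open>\<phi> : m \<rightarrow> n\<close>, given by the pseudofunctor structure.\<close>

definition comparison_obj ::
    "(nat, nat \<times> (nat \<Rightarrow> nat) \<times> nat, 'p, 'b) psfunct \<Rightarrow> 'p \<Rightarrow> ('p, 'b) desc_obj" where
  "comparison_obj A x =
     \<lparr>NOb = (\<lambda>n \<in> Obj Delta.
        \<lparr>FOb = (\<lambda>_. FOb (PArr A (from_zero n)) x),
         FAr = (\<lambda>_. Ide (PObj A n) (FOb (PArr A (from_zero n)) x))\<rparr>),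
      NAr = (\<lambda>\<phi> \<in> Arr Delta. \<lambda>_. PMult A \<phi> (from_zero (Dom Delta \<phi>)) x)\<rparr>"

definition comparison ::
    "(nat, nat \<times> (nat \<Rightarrow> nat) \<times> nat, 'p, 'b) psfunct
      \<Rightarrow> ('p, 'b, ('p, 'b) desc_obj, ('p, 'b) desc_arr) funct" where
  "comparison A =
     \<lparr>FOb = comparison_obj A,
      FAr = (\<lambda>h. (comparison_obj A (Dom (PObj A 0) h),
                  (\<lambda>n \<in> Obj Delta. \<lambda>_. FAr (PArr A (from_zero n)) h),
                  comparison_obj A (Cod (PObj A 0) h)))\<rparr>"

definition effective_descent :: "('o, 'a) cat \<Rightarrow> 'a \<Rightarrow> bool" where
  "effective_descent X p \<longleftrightarrow> p \<in> Arr X \<and>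
     is_equivalence (slice X (Cod X p)) (desc_cat (descent_ps X p)) (comparison (descent_ps X p))"

definition descent_morphism :: "('o, 'a) cat \<Rightarrow> 'a \<Rightarrow> bool" where
  "descent_morphism X p \<longleftrightarrow> p \<in> Arr X \<and>
     fully_faithful (slice X (Cod X p)) (desc_cat (descent_ps X p)) (comparison (descent_ps X p))"


section \<open>Pseudopullbacks of categories\<close>

definition iso_comma ::
    "('c, 'ac) cat \<Rightarrow> ('d, 'ad) cat \<Rightarrow> ('e, 'ae) cat \<Rightarrow>
      ('c, 'ac, 'e, 'ae) funct \<Rightarrow> ('d, 'ad, 'e, 'ae) funct \<Rightarrow>
      ('c \<times> 'd \<times> 'ae, ('c \<times> 'd \<times> 'ae) \<times> ('ac \<times> 'ad) \<times> ('c \<times> 'd \<times> 'ae)) cat" where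
  "iso_comma C D E F G =
     (let Ob = {(c, d, \<theta>). c \<in> Obj C \<and> d \<in> Obj D \<and> \<theta> \<in> hom E (FOb F c) (FOb G d) \<and> iso E \<theta>} in
      \<lparr>Obj = Ob,
       Arr = {((c, d, \<theta>), (u, v), (c', d', \<theta>')).
                (c, d, \<theta>) \<in> Ob \<and> (c', d', \<theta>') \<in> Ob \<and> u \<in> hom C c c' \<and> v \<in> hom D d d' \<and>
                \<theta>' \<cdot>\<^bsub>E\<^esub> FAr F u = FAr G v \<cdot>\<^bsub>E\<^esub> \<theta>},
       Dom = (\<lambda>(x, _, _). x),
       Cod = (\<lambda>(_, _, y). y),
       Ide = (\<lambda>(c, d, \<theta>). ((c, d, \<theta>), (Ide C c, Ide D d), (c, d, \<theta>))),
       Cmp = (\<lambda>(_, (u', v'), z) (x, (u, v), _). (x, (u' \<cdot>\<^bsub>C\<^esub> u, v' \<cdot>\<^bsub>D\<^esub> v), z))\<rparr>)"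

definition into_iso_comma ::
    "('b, 'ab) cat \<Rightarrow> ('b, 'ab, 'c, 'ac) funct \<Rightarrow> ('b, 'ab, 'd, 'ad) funct \<Rightarrow> ('b \<Rightarrow> 'ae) \<Rightarrow>
      ('b, 'ab, 'c \<times> 'd \<times> 'ae, ('c \<times> 'd \<times> 'ae) \<times> ('ac \<times> 'ad) \<times> ('c \<times> 'd \<times> 'ae)) funct" where
  "into_iso_comma B S Z \<sigma> =
     (let K = (\<lambda>b. (FOb S b, FOb Z b, \<sigma> b)) in
      \<lparr>FOb = K, FAr = (\<lambda>f. (K (Dom B f), (FAr S f, FAr Z f), K (Cod B f)))\<rparr>)"

definition is_pseudopullback ::
    "('b, 'ab) cat \<Rightarrow> ('c, 'ac) cat \<Rightarrow> ('d, 'ad) cat \<Rightarrow> ('e, 'ae) cat \<Rightarrow>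
      ('b, 'ab, 'c, 'ac) funct \<Rightarrow> ('b, 'ab, 'd, 'ad) funct \<Rightarrow>
      ('c, 'ac, 'e, 'ae) funct \<Rightarrow> ('d, 'ad, 'e, 'ae) funct \<Rightarrow> ('b \<Rightarrow> 'ae) \<Rightarrow> bool" where
  "is_pseudopullback B C D E S Z F G \<sigma> \<longleftrightarrow>
     nat_iso B E (F \<circ>\<^sub>F S) (G \<circ>\<^sub>F Z) \<sigma> \<and>
     is_equivalence B (iso_comma C D E F G) (into_iso_comma B S Z \<sigma>)"

end

theory Submission
  imports Defs
begin

text \<open>Fix \<open>p : E \<rightarrow> B\<close>. A descent datum is determined by its value \<open>c : C \<rightarrow> E\<close> at \<open>1\<close> together
  with an algebra structure \<open>\<xi> : C \<times>\<^sub>B E \<rightarrow> C\<close> for the monad of \<open>p\<close>: the element \<open>\<xi>(x, e)\<close> is obtained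
  from \<open>x\<close> by the two coface maps \<open>1 \<rightarrow> 2\<close>. So \<open>p\<close> is a descent morphism if and only if every pullback
  of \<open>p\<close> along some \<open>f : A \<rightarrow> B\<close> is, over \<open>B\<close>, a coequalizer of its kernel pair, and it is of effective
  descent if and only if moreover every algebra arises from a pullback square \<open>p c = f q\<close>, with
  \<open>q \<xi>(x, e) = q x\<close>.

  Both conditions only involve finite limits and pass through the pseudopullback. Solutions over
  \<open>S p\<close> and over \<open>Z p\<close> are sent by \<open>F\<close> and \<open>G\<close> to solutions over \<open>F S p\<close>, which agree up to a unique
  isomorphism because \<open>F S p\<close> is a descent morphism; hence they glue to a solution over \<open>p\<close>.\<close>

section \<open>Categories and pullbacks\<close>

text \<open>The functors preserve pullback squares but not the chosen pullbacks from which
  \<open>descent_ps\<close> is built. This is why \<open>coequalizing\<close> and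
  \<open>action\<close> speak about arbitrary squares \<open>is_pullback\<close>, and why choices
  disappear once \<open>effective_descent_iff\<close> is reached. On the way there, a descent datum
  is read on generalized elements: its isomorphism for \<phi> becomes a transport of elements,
  natural in the stage, and after \<open>push_push\<close> the coherence isomorphisms between
  iterated pullbacks are gone. Transport along the points 1 \<rightarrow> n is bijective, so
  everything over n is determined over 1; the ordinal 2 supplies the action and the ordinal 3 its
  associativity. The descent property of F S p enters twice. In lifting coequalizers, its uniqueness
  half shows that the solutions found in C and D are compatible with \<sigma>. In lifting actions,
  both halves produce the isomorphism \<theta> to which essential surjectivity of the pseudopullback
  is applied. Since F S p and G Z p are only isomorphic, squares coming from D are first moved along
  \<sigma>.\<close>

declare hom_def [simp]

context category
begin

lemma Cmp_simps [simp]: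
  assumes "f \<in> Arr C" "g \<in> Arr C" "Cod C f = Dom C g"
  shows "g \<cdot> f \<in> Arr C" "Dom C (g \<cdot> f) = Dom C f" "Cod C (g \<cdot> f) = Cod C g"
  using Cmp_hom[of f "Dom C f" "Cod C f" g "Cod C g"] assms by auto

lemma assoc [simp]:
  assumes "f \<in> Arr C" "g \<in> Arr C" "h \<in> Arr C" "Cod C f = Dom C g" "Cod C g = Dom C h"
  shows "(h \<cdot> g) \<cdot> f = h \<cdot> (g \<cdot> f)"
  using Cmp_assoc[of f "Dom C f" "Cod C f" g "Cod C g" h "Cod C h"] assms by auto

lemma Ide_simps [simp]:
  assumes "x \<in> Obj C"
  shows "Ide C x \<in> Arr C" "Dom C (Ide C x) = x" "Cod C (Ide C x) = x"
  using Ide_hom[OF assms] by auto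

lemma Dom_Cod_Obj [simp]:
  assumes "f \<in> Arr C" shows "Dom C f \<in> Obj C" "Cod C f \<in> Obj C"
  using Dom_Obj Cod_Obj assms by auto

lemma Cmp_Ide_simp [simp]: "f \<in> Arr C \<Longrightarrow> Dom C f = x \<Longrightarrow> f \<cdot> Ide C x = f"
  using Cmp_Ide by auto

lemma Ide_Cmp_simp [simp]: "f \<in> Arr C \<Longrightarrow> Cod C f = x \<Longrightarrow> Ide C x \<cdot> f = f"
  using Ide_Cmp by auto

text \<open>\<open>assoc\<close> is a simp rule that nests composites to the right, after which an
  equation for \<open>g \<cdot> f\<close> no longer matches inside a longer chain. This is the form
  that does match; it serves whenever an equation is applied in the middle of a composite.\<close>

lemma reassoc:
  assumes "g \<cdot> f = k" "f \<in> Arr C" "g \<in> Arr C" "Cod C f = Dom C g" "x \<in> Arr C" "Cod C x = Dom C f"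
  shows "g \<cdot> (f \<cdot> x) = k \<cdot> x"
  using assms assoc[of x f g] by simp

lemma isoI:
  assumes "f \<in> Arr C" "g \<in> Arr C" "Dom C g = Cod C f" "Cod C g = Dom C f"
    "g \<cdot> f = Ide C (Dom C f)" "f \<cdot> g = Ide C (Cod C f)"
  shows "iso C f"
  using assms unfolding iso_def by auto

lemma isoE:
  assumes "iso C f"
  obtains g where "f \<in> Arr C" "g \<in> Arr C" "Dom C g = Cod C f" "Cod C g = Dom C f"
    "g \<cdot> f = Ide C (Dom C f)" "f \<cdot> g = Ide C (Cod C f)" "iso C g"
  using assms that unfolding iso_def by force

lemma iso_cancel:
  assumes "iso C i" "h \<in> Arr C" "k \<in> Arr C" "Dom C h = Dom C k" "Cod C h = Dom C i" "Cod C k = Dom C i"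
    "i \<cdot> h = i \<cdot> k"
  shows "h = k"
proof -
  obtain j where j: "i \<in> Arr C" "j \<in> Arr C" "Dom C j = Cod C i" "Cod C j = Dom C i" "j \<cdot> i = Ide C (Dom C i)"
    using assms(1) isoE by metis
  have "j \<cdot> (i \<cdot> h) = j \<cdot> (i \<cdot> k)" using assms by simp
  then show ?thesis using j assms(1-6) by (simp add: reassoc[OF j(5)])
qed

lemma iso_Cmp:
  assumes "iso C f" "iso C g" "Cod C f = Dom C g"
  shows "iso C (g \<cdot> f)"
proof -
  obtain f' where f: "f \<in> Arr C" "f' \<in> Arr C" "Dom C f' = Cod C f" "Cod C f' = Dom C f"
    "f' \<cdot> f = Ide C (Dom C f)" "f \<cdot> f' = Ide C (Cod C f)" using assms(1) isoE by metis
  obtain g' where g: "g \<in> Arr C" "g' \<in> Arr C" "Dom C g' = Cod C g" "Cod C g' = Dom C g"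
    "g' \<cdot> g = Ide C (Dom C g)" "g \<cdot> g' = Ide C (Cod C g)" using assms(2) isoE by metis
  show ?thesis
    by (rule isoI[where g = "f' \<cdot> g'"])
      (use f g assms in \<open>simp_all add: reassoc[OF g(5)] reassoc[OF f(6)]\<close>)
qed

lemma is_pullbackD:
  assumes "is_pullback C f g u v"
  shows "f \<in> Arr C" "g \<in> Arr C" "Cod C g = Cod C f" "u \<in> Arr C" "v \<in> Arr C"
    "Dom C v = Dom C u" "Cod C u = Dom C f" "Cod C v = Dom C g" "g \<cdot> v = f \<cdot> u"
  using assms unfolding is_pullback_def by auto

lemma is_pullback_lift:
  assumes "is_pullback C f g u v" "s \<in> Arr C" "t \<in> Arr C" "Dom C s = Dom C t"
    "Cod C s = Dom C f" "Cod C t = Dom C g" "f \<cdot> s = g \<cdot> t"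
  obtains h where "h \<in> Arr C" "Dom C h = Dom C s" "Cod C h = Dom C u" "u \<cdot> h = s" "v \<cdot> h = t"
proof -
  have "\<exists>!h. h \<in> hom C (Dom C s) (Dom C u) \<and> u \<cdot> h = s \<and> v \<cdot> h = t"
    using assms unfolding is_pullback_def by auto
  then show thesis using that by auto
qed

lemma is_pullback_ext:
  assumes "is_pullback C f g u v" "h \<in> Arr C" "k \<in> Arr C" "Dom C h = Dom C k"
    "Cod C h = Dom C u" "Cod C k = Dom C u" "u \<cdot> h = u \<cdot> k" "v \<cdot> h = v \<cdot> k"
  shows "h = k"
proof -
  note P = is_pullbackD[OF assms(1)]
  have "f \<cdot> (u \<cdot> k) = g \<cdot> (v \<cdot> k)" using P assms by (simp add: reassoc[OF P(9)])
  then have "\<exists>!h. h \<in> hom C (Dom C k) (Dom C u) \<and> u \<cdot> h = u \<cdot> k \<and> v \<cdot> h = v \<cdot> k"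
    using assms(1) P assms(2-6) unfolding is_pullback_def by auto
  then show ?thesis using assms by auto
qed

lemma is_pullbackI:
  assumes "f \<in> Arr C" "g \<in> Arr C" "Cod C g = Cod C f" "u \<in> Arr C" "v \<in> Arr C"
    "Dom C v = Dom C u" "Cod C u = Dom C f" "Cod C v = Dom C g" "f \<cdot> u = g \<cdot> v"
    "\<And>s t. s \<in> Arr C \<Longrightarrow> t \<in> Arr C \<Longrightarrow> Dom C t = Dom C s \<Longrightarrow> Cod C s = Dom C f \<Longrightarrow> Cod C t = Dom C g
      \<Longrightarrow> f \<cdot> s = g \<cdot> t \<Longrightarrow> \<exists>h \<in> Arr C. Dom C h = Dom C s \<and> Cod C h = Dom C u \<and> u \<cdot> h = s \<and> v \<cdot> h = t"
    "\<And>h k. h \<in> Arr C \<Longrightarrow> k \<in> Arr C \<Longrightarrow> Dom C k = Dom C h \<Longrightarrow> Cod C h = Dom C u \<Longrightarrow> Cod C k = Dom C u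
      \<Longrightarrow> u \<cdot> h = u \<cdot> k \<Longrightarrow> v \<cdot> h = v \<cdot> k \<Longrightarrow> h = k"
  shows "is_pullback C f g u v"
proof -
  have "\<exists>!h. h \<in> hom C w (Dom C u) \<and> u \<cdot> h = s \<and> v \<cdot> h = t"
    if st: "s \<in> hom C w (Dom C f)" "t \<in> hom C w (Dom C g)" "f \<cdot> s = g \<cdot> t" for w s t
  proof -
    obtain h where h: "h \<in> hom C w (Dom C u)" "u \<cdot> h = s" "v \<cdot> h = t"
      using assms(10)[of s t] st by auto
    show ?thesis by (rule ex1I[of _ h]) (use h assms(11) in auto)
  qed
  moreover have "u \<in> hom C (Dom C u) (Dom C f)" "v \<in> hom C (Dom C u) (Dom C g)"
    using assms(4-8) by simp_all
  ultimately show ?thesis using assms(1-3,9) unfolding is_pullback_def by (simp del: hom_def)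
qed

end

locale pb_category = category X for X :: "('o, 'a) cat" (structure) +
  assumes pbs: "has_pullbacks X"
begin

lemma pb_is_pullback:
  assumes "f \<in> Arr X" "g \<in> Arr X" "Cod X g = Cod X f"
  shows "is_pullback X f g (pb1 X f g) (pb2 X f g)"
proof -
  have "\<exists>uv. case uv of (u, v) \<Rightarrow> is_pullback X f g u v"
    using pbs assms unfolding has_pullbacks_def by auto
  from someI_ex[OF this] show ?thesis
    unfolding pb1_def pb2_def pb_def case_prod_beta .
qed

lemma pb_simps [simp]:
  assumes "f \<in> Arr X" "g \<in> Arr X" "Cod X g = Cod X f"
  shows "pb1 X f g \<in> Arr X" "Cod X (pb1 X f g) = Dom X f"
    "pb2 X f g \<in> Arr X" "Dom X (pb2 X f g) = Dom X (pb1 X f g)" "Cod X (pb2 X f g) = Dom X g"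
    "g \<cdot> pb2 X f g = f \<cdot> pb1 X f g"
  using is_pullbackD[OF pb_is_pullback[OF assms]] by auto

lemma pb_comm_reassoc [simp]:
  assumes "f \<in> Arr X" "g \<in> Arr X" "Cod X g = Cod X f" "x \<in> Arr X" "Cod X x = Dom X (pb1 X f g)"
  shows "g \<cdot> (pb2 X f g \<cdot> x) = f \<cdot> (pb1 X f g \<cdot> x)"
  using assms reassoc[of g "pb2 X f g"] by simp

lemma pb_lift_props:
  assumes "f \<in> Arr X" "g \<in> Arr X" "Cod X g = Cod X f" "s \<in> Arr X" "t \<in> Arr X" "Dom X t = Dom X s"
    "Cod X s = Dom X f" "Cod X t = Dom X g" "g \<cdot> t = f \<cdot> s"
  shows "pb_lift X f g s t \<in> hom X (Dom X s) (Dom X (pb1 X f g)) \<and>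
     pb1 X f g \<cdot> pb_lift X f g s t = s \<and> pb2 X f g \<cdot> pb_lift X f g s t = t"
proof -
  have "\<exists>!h. h \<in> hom X (Dom X s) (Dom X (pb1 X f g)) \<and> pb1 X f g \<cdot> h = s \<and> pb2 X f g \<cdot> h = t"
    using pb_is_pullback[OF assms(1-3)] assms unfolding is_pullback_def by auto
  from theI'[OF this] show ?thesis unfolding pb_lift_def .
qed

lemma pb_lift_simps [simp]:
  assumes "f \<in> Arr X" "g \<in> Arr X" "Cod X g = Cod X f" "s \<in> Arr X" "t \<in> Arr X" "Dom X t = Dom X s"
    "Cod X s = Dom X f" "Cod X t = Dom X g" "g \<cdot> t = f \<cdot> s"
  shows "pb_lift X f g s t \<in> Arr X" "Dom X (pb_lift X f g s t) = Dom X s"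
    "Cod X (pb_lift X f g s t) = Dom X (pb1 X f g)"
    "pb1 X f g \<cdot> pb_lift X f g s t = s" "pb2 X f g \<cdot> pb_lift X f g s t = t"
  using pb_lift_props[OF assms] by auto

lemma pb_lift_reassoc [simp]:
  assumes "f \<in> Arr X" "g \<in> Arr X" "Cod X g = Cod X f" "s \<in> Arr X" "t \<in> Arr X" "Dom X t = Dom X s"
    "Cod X s = Dom X f" "Cod X t = Dom X g" "g \<cdot> t = f \<cdot> s" "x \<in> Arr X" "Cod X x = Dom X s"
  shows "pb1 X f g \<cdot> (pb_lift X f g s t \<cdot> x) = s \<cdot> x" "pb2 X f g \<cdot> (pb_lift X f g s t \<cdot> x) = t \<cdot> x"
  using assms reassoc[OF pb_lift_simps(4)[OF assms(1-9)]] reassoc[OF pb_lift_simps(5)[OF assms(1-9)]]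
  by simp_all

lemma pb_ext:
  assumes "pb1 X f g \<cdot> h = pb1 X f g \<cdot> k" "pb2 X f g \<cdot> h = pb2 X f g \<cdot> k"
    "f \<in> Arr X" "g \<in> Arr X" "Cod X g = Cod X f" "h \<in> Arr X" "k \<in> Arr X" "Dom X h = Dom X k"
    "Cod X h = Dom X (pb1 X f g)" "Cod X k = Dom X (pb1 X f g)"
  shows "h = k"
  using is_pullback_ext[OF pb_is_pullback[of f g]] assms by blast

lemma pb_lift_Cmp:
  assumes "f \<in> Arr X" "g \<in> Arr X" "Cod X g = Cod X f" "s \<in> Arr X" "t \<in> Arr X" "Dom X t = Dom X s"
    "Cod X s = Dom X f" "Cod X t = Dom X g" "g \<cdot> t = f \<cdot> s" "x \<in> Arr X" "Cod X x = Dom X s"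
  shows "pb_lift X f g s t \<cdot> x = pb_lift X f g (s \<cdot> x) (t \<cdot> x)"
proof -
  have e: "g \<cdot> (t \<cdot> x) = f \<cdot> (s \<cdot> x)" using assms reassoc[OF assms(9)] by simp
  show ?thesis by (rule pb_ext[of f g]) (use assms e in simp_all)
qed

end

section \<open>Slices and iterated pullbacks\<close>

lemma slice_simps [simp]:
  "Obj (slice X B) = {f \<in> Arr X. Cod X f = B}"
  "(f, h, g) \<in> Arr (slice X B) \<longleftrightarrow> f \<in> Arr X \<and> Cod X f = B \<and> g \<in> Arr X \<and> Cod X g = B \<and>
     h \<in> Arr X \<and> Dom X h = Dom X f \<and> Cod X h = Dom X g \<and> g \<cdot>\<^bsub>X\<^esub> h = f"
  "Dom (slice X B) (f, h, g) = f" "Cod (slice X B) (f, h, g) = g"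
  "Ide (slice X B) f = (f, Ide X (Dom X f), f)"
  "(g', k, g'') \<cdot>\<^bsub>slice X B\<^esub> (f, h, f') = (f, k \<cdot>\<^bsub>X\<^esub> h, g'')"
  by (auto simp: slice_def)

context category
begin

lemma category_slice: "category (slice C B)"
  by unfold_locales (auto simp: assoc[symmetric] simp del: assoc)

text \<open>An inverse \<open>k\<close> of \<open>h\<close> is automatically an arrow over the base,
  because f k = g h k = g.\<close>

lemma iso_slice:
  assumes "(f, h, g) \<in> Arr (slice C B)"
  shows "iso (slice C B) (f, h, g) \<longleftrightarrow> iso C h"
proof
  assume "iso C h"
  then obtain k where k: "h \<in> Arr C" "k \<in> Arr C" "Dom C k = Cod C h" "Cod C k = Dom C h"
    "k \<cdot> h = Ide C (Dom C h)" "h \<cdot> k = Ide C (Cod C h)" using isoE by metis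
  have "f \<cdot> k = g \<cdot> (h \<cdot> k)" using k(1-4) assms by (auto simp: assoc[symmetric] simp del: assoc)
  then have "f \<cdot> k = g" using k assms by auto
  then have "(g, k, f) \<in> hom (slice C B) g f" using k assms by auto
  then show "iso (slice C B) (f, h, g)"
  proof (intro category.isoI[OF category_slice, of _ _ "(g, k, f)"])
    show "(f, h, g) \<in> Arr (slice C B)" by (fact assms)
  qed (use assms k \<open>f \<cdot> k = g\<close> in simp_all)
next
  assume "iso (slice C B) (f, h, g)"
  then obtain a where a: "a \<in> hom (slice C B) (Cod (slice C B) (f, h, g)) (Dom (slice C B) (f, h, g))"
    "a \<cdot>\<^bsub>slice C B\<^esub> (f, h, g) = Ide (slice C B) (Dom (slice C B) (f, h, g))"
    "(f, h, g) \<cdot>\<^bsub>slice C B\<^esub> a = Ide (slice C B) (Cod (slice C B) (f, h, g))"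
    unfolding iso_def by blast
  obtain g' k f' where "a = (g', k, f')" by (cases a)
  then show "iso C h" using a assms isoI[of h k] by simp
qed

end

section \<open>Finite ordinals and monotone maps\<close>

abbreviation app :: "nat \<times> (nat \<Rightarrow> nat) \<times> nat \<Rightarrow> nat \<Rightarrow> nat" where
  "app \<phi> \<equiv> fst (snd \<phi>)"

lemma Delta_simps [simp]:
  "Obj Delta = {n. n \<noteq> 0}"
  "\<phi> \<in> Arr Delta \<longleftrightarrow> \<phi> \<in> Arr Delta_dot \<and> Dom Delta_dot \<phi> \<noteq> 0 \<and> Cod Delta_dot \<phi> \<noteq> 0"
  "Dom Delta = Dom Delta_dot" "Cod Delta = Cod Delta_dot" "Ide Delta = Ide Delta_dot"
  "Cmp Delta = Cmp Delta_dot" "Obj Delta_dot = UNIV"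
  by (auto simp: Delta_def full_subcategory_def Delta_dot_def)

lemma Delta_dot_triple: "\<phi> = (Dom Delta_dot \<phi>, app \<phi>, Cod Delta_dot \<phi>)"
  by (cases \<phi>) (simp add: Delta_dot_def)

lemma category_Delta_dot: "category Delta_dot"
proof
  fix f g x y z assume "f \<in> hom Delta_dot x y" "g \<in> hom Delta_dot y z"
  then show "g \<cdot>\<^bsub>Delta_dot\<^esub> f \<in> hom Delta_dot x z"
    by (auto simp: Delta_dot_def mono_on_def compose_def PiE_iff Pi_iff)
next
  fix f x y assume "f \<in> hom Delta_dot x y"
  then show "f \<cdot>\<^bsub>Delta_dot\<^esub> Ide Delta_dot x = f" "Ide Delta_dot y \<cdot>\<^bsub>Delta_dot\<^esub> f = f"
    by (auto simp: Delta_dot_def compose_def PiE_iff Pi_iff fun_eq_iff extensional_def)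
next
  fix f g h w x y z
  assume "f \<in> hom Delta_dot w x" "g \<in> hom Delta_dot x y" "h \<in> hom Delta_dot y z"
  then show "(h \<cdot>\<^bsub>Delta_dot\<^esub> g) \<cdot>\<^bsub>Delta_dot\<^esub> f = h \<cdot>\<^bsub>Delta_dot\<^esub> g \<cdot>\<^bsub>Delta_dot\<^esub> f"
    by (auto simp: Delta_dot_def compose_def PiE_iff Pi_iff fun_eq_iff extensional_def)
qed (auto simp: Delta_dot_def mono_on_def)

interpretation Delta_dot: category Delta_dot by (fact category_Delta_dot)

lemma app_simps [simp]:
  "i < n \<Longrightarrow> app (Ide Delta_dot n) i = i"
  "i < Dom Delta_dot \<phi> \<Longrightarrow> app (\<psi> \<cdot>\<^bsub>Delta_dot\<^esub> \<phi>) i = app \<psi> (app \<phi> i)"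
  "\<phi> \<in> Arr Delta_dot \<Longrightarrow> i < Dom Delta_dot \<phi> \<Longrightarrow> Cod Delta_dot \<phi> = n \<Longrightarrow> app \<phi> i < n"
  by (auto simp: Delta_dot_def compose_def split: prod.splits)

lemma from_zero_simps [simp]:
  "from_zero n \<in> Arr Delta_dot" "Dom Delta_dot (from_zero n) = 0" "Cod Delta_dot (from_zero n) = n"
  by (auto simp: from_zero_def Delta_dot_def mono_on_def)

lemma Delta_dot_eqI:
  assumes "\<phi> \<in> Arr Delta_dot" "\<psi> \<in> Arr Delta_dot" "Dom Delta_dot \<phi> = Dom Delta_dot \<psi>"
    "Cod Delta_dot \<phi> = Cod Delta_dot \<psi>" "\<And>i. i < Dom Delta_dot \<phi> \<Longrightarrow> app \<phi> i = app \<psi> i"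
  shows "\<phi> = \<psi>"
proof -
  have "app \<phi> = app \<psi>"
    using assms unfolding Delta_dot_def by (auto simp: fun_eq_iff PiE_iff extensional_def) metis
  then show ?thesis using assms by (metis Delta_dot_triple)
qed

text \<open>Monotone maps given by their lists of values. Only points \<open>[i]\<close> : 1
  \<rightarrow> n and pairs \<open>[i, j]\<close> : 2 \<rightarrow> n are needed; they induce single
  projections and pairs of projections.\<close>

definition map_of_list :: "nat list \<Rightarrow> nat \<Rightarrow> nat \<times> (nat \<Rightarrow> nat) \<times> nat" where
  "map_of_list is n = (length is, (\<lambda>i \<in> {..<length is}. is ! i), n)"

lemma map_of_list_simps [simp]:
  "Dom Delta_dot (map_of_list is n) = length is" "Cod Delta_dot (map_of_list is n) = n"
  "i < length is \<Longrightarrow> app (map_of_list is n) i = is ! i"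
  "sorted is \<Longrightarrow> \<forall>i \<in> set is. i < n \<Longrightarrow> map_of_list is n \<in> Arr Delta_dot"
  by (auto simp: map_of_list_def Delta_dot_def mono_on_def sorted_nth_mono)

section \<open>Fibre powers of \<open>p\<close> and their universal property\<close>

locale descent = pb_category X for X :: "('o, 'a) cat" (structure) +
  fixes p :: 'a
  assumes p [simp]: "p \<in> Arr X"
begin

abbreviation leg :: "nat \<Rightarrow> 'a" where "leg \<equiv> pow_leg X p"
abbreviation prj :: "nat \<Rightarrow> nat \<Rightarrow> 'a" where "prj \<equiv> pow_proj X p"
abbreviation dg :: "nat \<times> (nat \<Rightarrow> nat) \<times> nat \<Rightarrow> 'a" where "dg \<equiv> FAr (diagram X p)"

lemma leg_simps [simp]: "leg n \<in> Arr X" "Cod X (leg n) = Cod X p"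
proof -
  have "leg n \<in> Arr X \<and> Cod X (leg n) = Cod X p"
  proof (induction n)
    case (Suc n) then show ?case by (cases n) auto
  qed simp
  then show "leg n \<in> Arr X" "Cod X (leg n) = Cod X p" by auto
qed


lemma prj_props:
  "i < n \<Longrightarrow> prj n i \<in> Arr X \<and> Dom X (prj n i) = Dom X (leg n) \<and> Cod X (prj n i) = Dom X p \<and>
     p \<cdot> prj n i = leg n"
proof (induction n)
  case (Suc n)
  note IH = Suc
  show ?case
  proof (cases n)
    case 0 then show ?thesis using IH by simp
  next
    case (Suc m)
    show ?thesis
    proof (cases "i = n")
      case False
      then have i: "prj n i \<in> Arr X" "Dom X (prj n i) = Dom X (leg n)" "Cod X (prj n i) = Dom X p"
        "p \<cdot> prj n i = leg n" using IH by auto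
      show ?thesis using i False Suc reassoc[OF i(4)] by simp
    qed (use Suc in simp)
  qed
qed simp

lemma prj_simps [simp]:
  assumes "i < n"
  shows "prj n i \<in> Arr X" "Dom X (prj n i) = Dom X (leg n)" "Cod X (prj n i) = Dom X p"
    "p \<cdot> prj n i = leg n"
  using prj_props[OF assms] by auto

lemma p_prj_reassoc [simp]:
  assumes "i < n" "x \<in> Arr X" "Cod X x = Dom X (leg n)"
  shows "p \<cdot> (prj n i \<cdot> x) = leg n \<cdot> x"
  using assms reassoc[OF prj_simps(4)] by simp

lemma leg_1: "leg 1 = p" "prj 1 0 = Ide X (Dom X p)"
  by simp_all

text \<open>Induction on n, adding one binary pullback at a time. The composite \<open>l\<close> to
  the base is a separate datum because for n = 0 there are no components \<open>e i\<close> from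
  which to recover it.\<close>

lemma pow_lift:
  assumes "l \<in> Arr X" "Cod X l = Cod X p"
    "\<And>i. i < n \<Longrightarrow> e i \<in> Arr X \<and> Dom X (e i) = Dom X l \<and> Cod X (e i) = Dom X p \<and> p \<cdot> e i = l"
  shows "\<exists>h \<in> Arr X. Dom X h = Dom X l \<and> Cod X h = Dom X (leg n) \<and> leg n \<cdot> h = l \<and>
    (\<forall>i < n. prj n i \<cdot> h = e i)"
  using assms(3)
proof (induction n)
  case 0 then show ?case using assms by (intro bexI[of _ l]) auto
next
  case (Suc n)
  note IH = Suc
  show ?case
  proof (cases n)
    case 0 then show ?thesis using IH(2)[of 0] by (intro bexI[of _ "e 0"]) auto
  next
    case (Suc m)
    obtain h where h: "h \<in> Arr X" "Dom X h = Dom X l" "Cod X h = Dom X (leg n)" "leg n \<cdot> h = l"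
      "\<And>i. i < n \<Longrightarrow> prj n i \<cdot> h = e i"
      using IH(1) IH(2) by (metis less_SucI)
    have e: "e n \<in> Arr X" "Dom X (e n) = Dom X l" "Cod X (e n) = Dom X p" "p \<cdot> e n = l"
      using IH(2)[of n] by auto
    let ?h = "pb_lift X (leg n) p h (e n)"
    show ?thesis
      by (rule bexI[of _ ?h]) (use h e assms(1,2) Suc in \<open>auto simp: less_Suc_eq\<close>)
  qed
qed

text \<open>Produces the base elements over the ordinal 2 at which descent data are evaluated
  below.\<close>

lemma pow_pair:
  assumes "s \<in> Arr X" "t \<in> Arr X" "Dom X t = Dom X s" "Cod X s = Dom X p" "Cod X t = Dom X p" "p \<cdot> t = p \<cdot> s"
  obtains e where "e \<in> Arr X" "Dom X e = Dom X s" "Cod X e = Dom X (leg 2)" "leg 2 \<cdot> e = p \<cdot> s"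
    "prj 2 0 \<cdot> e = s" "prj 2 1 \<cdot> e = t"
proof -
  define ii where "ii i = (if i = 0 then s else t)" for i :: nat
  have "ii i \<in> Arr X \<and> Dom X (ii i) = Dom X (p \<cdot> s) \<and> Cod X (ii i) = Dom X p \<and> p \<cdot> ii i = p \<cdot> s" if "i < 2" for i
    unfolding ii_def using assms by simp
  then obtain e where "e \<in> Arr X" "Dom X e = Dom X s" "Cod X e = Dom X (leg 2)" "leg 2 \<cdot> e = p \<cdot> s"
      and "\<forall>i < 2. prj 2 i \<cdot> e = ii i"
    using pow_lift[of "p \<cdot> s" 2 ii] assms(1-5) by auto
  then show thesis using that[of e] unfolding ii_def by simp
qed

text \<open>Joint monicity, by the same induction. For n = 0 there is no projection and the equation
  on \<open>leg n\<close> carries the statement.\<close>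

lemma pow_ext:
  assumes "leg n \<cdot> h = leg n \<cdot> k" "\<And>i. i < n \<Longrightarrow> prj n i \<cdot> h = prj n i \<cdot> k"
    "h \<in> Arr X" "k \<in> Arr X" "Dom X h = Dom X k" "Cod X h = Dom X (leg n)" "Cod X k = Dom X (leg n)"
  shows "h = k"
  using assms
proof (induction n arbitrary: h k)
  case (Suc n)
  note IH = Suc
  show ?case
  proof (cases n)
    case 0 then show ?thesis using IH(3)[of 0] IH(4-) by simp
  next
    case (Suc m)
    have 0: "pb2 X (leg n) p \<cdot> h = pb2 X (leg n) p \<cdot> k" using IH(3)[of n] Suc by simp
    have 1: "pb1 X (leg n) p \<cdot> h = pb1 X (leg n) p \<cdot> k"
    proof (rule IH(1))
      show "leg n \<cdot> pb1 X (leg n) p \<cdot> h = leg n \<cdot> pb1 X (leg n) p \<cdot> k"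
        using IH(2,4-) Suc by simp
      show "prj n i \<cdot> pb1 X (leg n) p \<cdot> h = prj n i \<cdot> pb1 X (leg n) p \<cdot> k" if "i < n" for i
        using IH(3)[of i] IH(4-) that Suc by simp
    qed (use IH(4-) Suc in simp_all)
    show ?thesis by (rule pb_ext[OF 1 0]) (use IH(4-) Suc in simp_all)
  qed
qed simp

lemma diagram_FOb [simp]: "FOb (diagram X p) n = Dom X (leg n)"
  by (simp add: diagram_def)

text \<open>The definite description in \<open>diagram\<close> denotes: \<open>pow_lift\<close>
  gives existence and \<open>pow_ext\<close> uniqueness.\<close>

lemma dg_props:
  assumes "\<phi> \<in> Arr Delta_dot"
  defines "m \<equiv> Dom Delta_dot \<phi>" and "n \<equiv> Cod Delta_dot \<phi>"
  shows "dg \<phi> \<in> hom X (Dom X (leg n)) (Dom X (leg m)) \<and> leg m \<cdot> dg \<phi> = leg n \<and>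
    (\<forall>i < m. prj m i \<cdot> dg \<phi> = prj n (app \<phi> i))"
proof -
  have lt: "app \<phi> i < n" if "i < m" for i using assms that by auto
  define Q where "Q h \<longleftrightarrow> h \<in> hom X (Dom X (leg n)) (Dom X (leg m)) \<and> leg m \<cdot> h = leg n \<and>
    (\<forall>i < m. prj m i \<cdot> h = prj n (app \<phi> i))" for h
  have "\<exists>h. Q h" using pow_lift[of "leg n" m "\<lambda>i. prj n (app \<phi> i)"] lt unfolding Q_def by auto
  moreover have "h = k" if "Q h" "Q k" for h k
    by (rule pow_ext[of m]) (use that in \<open>auto simp: Q_def\<close>)
  ultimately have "Q (THE h. Q h)" by (metis the_equality)
  moreover have "dg \<phi> = (THE h. Q h)"
    unfolding diagram_def Q_def m_def n_def by (subst Delta_dot_triple[of \<phi>]) simp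
  ultimately show ?thesis unfolding Q_def by simp
qed

lemma dg_simps [simp]:
  assumes "\<phi> \<in> Arr Delta_dot"
  shows "dg \<phi> \<in> Arr X" "Dom X (dg \<phi>) = Dom X (leg (Cod Delta_dot \<phi>))"
    "Cod X (dg \<phi>) = Dom X (leg (Dom Delta_dot \<phi>))"
    "Dom Delta_dot \<phi> = m \<Longrightarrow> leg m \<cdot> dg \<phi> = leg (Cod Delta_dot \<phi>)"
    "Dom Delta_dot \<phi> = m \<Longrightarrow> i < m \<Longrightarrow> prj m i \<cdot> dg \<phi> = prj (Cod Delta_dot \<phi>) (app \<phi> i)"
  using dg_props[OF assms] by auto

lemma dg_reassoc [simp]:
  assumes "\<phi> \<in> Arr Delta_dot" "x \<in> Arr X" "Cod X x = Dom X (leg (Cod Delta_dot \<phi>))" "Dom Delta_dot \<phi> = m"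
  shows "leg m \<cdot> (dg \<phi> \<cdot> x) = leg (Cod Delta_dot \<phi>) \<cdot> x"
    "i < m \<Longrightarrow> prj m i \<cdot> (dg \<phi> \<cdot> x) = prj (Cod Delta_dot \<phi>) (app \<phi> i) \<cdot> x"
  using assms reassoc[OF dg_simps(4)[OF assms(1,4)]] reassoc[OF dg_simps(5)[OF assms(1,4)]] by auto

lemma dg_Ide [simp]: "dg (Ide Delta_dot n) = Ide X (Dom X (leg n))"
  by (rule pow_ext[of n]) auto

lemma dg_Cmp [simp]:
  assumes "\<phi> \<in> Arr Delta_dot" "\<psi> \<in> Arr Delta_dot" "Cod Delta_dot \<phi> = Dom Delta_dot \<psi>"
  shows "dg (\<psi> \<cdot>\<^bsub>Delta_dot\<^esub> \<phi>) = dg \<phi> \<cdot> dg \<psi>"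
  by (rule pow_ext[of "Dom Delta_dot \<phi>"]) (use assms in auto)

text \<open>Holds because \<open>leg 0\<close> is an identity. Consequently the functor of
  \<open>descent_ps X p\<close> at 0 \<rightarrow> n is pullback along \<open>leg n\<close>.\<close>

lemma dg_from_zero [simp]: "dg (from_zero n) = leg n"
  using dg_simps(4)[of "from_zero n" 0] dg_simps(1,3)[of "from_zero n"] by simp

lemma dg_point:
  assumes "i < n" shows "dg (map_of_list [i] n) = prj n i"
proof -
  have "prj 1 0 \<cdot> dg (map_of_list [i] n) = prj n i"
    using dg_simps(5)[of "map_of_list [i] n" 1 0] assms by (simp del: pow_proj.simps)
  then show ?thesis using dg_simps(1,3)[of "map_of_list [i] n"] assms by simp
qed

end

section \<open>The descent category in terms of generalized elements\<close>

lemma terminal_cat_simps [simp]: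
  "Obj terminal_cat = UNIV" "Arr terminal_cat = UNIV" "Dom terminal_cat a = ()" "Cod terminal_cat a = ()"
  "Ide terminal_cat x = ()" "a \<cdot>\<^bsub>terminal_cat\<^esub> b = ()"
  by (auto simp: terminal_cat_def)

lemma category_terminal_cat: "category terminal_cat"
  by unfold_locales auto

lemma is_functor_terminal_cat:
  "is_functor terminal_cat D G \<longleftrightarrow>
     category D \<and> FOb G () \<in> Obj D \<and> FAr G () = Ide D (FOb G ())"
proof (cases "category D")
  case True
  interpret D: category D by (fact True)
  show ?thesis
    unfolding is_functor_def using category_terminal_cat True by auto
qed (auto simp: is_functor_def)

lemma ps_simps [simp]:
  "PObj (const_ps K) k = K" "PArr (const_ps K) f = id_funct" "PUnit (const_ps K) k = Ide K"
  "PMult (const_ps K) g f = Ide K"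
  "PObj (ps_precomp P F) k = PObj P (FOb F k)" "PArr (ps_precomp P F) f = PArr P (FAr F f)"
  "PUnit (ps_precomp P F) k = PUnit P (FOb F k)"
  "PMult (ps_precomp P F) g f = PMult P (FAr F g) (FAr F f)"
  "FOb id_funct x = x" "FAr id_funct y = y"
  "FOb (G \<circ>\<^sub>F F') z = FOb G (FOb F' z)" "FAr (G \<circ>\<^sub>F F') w = FAr G (FAr F' w)"
  by (auto simp: const_ps_def ps_precomp_def id_funct_def comp_funct_def)

lemma basic_fibration_simps [simp]:
  "PObj (basic_fibration X) = slice X"
  "PArr (basic_fibration X) = pullback_funct X"
  "PUnit (basic_fibration X) B f = (f, pb_lift X (Ide X B) f f (Ide X (Dom X f)), pb1 X (Ide X B) f)"
  "PMult (basic_fibration X) q p f =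
        (pb1 X q (pb1 X p f),
         pb_lift X (p \<cdot>\<^bsub>X\<^esub> q) f (pb1 X q (pb1 X p f)) (pb2 X p f \<cdot>\<^bsub>X\<^esub> pb2 X q (pb1 X p f)),
         pb1 X (p \<cdot>\<^bsub>X\<^esub> q) f)"
  by (auto simp: basic_fibration_def)

lemma descent_ps_simps [simp]:
  "PObj (descent_ps X p) n = slice X (FOb (diagram X p) n)"
  "PArr (descent_ps X p) \<phi> = pullback_funct X (FAr (diagram X p) \<phi>)"
  "PUnit (descent_ps X p) n = PUnit (basic_fibration X) (FOb (diagram X p) n)"
  "PMult (descent_ps X p) \<psi> \<phi> = PMult (basic_fibration X) (FAr (diagram X p) \<psi>) (FAr (diagram X p) \<phi>)"
  by (auto simp: descent_ps_def)

lemma pullback_funct_simps [simp]: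
  "FOb (pullback_funct X p) f = pb1 X p f"
  "FAr (pullback_funct X p) (f, h, g) = (pb1 X p f, pb_lift X p g (pb1 X p f) (h \<cdot>\<^bsub>X\<^esub> pb2 X p f), pb1 X p g)"
  by (auto simp: pullback_funct_def)

section \<open>Pseudonatural transformations unpacked into descent data\<close>

context descent
begin

abbreviation "DQ \<equiv> ps_precomp (descent_ps X p) id_funct"
abbreviation "psn \<equiv> is_psnat Delta (const_ps terminal_cat) DQ"
abbreviation "md \<equiv> is_modification Delta (const_ps terminal_cat) DQ"
abbreviation "src \<equiv> Dom Delta_dot"
abbreviation "tgt \<equiv> Cod Delta_dot"
abbreviation "pw n \<equiv> Dom X (leg n)"
abbreviation "ob \<alpha> n \<equiv> FOb (NOb \<alpha> n) ()"
abbreviation "tr \<alpha> \<phi> \<equiv> fst (snd (NAr \<alpha> \<phi> ()))"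

text \<open>Descent data: objects \<open>a n\<close> over the powers of \<open>p\<close>, and isomorphisms \<open>\<phi>\<^sup>* (a m) \<cong> a n\<close> with
  underlying arrows \<open>t \<phi>\<close>.\<close>

definition ddata :: "(nat \<Rightarrow> 'a) \<Rightarrow> (nat \<times> (nat \<Rightarrow> nat) \<times> nat \<Rightarrow> 'a) \<Rightarrow> bool" where
  "ddata a t \<longleftrightarrow>
    (\<forall>n. n \<noteq> 0 \<longrightarrow> a n \<in> Arr X \<and> Cod X (a n) = pw n) \<and>
    (\<forall>\<phi> \<in> Arr Delta. t \<phi> \<in> hom X (Dom X (pb1 X (dg \<phi>) (a (src \<phi>)))) (Dom X (a (tgt \<phi>))) \<and>
       a (tgt \<phi>) \<cdot> t \<phi> = pb1 X (dg \<phi>) (a (src \<phi>)) \<and> iso X (t \<phi>)) \<and>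
    (\<forall>n. n \<noteq> 0 \<longrightarrow>
       t (Ide Delta n) \<cdot> pb_lift X (Ide X (pw n)) (a n) (a n) (Ide X (Dom X (a n))) = Ide X (Dom X (a n))) \<and>
    (\<forall>\<phi> \<in> Arr Delta. \<forall>\<psi> \<in> Arr Delta. tgt \<phi> = src \<psi> \<longrightarrow>
       (let b = pb1 X (dg \<phi>) (a (src \<phi>)) in
       t (\<psi> \<cdot>\<^bsub>Delta\<^esub> \<phi>) \<cdot> pb_lift X (dg \<phi> \<cdot> dg \<psi>) (a (src \<phi>)) (pb1 X (dg \<psi>) b)
             (pb2 X (dg \<phi>) (a (src \<phi>)) \<cdot> pb2 X (dg \<psi>) b)
         = t \<psi> \<cdot> pb_lift X (dg \<psi>) (a (tgt \<phi>)) (pb1 X (dg \<psi>) b) (t \<phi> \<cdot> pb2 X (dg \<psi>) b)))"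

text \<open>Inverse to reading off \<open>ob\<close> and \<open>tr\<close>. The restrictions to
  \<open>Delta\<close> meet the extensionality demands of \<open>is_psnat\<close>; on
  \<open>unit\<close> there is nothing outside the domain to restrict.\<close>

definition mk_psnat ::
    "(nat \<Rightarrow> 'a) \<Rightarrow> (nat \<times> (nat \<Rightarrow> nat) \<times> nat \<Rightarrow> 'a) \<Rightarrow> ('a, 'a \<times> 'a \<times> 'a) desc_obj" where
  "mk_psnat a t = \<lparr>NOb = (\<lambda>n \<in> Obj Delta. \<lparr>FOb = (\<lambda>_. a n), FAr = (\<lambda>_. (a n, Ide X (Dom X (a n)), a n))\<rparr>),
      NAr = (\<lambda>\<phi> \<in> Arr Delta. \<lambda>_. (pb1 X (dg \<phi>) (a (src \<phi>)), t \<phi>, a (tgt \<phi>)))\<rparr>"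

text \<open>A functor out of the terminal category is an object together with its identity, and
  naturality over its single arrow is automatic. What remains of each component is the middle arrow
  of a slice triple whose ends are forced.\<close>

lemma psn_iff:
  "psn \<alpha> \<longleftrightarrow> NOb \<alpha> \<in> extensional (Obj Delta) \<and> NAr \<alpha> \<in> extensional (Arr Delta) \<and>
    (\<forall>n. n \<noteq> 0 \<longrightarrow> FAr (NOb \<alpha> n) () = (ob \<alpha> n, Ide X (Dom X (ob \<alpha> n)), ob \<alpha> n)) \<and>
    (\<forall>\<phi> \<in> Arr Delta. NAr \<alpha> \<phi> () = (pb1 X (dg \<phi>) (ob \<alpha> (src \<phi>)), tr \<alpha> \<phi>, ob \<alpha> (tgt \<phi>))) \<and>
    ddata (ob \<alpha>) (tr \<alpha>)"
    (is "_ \<longleftrightarrow> ?R")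
proof -
  let ?A = "\<forall>k \<in> Obj Delta. is_functor terminal_cat (slice X (pw k)) (NOb \<alpha> k)"
  let ?A' = "(\<forall>n. n \<noteq> 0 \<longrightarrow> ob \<alpha> n \<in> Arr X \<and> Cod X (ob \<alpha> n) = pw n \<and>
    FAr (NOb \<alpha> n) () = (ob \<alpha> n, Ide X (Dom X (ob \<alpha> n)), ob \<alpha> n))"
  let ?B = "\<forall>\<phi> \<in> Arr Delta. nat_iso terminal_cat (slice X (pw (tgt \<phi>)))
    (pullback_funct X (dg \<phi>) \<circ>\<^sub>F NOb \<alpha> (src \<phi>)) (NOb \<alpha> (tgt \<phi>) \<circ>\<^sub>F id_funct) (NAr \<alpha> \<phi>)"
  let ?B' = "\<forall>\<phi> \<in> Arr Delta. tr \<alpha> \<phi> \<in> hom X (Dom X (pb1 X (dg \<phi>) (ob \<alpha> (src \<phi>)))) (Dom X (ob \<alpha> (tgt \<phi>))) \<and>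
       ob \<alpha> (tgt \<phi>) \<cdot> tr \<alpha> \<phi> = pb1 X (dg \<phi>) (ob \<alpha> (src \<phi>)) \<and> iso X (tr \<alpha> \<phi>) \<and>
       NAr \<alpha> \<phi> () = (pb1 X (dg \<phi>) (ob \<alpha> (src \<phi>)), tr \<alpha> \<phi>, ob \<alpha> (tgt \<phi>))"
  have A: "?A \<longleftrightarrow> ?A'"
    using category_slice unfolding is_functor_terminal_cat by auto
  have B: "?B \<longleftrightarrow> ?B'" if ?A'
  proof (rule ball_cong[OF refl])
    fix \<phi> assume f: "\<phi> \<in> Arr Delta"
    let ?a = "ob \<alpha> (src \<phi>)" and ?b = "ob \<alpha> (tgt \<phi>)"
    have ab: "?a \<in> Arr X" "Cod X ?a = pw (src \<phi>)" "FAr (NOb \<alpha> (src \<phi>)) () = (?a, Ide X (Dom X ?a), ?a)"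
      "?b \<in> Arr X" "Cod X ?b = pw (tgt \<phi>)" "FAr (NOb \<alpha> (tgt \<phi>)) () = (?b, Ide X (Dom X ?b), ?b)"
      using that f by auto
    \<comment> \<open>The pullback functor preserves the identity of \<open>?a\<close>; this makes
      the composite a functor and reduces naturality to the typing of the component.\<close>
    have i: "pb_lift X (dg \<phi>) ?a (pb1 X (dg \<phi>) ?a) (Ide X (Dom X ?a) \<cdot> pb2 X (dg \<phi>) ?a) =
       Ide X (Dom X (pb1 X (dg \<phi>) ?a))"
      by (rule pb_ext[of "dg \<phi>" ?a]) (use ab f in auto)
    obtain x h y where n: "NAr \<alpha> \<phi> () = (x, h, y)" by (cases "NAr \<alpha> \<phi> ()")
    have F: "is_functor terminal_cat (slice X (pw (tgt \<phi>))) (pullback_funct X (dg \<phi>) \<circ>\<^sub>F NOb \<alpha> (src \<phi>))"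
      "is_functor terminal_cat (slice X (pw (tgt \<phi>))) (NOb \<alpha> (tgt \<phi>) \<circ>\<^sub>F id_funct)"
      unfolding is_functor_terminal_cat using f ab i category_slice by simp_all
    have "nat_iso terminal_cat (slice X (pw (tgt \<phi>)))
        (pullback_funct X (dg \<phi>) \<circ>\<^sub>F NOb \<alpha> (src \<phi>)) (NOb \<alpha> (tgt \<phi>) \<circ>\<^sub>F id_funct) (NAr \<alpha> \<phi>)
      \<longleftrightarrow> (x, h, y) \<in> hom (slice X (pw (tgt \<phi>))) (pb1 X (dg \<phi>) ?a) ?b \<and> iso (slice X (pw (tgt \<phi>))) (x, h, y)"
      unfolding nat_iso_def nat_trans_def using F n f ab i by auto
    also have "\<dots> \<longleftrightarrow> (x, h, y) \<in> hom (slice X (pw (tgt \<phi>))) (pb1 X (dg \<phi>) ?a) ?b \<and> iso X h"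
      using iso_slice[of x h y "pw (tgt \<phi>)"] by auto
    finally show "nat_iso terminal_cat (slice X (pw (tgt \<phi>)))
        (pullback_funct X (dg \<phi>) \<circ>\<^sub>F NOb \<alpha> (src \<phi>)) (NOb \<alpha> (tgt \<phi>) \<circ>\<^sub>F id_funct) (NAr \<alpha> \<phi>) \<longleftrightarrow>
       tr \<alpha> \<phi> \<in> hom X (Dom X (pb1 X (dg \<phi>) ?a)) (Dom X ?b) \<and>
       ?b \<cdot> tr \<alpha> \<phi> = pb1 X (dg \<phi>) ?a \<and> iso X (tr \<alpha> \<phi>) \<and>
       NAr \<alpha> \<phi> () = (pb1 X (dg \<phi>) ?a, tr \<alpha> \<phi>, ?b)"
      using f ab n by auto
  qed
  let ?U = "\<forall>k \<in> Obj Delta. NAr \<alpha> (Ide Delta k) () \<cdot>\<^bsub>slice X (pw k)\<^esub>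
    (ob \<alpha> k, pb_lift X (Ide X (pw k)) (ob \<alpha> k) (ob \<alpha> k) (Ide X (Dom X (ob \<alpha> k))), pb1 X (Ide X (pw k)) (ob \<alpha> k))
          = FAr (NOb \<alpha> k) ()"
  let ?U' = "\<forall>n. n \<noteq> 0 \<longrightarrow> tr \<alpha> (Ide Delta n) \<cdot>
    pb_lift X (Ide X (pw n)) (ob \<alpha> n) (ob \<alpha> n) (Ide X (Dom X (ob \<alpha> n))) = Ide X (Dom X (ob \<alpha> n))"
  have U: "?U \<longleftrightarrow> ?U'" if a: ?A' and b: ?B'
  proof -
    have "NAr \<alpha> (Ide Delta k) () \<cdot>\<^bsub>slice X (pw k)\<^esub>
        (ob \<alpha> k, pb_lift X (Ide X (pw k)) (ob \<alpha> k) (ob \<alpha> k) (Ide X (Dom X (ob \<alpha> k))), pb1 X (Ide X (pw k)) (ob \<alpha> k))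
          = FAr (NOb \<alpha> k) () \<longleftrightarrow>
        tr \<alpha> (Ide Delta k) \<cdot> pb_lift X (Ide X (pw k)) (ob \<alpha> k) (ob \<alpha> k) (Ide X (Dom X (ob \<alpha> k))) =
          Ide X (Dom X (ob \<alpha> k))" if "k \<noteq> 0" for k
    proof -
      define t where "t = tr \<alpha> (Ide Delta k)"
      have "NAr \<alpha> (Ide Delta k) () = (pb1 X (dg (Ide Delta k)) (ob \<alpha> k), t, ob \<alpha> k)"
        using b[rule_format, of "Ide Delta k"] that unfolding t_def by simp
      then show ?thesis using a that by simp
    qed
    then show ?thesis by simp
  qed
  let ?M = "\<forall>\<phi> \<in> Arr Delta. \<forall>\<psi> \<in> Arr Delta. Cod Delta \<phi> = Dom Delta \<psi> \<longrightarrow>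
     (NAr \<alpha> (\<psi> \<cdot>\<^bsub>Delta\<^esub> \<phi>) () \<cdot>\<^bsub>slice X (pw (tgt \<psi>))\<^esub> PMult DQ \<psi> \<phi> (ob \<alpha> (src \<phi>))
             = FAr (NOb \<alpha> (tgt \<psi>)) () \<cdot>\<^bsub>slice X (pw (tgt \<psi>))\<^esub> NAr \<alpha> \<psi> ()
                 \<cdot>\<^bsub>slice X (pw (tgt \<psi>))\<^esub> FAr (pullback_funct X (dg \<psi>)) (NAr \<alpha> \<phi> ()))"
  let ?M' = "\<forall>\<phi> \<in> Arr Delta. \<forall>\<psi> \<in> Arr Delta. tgt \<phi> = src \<psi> \<longrightarrow>
       (let b = pb1 X (dg \<phi>) (ob \<alpha> (src \<phi>)) in
       tr \<alpha> (\<psi> \<cdot>\<^bsub>Delta\<^esub> \<phi>) \<cdot> pb_lift X (dg \<phi> \<cdot> dg \<psi>) (ob \<alpha> (src \<phi>)) (pb1 X (dg \<psi>) b)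
             (pb2 X (dg \<phi>) (ob \<alpha> (src \<phi>)) \<cdot> pb2 X (dg \<psi>) b)
         = tr \<alpha> \<psi> \<cdot> pb_lift X (dg \<psi>) (ob \<alpha> (tgt \<phi>)) (pb1 X (dg \<psi>) b) (tr \<alpha> \<phi> \<cdot> pb2 X (dg \<psi>) b))"
  have M: "?M \<longleftrightarrow> ?M'" if a: ?A' and b: ?B'
  proof (intro ball_cong refl imp_cong)
    fix \<phi> \<psi> assume f: "\<phi> \<in> Arr Delta" "\<psi> \<in> Arr Delta" "tgt \<phi> = src \<psi>"
    let ?a = "ob \<alpha> (src \<phi>)" and ?b = "ob \<alpha> (src \<psi>)" and ?c = "ob \<alpha> (tgt \<psi>)"
    note N = b[rule_format, OF f(1)] b[rule_format, OF f(2)] b[rule_format, of "\<psi> \<cdot>\<^bsub>Delta\<^esub> \<phi>"]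
    define t u v where tuv: "t = tr \<alpha> \<phi>" "u = tr \<alpha> \<psi>" "v = tr \<alpha> (\<psi> \<cdot>\<^bsub>Delta\<^esub> \<phi>)"
    have N': "NAr \<alpha> \<phi> () = (pb1 X (dg \<phi>) ?a, t, ?b)" "NAr \<alpha> \<psi> () = (pb1 X (dg \<psi>) ?b, u, ?c)"
      "NAr \<alpha> (\<psi> \<cdot>\<^bsub>Delta\<^esub> \<phi>) () = (pb1 X (dg \<phi> \<cdot> dg \<psi>) ?a, v, ?c)"
      unfolding tuv using N f by auto
    have T: "t \<in> Arr X" "Dom X t = Dom X (pb1 X (dg \<phi>) ?a)" "Cod X t = Dom X ?b"
      "?b \<cdot> t = pb1 X (dg \<phi>) ?a"
      "u \<in> Arr X" "Dom X u = Dom X (pb1 X (dg \<psi>) ?b)" "Cod X u = Dom X ?c"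
      unfolding tuv using N(1,2) f by auto
    have a': "?a \<in> Arr X" "Cod X ?a = pw (src \<phi>)" "?b \<in> Arr X" "Cod X ?b = pw (src \<psi>)"
      "?c \<in> Arr X" "Cod X ?c = pw (tgt \<psi>)" "FAr (NOb \<alpha> (tgt \<psi>)) () = (?c, Ide X (Dom X ?c), ?c)"
      using a f by auto
    show "(NAr \<alpha> (\<psi> \<cdot>\<^bsub>Delta\<^esub> \<phi>) () \<cdot>\<^bsub>slice X (pw (tgt \<psi>))\<^esub> PMult DQ \<psi> \<phi> ?a
             = FAr (NOb \<alpha> (tgt \<psi>)) () \<cdot>\<^bsub>slice X (pw (tgt \<psi>))\<^esub> NAr \<alpha> \<psi> ()
                 \<cdot>\<^bsub>slice X (pw (tgt \<psi>))\<^esub> FAr (pullback_funct X (dg \<psi>)) (NAr \<alpha> \<phi> ())) \<longleftrightarrow>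
       (let b = pb1 X (dg \<phi>) ?a in
       tr \<alpha> (\<psi> \<cdot>\<^bsub>Delta\<^esub> \<phi>) \<cdot> pb_lift X (dg \<phi> \<cdot> dg \<psi>) ?a (pb1 X (dg \<psi>) b) (pb2 X (dg \<phi>) ?a \<cdot> pb2 X (dg \<psi>) b)
         = tr \<alpha> \<psi> \<cdot> pb_lift X (dg \<psi>) (ob \<alpha> (tgt \<phi>)) (pb1 X (dg \<psi>) b) (tr \<alpha> \<phi> \<cdot> pb2 X (dg \<psi>) b))"
      unfolding N' a'(7) Let_def
      using f a' T reassoc[OF T(4)] by simp
  qed simp_all
  \<comment> \<open>Each clause can be rewritten only under the typing supplied by the earlier ones,
    so the equivalences are combined conditionally.\<close>
  have logic: "(N \<and> E \<and> A \<and> B \<and> U \<and> M) = (N \<and> E \<and> A' \<and> B' \<and> U' \<and> M')"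
    if "A = A'" "A' \<Longrightarrow> B = B'" "A' \<Longrightarrow> B' \<Longrightarrow> U = U'" "A' \<Longrightarrow> B' \<Longrightarrow> M = M'" for N E A A' B B' U U' M M'
    using that by blast
  have "psn \<alpha> \<longleftrightarrow> NOb \<alpha> \<in> extensional (Obj Delta) \<and> NAr \<alpha> \<in> extensional (Arr Delta) \<and> ?A \<and> ?B \<and> ?U \<and> ?M"
    unfolding is_psnat_def by (simp add: ball_conj_distrib)
  also have "\<dots> \<longleftrightarrow> NOb \<alpha> \<in> extensional (Obj Delta) \<and> NAr \<alpha> \<in> extensional (Arr Delta) \<and> ?A' \<and> ?B' \<and> ?U' \<and> ?M'"
    by (rule logic[OF A B U M])
  also have "\<dots> \<longleftrightarrow> ?R" unfolding ddata_def ball_conj_distrib by blast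
  finally show ?thesis .
qed

end

section \<open>Transport of generalized elements\<close>

locale descent_data = descent X p for X :: "('o, 'a) cat" (structure) and p :: 'a +
  fixes a :: "nat \<Rightarrow> 'a" and t :: "nat \<times> (nat \<Rightarrow> nat) \<times> nat \<Rightarrow> 'a"
  assumes ddata: "ddata a t"
begin

text \<open>The action of \<open>\<phi>\<close> on generalized elements: \<open>push \<phi> e\<close> takes the elements of \<open>a m\<close> over
  \<open>e \<phi>\<close> bijectively to the elements of \<open>a n\<close> over \<open>e\<close>.\<close>

definition push :: "nat \<times> (nat \<Rightarrow> nat) \<times> nat \<Rightarrow> 'a \<Rightarrow> 'a \<Rightarrow> 'a" where
  "push \<phi> e x = t \<phi> \<cdot> pb_lift X (dg \<phi>) (a (src \<phi>)) e x"

lemma a_simps [simp]: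
  assumes "n \<noteq> 0" shows "a n \<in> Arr X" "Cod X (a n) = pw n"
  using ddata assms unfolding ddata_def by auto

lemma t_simps [simp]:
  assumes "\<phi> \<in> Arr Delta_dot" "src \<phi> \<noteq> 0" "tgt \<phi> \<noteq> 0"
  shows "t \<phi> \<in> Arr X" "Dom X (t \<phi>) = Dom X (pb1 X (dg \<phi>) (a (src \<phi>)))"
    "Cod X (t \<phi>) = Dom X (a (tgt \<phi>))" "tgt \<phi> = n \<Longrightarrow> a n \<cdot> t \<phi> = pb1 X (dg \<phi>) (a (src \<phi>))" "iso X (t \<phi>)"
  using ddata assms unfolding ddata_def by auto

lemma t_reassoc [simp]:
  assumes "\<phi> \<in> Arr Delta_dot" "src \<phi> \<noteq> 0" "tgt \<phi> \<noteq> 0" "x \<in> Arr X" "tgt \<phi> = n"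
    "Cod X x = Dom X (pb1 X (dg \<phi>) (a (src \<phi>)))"
  shows "a n \<cdot> (t \<phi> \<cdot> x) = pb1 X (dg \<phi>) (a (src \<phi>)) \<cdot> x"
  using assms reassoc[OF t_simps(4)[OF assms(1-3,5)]] by simp

text \<open>These are exactly the pairs \<open>(e, x)\<close> that factor through the chosen
  pullback of \<open>a (src \<phi>)\<close> along \<open>dg \<phi>\<close>, hence the domain of
  \<open>push \<phi>\<close>.\<close>

definition elt :: "nat \<times> (nat \<Rightarrow> nat) \<times> nat \<Rightarrow> 'a \<Rightarrow> 'a \<Rightarrow> bool" where
  "elt \<phi> e x \<longleftrightarrow> \<phi> \<in> Arr Delta_dot \<and> src \<phi> \<noteq> 0 \<and> tgt \<phi> \<noteq> 0 \<and>
     e \<in> Arr X \<and> Cod X e = pw (tgt \<phi>) \<and> x \<in> Arr X \<and> Dom X x = Dom X e \<and> Cod X x = Dom X (a (src \<phi>)) \<and>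
     a (src \<phi>) \<cdot> x = dg \<phi> \<cdot> e"

lemma push_simps [simp]:
  assumes "elt \<phi> e x"
  shows "push \<phi> e x \<in> Arr X" "Dom X (push \<phi> e x) = Dom X e" "Cod X (push \<phi> e x) = Dom X (a (tgt \<phi>))"
    "tgt \<phi> = n \<Longrightarrow> a n \<cdot> push \<phi> e x = e"
  using assms unfolding elt_def push_def by auto

text \<open>Naturality in the stage of definition: lifts into a pullback commute with
  precomposition.\<close>

lemma push_Cmp:
  assumes "elt \<phi> e x" "k \<in> Arr X" "Cod X k = Dom X e"
  shows "push \<phi> e x \<cdot> k = push \<phi> (e \<cdot> k) (x \<cdot> k)"
  using assms unfolding elt_def push_def
  by (auto simp: pb_lift_Cmp)

text \<open>The composition law in \<open>ddata\<close> is an equation between arrows out of an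
  iterated pullback; it is evaluated at the element of that pullback with coordinates
  \<open>e\<close> and \<open>x\<close>.\<close>

lemma push_push:
  assumes "elt \<phi> (dg \<psi> \<cdot> e) x" "\<psi> \<in> Arr Delta_dot" "tgt \<phi> = src \<psi>" "tgt \<psi> \<noteq> 0"
    "e \<in> Arr X" "Cod X e = pw (tgt \<psi>)"
  shows "push \<psi> e (push \<phi> (dg \<psi> \<cdot> e) x) = push (\<psi> \<cdot>\<^bsub>Delta_dot\<^esub> \<phi>) e x"
proof -
  define b where "b = pb1 X (dg \<phi>) (a (src \<phi>))"
  let ?l = "pb_lift X (dg \<phi> \<cdot> dg \<psi>) (a (src \<phi>)) (pb1 X (dg \<psi>) b) (pb2 X (dg \<phi>) (a (src \<phi>)) \<cdot> pb2 X (dg \<psi>) b)"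
  let ?r = "pb_lift X (dg \<psi>) (a (tgt \<phi>)) (pb1 X (dg \<psi>) b) (t \<phi> \<cdot> pb2 X (dg \<psi>) b)"
  \<comment> \<open>\<open>k\<close> is the given pair as an element of the pullback along
    \<open>dg \<phi>\<close>, and \<open>h\<close> the resulting element of the further pullback
    along \<open>dg \<psi>\<close>.\<close>
  define k where "k = pb_lift X (dg \<phi>) (a (src \<phi>)) (dg \<psi> \<cdot> e) x"
  define h where "h = pb_lift X (dg \<psi>) b e k"
  note E = assms(1)[unfolded elt_def]
  have b: "b \<in> Arr X" "Cod X b = pw (src \<psi>)" "a (src \<psi>) \<cdot> t \<phi> = b" "Dom X (t \<phi>) = Dom X b"
    using E assms unfolding b_def by auto
  have bt: "a (src \<psi>) \<cdot> (t \<phi> \<cdot> y) = b \<cdot> y" if "y \<in> Arr X" "Cod X y = Dom X b" for y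
    using reassoc[OF b(3) _ _ _ that(1)] that E assms b by simp
  have k: "k \<in> Arr X" "Dom X k = Dom X e" "Cod X k = Dom X b" "b \<cdot> k = dg \<psi> \<cdot> e"
    "pb2 X (dg \<phi>) (a (src \<phi>)) \<cdot> k = x"
    using E assms unfolding b_def k_def by auto
  have h: "h \<in> Arr X" "Dom X h = Dom X e" "Cod X h = Dom X (pb1 X (dg \<psi>) b)"
    "pb1 X (dg \<psi>) b \<cdot> h = e" "pb2 X (dg \<psi>) b \<cdot> h = k"
    using E assms b k unfolding h_def by auto
  have pc: "a (src \<phi>) \<cdot> (pb2 X (dg \<phi>) (a (src \<phi>)) \<cdot> pb2 X (dg \<psi>) b) = dg \<phi> \<cdot> (b \<cdot> pb2 X (dg \<psi>) b)"
    using E assms b unfolding b_def by simp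
  have eq: "t (\<psi> \<cdot>\<^bsub>Delta_dot\<^esub> \<phi>) \<cdot> ?l = t \<psi> \<cdot> ?r"
    using ddata E assms unfolding ddata_def Let_def b_def by auto
  have ll: "?l \<in> Arr X" "Dom X ?l = Dom X (pb1 X (dg \<psi>) b)" "Cod X ?l = Dom X (pb1 X (dg \<phi> \<cdot> dg \<psi>) (a (src \<phi>)))"
    using E assms b pc unfolding b_def by (simp_all add: b_def[symmetric])
  have rr: "?r \<in> Arr X" "Dom X ?r = Dom X (pb1 X (dg \<psi>) b)" "Cod X ?r = Dom X (pb1 X (dg \<psi>) (a (tgt \<phi>)))"
    using E assms b bt by simp_all
  have l: "?l \<cdot> h = pb_lift X (dg \<phi> \<cdot> dg \<psi>) (a (src \<phi>)) e x"
    by (subst pb_lift_Cmp) (use E assms b k h pc in \<open>simp_all add: b_def[symmetric]\<close>)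
  have r: "?r \<cdot> h = pb_lift X (dg \<psi>) (a (tgt \<phi>)) e (t \<phi> \<cdot> k)"
    by (subst pb_lift_Cmp) (use E assms b k h bt in simp_all)
  have "push (\<psi> \<cdot>\<^bsub>Delta_dot\<^esub> \<phi>) e x = t (\<psi> \<cdot>\<^bsub>Delta_dot\<^esub> \<phi>) \<cdot> (?l \<cdot> h)"
    unfolding l push_def using E assms by simp
  also have "\<dots> = t \<psi> \<cdot> (?r \<cdot> h)"
    using reassoc[OF eq] ll rr h E assms by simp
  also have "\<dots> = push \<psi> e (push \<phi> (dg \<psi> \<cdot> e) x)"
    unfolding r push_def using E assms by (simp add: k_def)
  finally show ?thesis by simp
qed

text \<open>\<open>t \<phi>\<close> is invertible, and \<open>x\<close> is the second coordinate of
  the lift to which it is applied.\<close>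

lemma push_inj:
  assumes "push \<phi> e x = push \<phi> e y" "elt \<phi> e x" "elt \<phi> e y"
  shows "x = y"
proof -
  have "pb_lift X (dg \<phi>) (a (src \<phi>)) e x = pb_lift X (dg \<phi>) (a (src \<phi>)) e y"
    by (rule iso_cancel[of "t \<phi>"]) (use assms in \<open>auto simp: push_def elt_def\<close>)
  then have "pb2 X (dg \<phi>) (a (src \<phi>)) \<cdot> pb_lift X (dg \<phi>) (a (src \<phi>)) e x =
      pb2 X (dg \<phi>) (a (src \<phi>)) \<cdot> pb_lift X (dg \<phi>) (a (src \<phi>)) e y" by simp
  then show ?thesis using assms(2,3) unfolding elt_def by simp
qed

text \<open>The preimage is the second coordinate of \<open>y\<close> composed with the inverse of
  \<open>t \<phi>\<close>; its first coordinate is \<open>e\<close> because \<open>t \<phi>\<close>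
  is an arrow of the slice.\<close>

lemma push_surj:
  assumes "\<phi> \<in> Arr Delta_dot" "src \<phi> \<noteq> 0" "tgt \<phi> \<noteq> 0" "y \<in> Arr X" "Cod X y = Dom X (a (tgt \<phi>))"
    "a (tgt \<phi>) \<cdot> y = e"
  shows "\<exists>x. elt \<phi> e x \<and> push \<phi> e x = y"
proof -
  obtain t' where t': "t' \<in> Arr X" "Dom X t' = Dom X (a (tgt \<phi>))" "Cod X t' = Dom X (pb1 X (dg \<phi>) (a (src \<phi>)))"
    "t \<phi> \<cdot> t' = Ide X (Dom X (a (tgt \<phi>)))"
    using isoE[OF t_simps(5)[OF assms(1-3)]] t_simps[OF assms(1-3)] by metis
  have "a (tgt \<phi>) \<cdot> (t \<phi> \<cdot> (t' \<cdot> y)) = e"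
    using reassoc[OF t'(4)] t' assms t_simps(1-3)[OF assms(1-3)] by simp
  then have 1: "pb1 X (dg \<phi>) (a (src \<phi>)) \<cdot> (t' \<cdot> y) = e"
    using t' assms by simp
  let ?x = "pb2 X (dg \<phi>) (a (src \<phi>)) \<cdot> (t' \<cdot> y)"
  have e: "e \<in> Arr X" "Dom X e = Dom X y" "Cod X e = pw (tgt \<phi>)" using assms by auto
  have el: "elt \<phi> e ?x" unfolding elt_def using t' assms 1 e by simp
  have "pb_lift X (dg \<phi>) (a (src \<phi>)) e ?x = t' \<cdot> y"
    by (rule pb_ext[of "dg \<phi>" "a (src \<phi>)"]) (use el[unfolded elt_def] e 1 t' assms in simp_all)
  then have "push \<phi> e ?x = y"
    unfolding push_def using reassoc[OF t'(4)] t' assms by simp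
  then show ?thesis using el by blast
qed

text \<open>The Yoneda argument: the two projections form the universal element, whose lift is the
  identity. So statements about \<open>push\<close> determine \<open>t \<phi>\<close>.\<close>

lemma t_eq_push:
  assumes "\<phi> \<in> Arr Delta_dot" "src \<phi> \<noteq> 0" "tgt \<phi> \<noteq> 0"
  shows "elt \<phi> (pb1 X (dg \<phi>) (a (src \<phi>))) (pb2 X (dg \<phi>) (a (src \<phi>)))"
    "push \<phi> (pb1 X (dg \<phi>) (a (src \<phi>))) (pb2 X (dg \<phi>) (a (src \<phi>))) = t \<phi>"
proof -
  show "elt \<phi> (pb1 X (dg \<phi>) (a (src \<phi>))) (pb2 X (dg \<phi>) (a (src \<phi>)))"
    using assms unfolding elt_def by simp
  have "pb_lift X (dg \<phi>) (a (src \<phi>)) (pb1 X (dg \<phi>) (a (src \<phi>))) (pb2 X (dg \<phi>) (a (src \<phi>))) =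
      Ide X (Dom X (pb1 X (dg \<phi>) (a (src \<phi>))))"
    by (rule pb_ext[of "dg \<phi>" "a (src \<phi>)"]) (use assms in simp_all)
  then show "push \<phi> (pb1 X (dg \<phi>) (a (src \<phi>))) (pb2 X (dg \<phi>) (a (src \<phi>))) = t \<phi>"
    unfolding push_def using assms by simp
qed

end


section \<open>Arrows and isomorphisms of the descent category\<close>

context descent
begin

abbreviation "transport \<equiv> descent_data.push X p"
abbreviation "element \<equiv> descent_data.elt X p"
abbreviation "DC \<equiv> desc_cat (descent_ps X p)"
abbreviation "mo \<Gamma> n \<equiv> fst (snd (\<Gamma> n ()))"

lemma descent_dataI: "ddata a t \<Longrightarrow> descent_data X p a t"
  by (intro descent_data.intro descent_axioms descent_data_axioms.intro)

text \<open>The lift on the right is the underlying arrow of the pulled back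
  \<open>g (src \<phi>)\<close>. The square is kept in terms of arrows here, so as to match
  \<open>is_modification\<close> directly.\<close>

definition dmor where
  "dmor a t b s g \<longleftrightarrow>
    (\<forall>n. n \<noteq> 0 \<longrightarrow> g n \<in> hom X (Dom X (a n)) (Dom X (b n)) \<and> b n \<cdot> g n = a n) \<and>
    (\<forall>\<phi> \<in> Arr Delta. g (tgt \<phi>) \<cdot> t \<phi> = s \<phi> \<cdot> pb_lift X (dg \<phi>) (b (src \<phi>))
       (pb1 X (dg \<phi>) (a (src \<phi>))) (g (src \<phi>) \<cdot> pb2 X (dg \<phi>) (a (src \<phi>))))"

definition mk_mod :: "(nat \<Rightarrow> 'a) \<Rightarrow> (nat \<Rightarrow> 'a) \<Rightarrow> (nat \<Rightarrow> 'a) \<Rightarrow> nat \<Rightarrow> unit \<Rightarrow> 'a \<times> 'a \<times> 'a" where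
  "mk_mod a b g = (\<lambda>n \<in> Obj Delta. \<lambda>_. (a n, g n, b n))"

lemma mk_mod_eq_iff: "mk_mod a b g = mk_mod a b h \<longleftrightarrow> (\<forall>n. n \<noteq> 0 \<longrightarrow> g n = h n)"
proof
  assume eq: "mk_mod a b g = mk_mod a b h"
  show "\<forall>n. n \<noteq> 0 \<longrightarrow> g n = h n"
  proof (intro allI impI)
    fix n :: nat assume "n \<noteq> 0"
    then show "g n = h n" using fun_cong[OF fun_cong[OF eq, of n], of "()"] by (simp add: mk_mod_def)
  qed
qed (auto simp: mk_mod_def restrict_def)

lemma mk_mod_simp [simp]: "n \<noteq> 0 \<Longrightarrow> mk_mod a b g n () = (a n, g n, b n)"
  by (simp add: mk_mod_def)

lemma elt_def': "ddata a t \<Longrightarrow> element a \<phi> e x \<longleftrightarrow> \<phi> \<in> Arr Delta_dot \<and> src \<phi> \<noteq> 0 \<and> tgt \<phi> \<noteq> 0 \<and>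
     e \<in> Arr X \<and> Cod X e = pw (tgt \<phi>) \<and> x \<in> Arr X \<and> Dom X x = Dom X e \<and> Cod X x = Dom X (a (src \<phi>)) \<and>
     a (src \<phi>) \<cdot> x = dg \<phi> \<cdot> e"
  using descent_data.elt_def[OF descent_dataI] .

text \<open>Precomposing the square with the lift of \<open>e\<close> and \<open>x\<close> gives the
  statement on elements; conversely the square is its case for the universal element, by
  \<open>t_eq_push\<close>.\<close>

lemma dmor_iff_push:
  assumes A: "ddata a t" and B: "ddata b s"
  shows "dmor a t b s g \<longleftrightarrow>
    (\<forall>n. n \<noteq> 0 \<longrightarrow> g n \<in> hom X (Dom X (a n)) (Dom X (b n)) \<and> b n \<cdot> g n = a n) \<and>
    (\<forall>\<phi> e x. element a \<phi> e x \<longrightarrow> g (tgt \<phi>) \<cdot> transport a t \<phi> e x = transport b s \<phi> e (g (src \<phi>) \<cdot> x))"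
    (is "_ \<longleftrightarrow> ?G \<and> ?P")
proof -
  interpret A: descent_data X p a t by (rule descent_dataI[OF A])
  interpret B: descent_data X p b s by (rule descent_dataI[OF B])
  have "(g (tgt \<phi>) \<cdot> t \<phi> = s \<phi> \<cdot> pb_lift X (dg \<phi>) (b (src \<phi>))
       (pb1 X (dg \<phi>) (a (src \<phi>))) (g (src \<phi>) \<cdot> pb2 X (dg \<phi>) (a (src \<phi>)))) \<longleftrightarrow>
     (\<forall>e x. element a \<phi> e x \<longrightarrow> g (tgt \<phi>) \<cdot> transport a t \<phi> e x = transport b s \<phi> e (g (src \<phi>) \<cdot> x))"
    (is "?E \<longleftrightarrow> _")
    if f: "\<phi> \<in> Arr Delta" and g: ?G for \<phi>
  proof -
    let ?x = "pb2 X (dg \<phi>) (a (src \<phi>))" and ?e = "pb1 X (dg \<phi>) (a (src \<phi>))"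
    have f': "\<phi> \<in> Arr Delta_dot" "src \<phi> \<noteq> 0" "tgt \<phi> \<noteq> 0" using f by auto
    have gs: "g (src \<phi>) \<in> Arr X" "Dom X (g (src \<phi>)) = Dom X (a (src \<phi>))" "Cod X (g (src \<phi>)) = Dom X (b (src \<phi>))"
      "b (src \<phi>) \<cdot> g (src \<phi>) = a (src \<phi>)"
      "g (tgt \<phi>) \<in> Arr X" "Dom X (g (tgt \<phi>)) = Dom X (a (tgt \<phi>))" "Cod X (g (tgt \<phi>)) = Dom X (b (tgt \<phi>))"
      using g f' by auto
    have gx: "element b \<phi> e (g (src \<phi>) \<cdot> x)" if "element a \<phi> e x" for e x
      using that f' gs reassoc[OF gs(4)] unfolding A.elt_def B.elt_def by simp
    note T = A.t_eq_push[OF f']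
    have rhs: "s \<phi> \<cdot> pb_lift X (dg \<phi>) (b (src \<phi>)) ?e (g (src \<phi>) \<cdot> ?x) = transport b s \<phi> ?e (g (src \<phi>) \<cdot> ?x)"
      unfolding B.push_def ..
    show ?thesis
    proof
      assume E: ?E
      show "\<forall>e x. element a \<phi> e x \<longrightarrow> g (tgt \<phi>) \<cdot> transport a t \<phi> e x = transport b s \<phi> e (g (src \<phi>) \<cdot> x)"
      proof (intro allI impI)
        fix e x assume e: "element a \<phi> e x"
        note e' = e[unfolded A.elt_def]
        let ?k = "pb_lift X (dg \<phi>) (a (src \<phi>)) e x"
        have k: "?k \<in> Arr X" "Dom X ?k = Dom X e" "Cod X ?k = Dom X ?e" "?e \<cdot> ?k = e" "?x \<cdot> ?k = x"
          using e' f' by auto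
        have "g (tgt \<phi>) \<cdot> transport a t \<phi> e x = (g (tgt \<phi>) \<cdot> t \<phi>) \<cdot> ?k"
          unfolding A.push_def using k(1-3) gs f' by simp
        also have "\<dots> = transport b s \<phi> ?e (g (src \<phi>) \<cdot> ?x) \<cdot> ?k" unfolding E rhs ..
        also have "\<dots> = transport b s \<phi> e (g (src \<phi>) \<cdot> x)"
          using B.push_Cmp[OF gx[OF T(1)], of ?k] k gs f' by simp
        finally show "g (tgt \<phi>) \<cdot> transport a t \<phi> e x = transport b s \<phi> e (g (src \<phi>) \<cdot> x)" .
      qed
    next
      assume "\<forall>e x. element a \<phi> e x \<longrightarrow> g (tgt \<phi>) \<cdot> transport a t \<phi> e x = transport b s \<phi> e (g (src \<phi>) \<cdot> x)"
      then show ?E using T rhs by metis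
    qed
  qed
  then have "?G \<Longrightarrow> (\<forall>\<phi> \<in> Arr Delta. g (tgt \<phi>) \<cdot> t \<phi> = s \<phi> \<cdot> pb_lift X (dg \<phi>) (b (src \<phi>))
       (pb1 X (dg \<phi>) (a (src \<phi>))) (g (src \<phi>) \<cdot> pb2 X (dg \<phi>) (a (src \<phi>)))) \<longleftrightarrow> ?P"
    using A.elt_def by auto
  then show ?thesis unfolding dmor_def by blast
qed

lemma slice_hom:
  assumes "a \<in> Arr X" "Cod X a = B" "b \<in> Arr X" "Cod X b = B"
  shows "(x, h, y) \<in> hom (slice X B) a b \<longleftrightarrow>
    x = a \<and> y = b \<and> h \<in> hom X (Dom X a) (Dom X b) \<and> b \<cdot> h = a"
  using assms by auto

text \<open>Over the terminal category a modification is a family of slice arrows. Their ends are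
  prescribed by \<alpha> and \<beta>, so only the middle components \<open>mo \<Gamma>\<close> carry
  information.\<close>

lemma md_iff:
  assumes "psn \<alpha>" "psn \<beta>"
  shows "md \<alpha> \<beta> \<Gamma> \<longleftrightarrow> \<Gamma> = mk_mod (ob \<alpha>) (ob \<beta>) (mo \<Gamma>) \<and> dmor (ob \<alpha>) (tr \<alpha>) (ob \<beta>) (tr \<beta>) (mo \<Gamma>)"
proof -
  note P = assms[unfolded psn_iff]
  interpret A: descent_data X p "ob \<alpha>" "tr \<alpha>" by (rule descent_dataI) (use P in blast)
  interpret B: descent_data X p "ob \<beta>" "tr \<beta>" by (rule descent_dataI) (use P in blast)
  let ?N = "\<forall>k \<in> Obj Delta. nat_trans terminal_cat (slice X (pw k)) (NOb \<alpha> k) (NOb \<beta> k) (\<Gamma> k)"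
  let ?N' = "\<forall>n. n \<noteq> 0 \<longrightarrow> \<Gamma> n () = (ob \<alpha> n, mo \<Gamma> n, ob \<beta> n) \<and>
    mo \<Gamma> n \<in> hom X (Dom X (ob \<alpha> n)) (Dom X (ob \<beta> n)) \<and> ob \<beta> n \<cdot> mo \<Gamma> n = ob \<alpha> n"
  have nfun: "is_functor terminal_cat (slice X (pw n)) (NOb \<alpha> n)" "is_functor terminal_cat (slice X (pw n)) (NOb \<beta> n)"
    if "n \<noteq> 0" for n
    using P that category_slice unfolding is_functor_terminal_cat by auto
  have Fn: "FAr (NOb \<alpha> n) () = (ob \<alpha> n, Ide X (Dom X (ob \<alpha> n)), ob \<alpha> n)"
    "FAr (NOb \<beta> n) () = (ob \<beta> n, Ide X (Dom X (ob \<beta> n)), ob \<beta> n)" if "n \<noteq> 0" for n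
    using P that by auto
  have NA: "NAr \<alpha> \<phi> () = (pb1 X (dg \<phi>) (ob \<alpha> (src \<phi>)), tr \<alpha> \<phi>, ob \<alpha> (tgt \<phi>))"
    and NB: "NAr \<beta> \<phi> () = (pb1 X (dg \<phi>) (ob \<beta> (src \<phi>)), tr \<beta> \<phi>, ob \<beta> (tgt \<phi>))"
    if "\<phi> \<in> Arr Delta" for \<phi> using P that by blast+
  have N: "?N \<longleftrightarrow> ?N'"
  proof -
    have "nat_trans terminal_cat (slice X (pw n)) (NOb \<alpha> n) (NOb \<beta> n) (\<Gamma> n) \<longleftrightarrow>
      \<Gamma> n () = (ob \<alpha> n, mo \<Gamma> n, ob \<beta> n) \<and>
      mo \<Gamma> n \<in> hom X (Dom X (ob \<alpha> n)) (Dom X (ob \<beta> n)) \<and> ob \<beta> n \<cdot> mo \<Gamma> n = ob \<alpha> n" if n: "n \<noteq> 0" for n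
    proof -
      obtain x h y where g: "\<Gamma> n () = (x, h, y)" by (cases "\<Gamma> n ()")
      have "nat_trans terminal_cat (slice X (pw n)) (NOb \<alpha> n) (NOb \<beta> n) (\<Gamma> n) \<longleftrightarrow>
          \<Gamma> n () \<in> hom (slice X (pw n)) (ob \<alpha> n) (ob \<beta> n) \<and>
          \<Gamma> n () \<cdot>\<^bsub>slice X (pw n)\<^esub> FAr (NOb \<alpha> n) () = FAr (NOb \<beta> n) () \<cdot>\<^bsub>slice X (pw n)\<^esub> \<Gamma> n ()"
        unfolding nat_trans_def using nfun[OF n] by (simp del: hom_def)
      also have "\<dots> \<longleftrightarrow> x = ob \<alpha> n \<and> y = ob \<beta> n \<and>
          h \<in> hom X (Dom X (ob \<alpha> n)) (Dom X (ob \<beta> n)) \<and> ob \<beta> n \<cdot> h = ob \<alpha> n"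
      proof -
        have "(x, h, y) \<in> hom (slice X (pw n)) (ob \<alpha> n) (ob \<beta> n) \<longleftrightarrow> x = ob \<alpha> n \<and> y = ob \<beta> n \<and>
          h \<in> hom X (Dom X (ob \<alpha> n)) (Dom X (ob \<beta> n)) \<and> ob \<beta> n \<cdot> h = ob \<alpha> n"
          by (rule slice_hom) (use A.a_simps[OF n] B.a_simps[OF n] in blast)+
        then show ?thesis unfolding Fn[OF n] g by (simp cong: conj_cong del: hom_def slice_simps(2)) auto
      qed
      finally show ?thesis unfolding g by simp
    qed
    then show ?thesis by auto
  qed
  let ?M = "\<forall>\<phi> \<in> Arr Delta. \<Gamma> (tgt \<phi>) () \<cdot>\<^bsub>slice X (pw (tgt \<phi>))\<^esub> NAr \<alpha> \<phi> ()
          = NAr \<beta> \<phi> () \<cdot>\<^bsub>slice X (pw (tgt \<phi>))\<^esub> FAr (pullback_funct X (dg \<phi>)) (\<Gamma> (src \<phi>) ())"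
  let ?M' = "\<forall>\<phi> \<in> Arr Delta. mo \<Gamma> (tgt \<phi>) \<cdot> tr \<alpha> \<phi> = tr \<beta> \<phi> \<cdot> pb_lift X (dg \<phi>) (ob \<beta> (src \<phi>))
       (pb1 X (dg \<phi>) (ob \<alpha> (src \<phi>))) (mo \<Gamma> (src \<phi>) \<cdot> pb2 X (dg \<phi>) (ob \<alpha> (src \<phi>)))"
  have M: "?M \<longleftrightarrow> ?M'" if n: ?N'
  proof (rule ball_cong[OF refl])
    fix \<phi> assume f: "\<phi> \<in> Arr Delta"
    define t s g h where d: "t = tr \<alpha> \<phi>" "s = tr \<beta> \<phi>" "g = mo \<Gamma> (src \<phi>)" "h = mo \<Gamma> (tgt \<phi>)"
    have e: "NAr \<alpha> \<phi> () = (pb1 X (dg \<phi>) (ob \<alpha> (src \<phi>)), t, ob \<alpha> (tgt \<phi>))"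
       "NAr \<beta> \<phi> () = (pb1 X (dg \<phi>) (ob \<beta> (src \<phi>)), s, ob \<beta> (tgt \<phi>))"
       "\<Gamma> (src \<phi>) () = (ob \<alpha> (src \<phi>), g, ob \<beta> (src \<phi>))"
       "\<Gamma> (tgt \<phi>) () = (ob \<alpha> (tgt \<phi>), h, ob \<beta> (tgt \<phi>))"
      unfolding d using NA[OF f] NB[OF f] n[THEN spec, of "src \<phi>"] n[THEN spec, of "tgt \<phi>"] f
      unfolding Delta_simps by blast+
    show "(\<Gamma> (tgt \<phi>) () \<cdot>\<^bsub>slice X (pw (tgt \<phi>))\<^esub> NAr \<alpha> \<phi> ()
          = NAr \<beta> \<phi> () \<cdot>\<^bsub>slice X (pw (tgt \<phi>))\<^esub> FAr (pullback_funct X (dg \<phi>)) (\<Gamma> (src \<phi>) ())) \<longleftrightarrow>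
      (mo \<Gamma> (tgt \<phi>) \<cdot> tr \<alpha> \<phi> = tr \<beta> \<phi> \<cdot> pb_lift X (dg \<phi>) (ob \<beta> (src \<phi>))
       (pb1 X (dg \<phi>) (ob \<alpha> (src \<phi>))) (mo \<Gamma> (src \<phi>) \<cdot> pb2 X (dg \<phi>) (ob \<alpha> (src \<phi>))))"
      unfolding e by simp
  qed
  have "md \<alpha> \<beta> \<Gamma> \<longleftrightarrow> \<Gamma> \<in> extensional (Obj Delta) \<and> ?N \<and> ?M"
    unfolding is_modification_def by simp
  also have "\<dots> \<longleftrightarrow> \<Gamma> \<in> extensional (Obj Delta) \<and> ?N' \<and> ?M'"
    using N M by blast
  also have "\<dots> \<longleftrightarrow> \<Gamma> = mk_mod (ob \<alpha>) (ob \<beta>) (mo \<Gamma>) \<and> dmor (ob \<alpha>) (tr \<alpha>) (ob \<beta>) (tr \<beta>) (mo \<Gamma>)"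
  proof -
    have "\<Gamma> = mk_mod (ob \<alpha>) (ob \<beta>) (mo \<Gamma>) \<longleftrightarrow> \<Gamma> \<in> extensional (Obj Delta) \<and>
       (\<forall>n. n \<noteq> 0 \<longrightarrow> \<Gamma> n () = (ob \<alpha> n, mo \<Gamma> n, ob \<beta> n))"
      unfolding mk_mod_def extensional_def restrict_def fun_eq_iff by auto
    then show ?thesis unfolding dmor_def by blast
  qed
  finally show ?thesis .
qed

lemma dmor_cong: "(\<And>n. n \<noteq> 0 \<Longrightarrow> g n = h n) \<Longrightarrow> dmor a t b s g \<longleftrightarrow> dmor a t b s h"
  unfolding dmor_def by auto

lemma md_mk_mod:
  assumes "psn \<alpha>" "psn \<beta>"
  shows "md \<alpha> \<beta> (mk_mod (ob \<alpha>) (ob \<beta>) g) \<longleftrightarrow> dmor (ob \<alpha>) (tr \<alpha>) (ob \<beta>) (tr \<beta>) g"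
proof -
  have "dmor (ob \<alpha>) (tr \<alpha>) (ob \<beta>) (tr \<beta>) (mo (mk_mod (ob \<alpha>) (ob \<beta>) g)) \<longleftrightarrow>
     dmor (ob \<alpha>) (tr \<alpha>) (ob \<beta>) (tr \<beta>) g"
    by (rule dmor_cong) simp
  then show ?thesis unfolding md_iff[OF assms] mk_mod_eq_iff by simp
qed

lemma psn_ddata: "psn \<alpha> \<Longrightarrow> ddata (ob \<alpha>) (tr \<alpha>)"
  unfolding psn_iff by blast

lemma ob_tr_mk_psnat [simp]:
  "n \<noteq> 0 \<Longrightarrow> ob (mk_psnat a t) n = a n" "\<phi> \<in> Arr Delta \<Longrightarrow> tr (mk_psnat a t) \<phi> = t \<phi>"
  by (simp_all add: mk_psnat_def)

lemma ddata_cong: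
  assumes "\<And>n. n \<noteq> 0 \<Longrightarrow> a n = b n" "\<And>\<phi>. \<phi> \<in> Arr Delta \<Longrightarrow> t \<phi> = s \<phi>" "ddata a t"
  shows "ddata b s"
  using assms unfolding ddata_def Let_def by auto

lemma psn_mk_psnat:
  assumes "ddata a t"
  shows "psn (mk_psnat a t)"
proof -
  have "ddata (ob (mk_psnat a t)) (tr (mk_psnat a t))"
    by (rule ddata_cong[OF _ _ assms]) simp_all
  then show ?thesis unfolding psn_iff by (auto simp: mk_psnat_def)
qed

lemma DC_simps [simp]:
  "Obj DC = {\<alpha>. psn \<alpha>}"
  "(\<alpha>, \<Gamma>, \<beta>) \<in> Arr DC \<longleftrightarrow> psn \<alpha> \<and> psn \<beta> \<and> md \<alpha> \<beta> \<Gamma>"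
  "Dom DC (\<alpha>, \<Gamma>, \<beta>) = \<alpha>" "Cod DC (\<alpha>, \<Gamma>, \<beta>) = \<beta>"
  "Ide DC \<alpha> = (\<alpha>, mk_mod (ob \<alpha>) (ob \<alpha>) (\<lambda>n. Ide X (Dom X (ob \<alpha> n))), \<alpha>)"
  by (simp_all add: desc_cat_def psnat_cat_def mk_mod_def restrict_def)

lemma DC_Cmp [simp]:
  "(\<beta>', mk_mod b c h, \<gamma>) \<cdot>\<^bsub>DC\<^esub> (\<alpha>, mk_mod a b' g, \<beta>) = (\<alpha>, mk_mod a c (\<lambda>n. h n \<cdot> g n), \<gamma>)"
  by (auto simp: desc_cat_def psnat_cat_def mk_mod_def restrict_def fun_eq_iff)

lemma dmor_Cmp:
  assumes "ddata a t" "ddata b s" "ddata c r" "dmor a t b s g" "dmor b s c r h"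
  shows "dmor a t c r (\<lambda>n. h n \<cdot> g n)"
proof -
  interpret A: descent_data X p a t by (rule descent_dataI) fact
  interpret B: descent_data X p b s by (rule descent_dataI) fact
  interpret C: descent_data X p c r by (rule descent_dataI) fact
  note g = assms(4)[unfolded dmor_iff_push[OF assms(1,2)]]
  note h = assms(5)[unfolded dmor_iff_push[OF assms(2,3)]]
  have G: "g n \<in> Arr X" "Dom X (g n) = Dom X (a n)" "Cod X (g n) = Dom X (b n)" "b n \<cdot> g n = a n"
     "h n \<in> Arr X" "Dom X (h n) = Dom X (b n)" "Cod X (h n) = Dom X (c n)" "c n \<cdot> h n = b n"
    if "n \<noteq> 0" for n using g h that by auto
  have gp: "g (tgt \<phi>) \<cdot> transport a t \<phi> e x = transport b s \<phi> e (g (src \<phi>) \<cdot> x)"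
    if "element a \<phi> e x" for \<phi> e x using g that by blast
  have hp: "h (tgt \<phi>) \<cdot> transport b s \<phi> e x = transport c r \<phi> e (h (src \<phi>) \<cdot> x)"
    if "element b \<phi> e x" for \<phi> e x using h that by blast
  have "h (tgt \<phi>) \<cdot> (g (tgt \<phi>) \<cdot> transport a t \<phi> e x) = transport c r \<phi> e (h (src \<phi>) \<cdot> (g (src \<phi>) \<cdot> x))"
    if e: "element a \<phi> e x" for \<phi> e x
  proof -
    have "element b \<phi> e (g (src \<phi>) \<cdot> x)"
      using e G reassoc[OF G(4)] unfolding A.elt_def B.elt_def by simp
    then show ?thesis using gp[OF e] hp by simp
  qed
  moreover have "c n \<cdot> (h n \<cdot> g n) = a n" if "n \<noteq> 0" for n
    using G[OF that] reassoc[OF G(8)[OF that]] that by simp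
  ultimately show ?thesis
    unfolding dmor_iff_push[OF assms(1,3)]
    using G by (auto simp: A.elt_def)
qed

lemma dmor_Ide:
  assumes "ddata a t"
  shows "dmor a t a t (\<lambda>n. Ide X (Dom X (a n)))"
proof -
  interpret A: descent_data X p a t by (rule descent_dataI) fact
  show ?thesis unfolding dmor_iff_push[OF assms assms]
    by (auto simp: A.elt_def A.push_simps)
qed

lemma Arr_DC:
  assumes "f \<in> Arr DC"
  obtains \<alpha> \<beta> g where "f = (\<alpha>, mk_mod (ob \<alpha>) (ob \<beta>) g, \<beta>)" "psn \<alpha>" "psn \<beta>" "ddata (ob \<alpha>) (tr \<alpha>)" "ddata (ob \<beta>) (tr \<beta>)"
    "dmor (ob \<alpha>) (tr \<alpha>) (ob \<beta>) (tr \<beta>) g"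
proof -
  obtain \<alpha> \<Gamma> \<beta> where f: "f = (\<alpha>, \<Gamma>, \<beta>)" by (cases f)
  then have a: "psn \<alpha>" "psn \<beta>" "md \<alpha> \<beta> \<Gamma>" using assms by auto
  show thesis
    by (rule that[of \<alpha> \<beta> "mo \<Gamma>"]) (use a md_iff[OF a(1,2)] f psn_ddata in auto)
qed

lemma category_DC: "category DC"
proof
  fix f assume "f \<in> Arr DC"
  then show "Dom DC f \<in> Obj DC" "Cod DC f \<in> Obj DC" by (auto elim!: Arr_DC)
next
  fix \<alpha> assume "\<alpha> \<in> Obj DC"
  then show "Ide DC \<alpha> \<in> hom DC \<alpha> \<alpha>" using dmor_Ide[OF psn_ddata] by (auto simp: md_mk_mod)
next
  fix f g x y z assume f: "f \<in> hom DC x y" and g: "g \<in> hom DC y z"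
  obtain u where u: "f = (x, mk_mod (ob x) (ob y) u, y)" "psn x" "psn y" "ddata (ob x) (tr x)" "ddata (ob y) (tr y)"
    "dmor (ob x) (tr x) (ob y) (tr y) u" using f by (auto elim!: Arr_DC)
  obtain v where v: "g = (y, mk_mod (ob y) (ob z) v, z)" "psn z" "ddata (ob z) (tr z)"
    "dmor (ob y) (tr y) (ob z) (tr z) v" using g by (auto elim!: Arr_DC)
  show "g \<cdot>\<^bsub>DC\<^esub> f \<in> hom DC x z"
    using u v dmor_Cmp[OF u(4,5) v(3) u(6) v(4)] by (simp add: md_mk_mod)
next
  fix f x y assume f: "f \<in> hom DC x y"
  obtain u where u: "f = (x, mk_mod (ob x) (ob y) u, y)" "dmor (ob x) (tr x) (ob y) (tr y) u"
    using f by (auto elim!: Arr_DC)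
  show "f \<cdot>\<^bsub>DC\<^esub> Ide DC x = f" "Ide DC y \<cdot>\<^bsub>DC\<^esub> f = f"
    using u by (auto simp: mk_mod_eq_iff dmor_def)
next
  fix f g h w x y z assume f: "f \<in> hom DC w x" and g: "g \<in> hom DC x y" and h: "h \<in> hom DC y z"
  obtain u where u: "f = (w, mk_mod (ob w) (ob x) u, x)" "dmor (ob w) (tr w) (ob x) (tr x) u"
    using f by (auto elim!: Arr_DC)
  obtain v where v: "g = (x, mk_mod (ob x) (ob y) v, y)" "dmor (ob x) (tr x) (ob y) (tr y) v"
    using g by (auto elim!: Arr_DC)
  obtain r where r: "h = (y, mk_mod (ob y) (ob z) r, z)" "dmor (ob y) (tr y) (ob z) (tr z) r"
    using h by (auto elim!: Arr_DC)
  show "(h \<cdot>\<^bsub>DC\<^esub> g) \<cdot>\<^bsub>DC\<^esub> f = h \<cdot>\<^bsub>DC\<^esub> g \<cdot>\<^bsub>DC\<^esub> f"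
    using u v r by (auto simp: mk_mod_eq_iff dmor_def)
qed

text \<open>The componentwise inverses \<open>h\<close> commute with transport automatically: write
  an element \<open>x\<close> as g (h x), move \<open>g\<close> out of the transport and cancel it
  against \<open>h\<close>.\<close>

lemma iso_DC:
  assumes "psn \<alpha>" "psn \<beta>" "dmor (ob \<alpha>) (tr \<alpha>) (ob \<beta>) (tr \<beta>) g"
  shows "iso DC (\<alpha>, mk_mod (ob \<alpha>) (ob \<beta>) g, \<beta>) \<longleftrightarrow> (\<forall>n. n \<noteq> 0 \<longrightarrow> iso X (g n))"
proof
  let ?f = "(\<alpha>, mk_mod (ob \<alpha>) (ob \<beta>) g, \<beta>)"
  note G = assms(3)[unfolded dmor_def]
  assume "iso DC ?f"
  then obtain k where k: "k \<in> hom DC (Cod DC ?f) (Dom DC ?f)"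
    "k \<cdot>\<^bsub>DC\<^esub> ?f = Ide DC (Dom DC ?f)" "?f \<cdot>\<^bsub>DC\<^esub> k = Ide DC (Cod DC ?f)"
    unfolding iso_def by blast
  obtain h where h: "k = (\<beta>, mk_mod (ob \<beta>) (ob \<alpha>) h, \<alpha>)" "dmor (ob \<beta>) (tr \<beta>) (ob \<alpha>) (tr \<alpha>) h"
    using k(1) by (auto elim!: Arr_DC)
  show "\<forall>n. n \<noteq> 0 \<longrightarrow> iso X (g n)"
  proof (intro allI impI)
    fix n :: nat assume n: "n \<noteq> 0"
    show "iso X (g n)"
      using k(2,3) n G h(2)[unfolded dmor_def] unfolding h(1)
      by (intro isoI[of "g n" "h n"]) (auto simp: mk_mod_eq_iff)
  qed
next
  assume i: "\<forall>n. n \<noteq> 0 \<longrightarrow> iso X (g n)"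
  note dd = psn_ddata[OF assms(1)] psn_ddata[OF assms(2)]
  interpret A: descent_data X p "ob \<alpha>" "tr \<alpha>" by (rule descent_dataI) fact
  interpret B: descent_data X p "ob \<beta>" "tr \<beta>" by (rule descent_dataI) fact
  note G = assms(3)[unfolded dmor_iff_push[OF dd]]
  have "\<exists>h. \<forall>n. n \<noteq> 0 \<longrightarrow> h n \<in> Arr X \<and> Dom X (h n) = Cod X (g n) \<and> Cod X (h n) = Dom X (g n) \<and>
    h n \<cdot> g n = Ide X (Dom X (g n)) \<and> g n \<cdot> h n = Ide X (Cod X (g n))"
    by (rule choice) (use i isoE in metis)
  then obtain h where h: "\<And>n. n \<noteq> 0 \<Longrightarrow> h n \<in> Arr X" "\<And>n. n \<noteq> 0 \<Longrightarrow> Dom X (h n) = Dom X (ob \<beta> n)"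
    "\<And>n. n \<noteq> 0 \<Longrightarrow> Cod X (h n) = Dom X (ob \<alpha> n)"
    "\<And>n. n \<noteq> 0 \<Longrightarrow> h n \<cdot> g n = Ide X (Dom X (ob \<alpha> n))" "\<And>n. n \<noteq> 0 \<Longrightarrow> g n \<cdot> h n = Ide X (Dom X (ob \<beta> n))"
    using G by auto
  have g: "g n \<in> Arr X" "Dom X (g n) = Dom X (ob \<alpha> n)" "Cod X (g n) = Dom X (ob \<beta> n)" "ob \<beta> n \<cdot> g n = ob \<alpha> n"
    if "n \<noteq> 0" for n using G that by auto
  have hh: "ob \<alpha> n \<cdot> h n = ob \<beta> n" if "n \<noteq> 0" for n
    using reassoc[OF g(4)[OF that], of "h n"] h(1-3,5)[OF that] g(1-3)[OF that] that by simp
  have "h (tgt \<phi>) \<cdot> transport (ob \<beta>) (tr \<beta>) \<phi> e x = transport (ob \<alpha>) (tr \<alpha>) \<phi> e (h (src \<phi>) \<cdot> x)"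
    if e: "element (ob \<beta>) \<phi> e x" for \<phi> e x
  proof -
    note e' = e[unfolded B.elt_def]
    have s: "src \<phi> \<noteq> 0" "tgt \<phi> \<noteq> 0" using e' by auto
    have x: "element (ob \<alpha>) \<phi> e (h (src \<phi>) \<cdot> x)"
      using e' h(1-3)[OF s(1)] reassoc[OF hh[OF s(1)]] unfolding A.elt_def by simp
    have "g (src \<phi>) \<cdot> (h (src \<phi>) \<cdot> x) = x"
      using reassoc[OF h(5)[OF s(1)]] e' h(1-3)[OF s(1)] g(1-3)[OF s(1)] by simp
    then have "g (tgt \<phi>) \<cdot> transport (ob \<alpha>) (tr \<alpha>) \<phi> e (h (src \<phi>) \<cdot> x) = transport (ob \<beta>) (tr \<beta>) \<phi> e x"
      using G[THEN conjunct2, rule_format, OF x] by simp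
    then have "h (tgt \<phi>) \<cdot> transport (ob \<beta>) (tr \<beta>) \<phi> e x = h (tgt \<phi>) \<cdot> (g (tgt \<phi>) \<cdot> transport (ob \<alpha>) (tr \<alpha>) \<phi> e (h (src \<phi>) \<cdot> x))"
      by simp
    also have "\<dots> = transport (ob \<alpha>) (tr \<alpha>) \<phi> e (h (src \<phi>) \<cdot> x)"
      using reassoc[OF h(4)[OF s(2)]] A.push_simps[OF x] e' h(1-3)[OF s(2)] g(1-3)[OF s(2)] by simp
    finally show ?thesis .
  qed
  then have "dmor (ob \<beta>) (tr \<beta>) (ob \<alpha>) (tr \<alpha>) h"
    unfolding dmor_iff_push[OF dd(2,1)] using h(1-3) hh by auto
  then show "iso DC (\<alpha>, mk_mod (ob \<alpha>) (ob \<beta>) g, \<beta>)"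
    using assms h(4,5)
    by (intro category.isoI[OF category_DC, of _ "(\<beta>, mk_mod (ob \<beta>) (ob \<alpha>) h, \<alpha>)"])
      (simp_all add: md_mk_mod mk_mod_eq_iff)
qed

end

text \<open>Here \<open>e\<close> is an element of the n-th power and \<open>z\<close> an element of
  the domain of \<open>c\<close> over the same point of the base. In the locale below
  \<open>c \<cdot> z\<close> may differ from the point \<open>r n \<cdot> e\<close>, and
  \<open>act\<close> moves \<open>z\<close> there.\<close>

definition (in descent) ok_elt :: "'a \<Rightarrow> 'a \<Rightarrow> nat \<Rightarrow> 'a \<Rightarrow> 'a \<Rightarrow> bool" where
  "ok_elt w c n e z \<longleftrightarrow> n \<noteq> 0 \<and> e \<in> Arr X \<and> Cod X e = pw n \<and> z \<in> Arr X \<and> Cod X z = Dom X c \<and>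
    Dom X z = Dom X e \<and> w \<cdot> (c \<cdot> z) = leg n \<cdot> e"

text \<open>Both the image of an object of \<open>X/B\<close> under the comparison (\<open>r n = leg n\<close>, \<open>act n e z = z\<close>)
  and the descent datum of an action (\<open>r n = prj n 0\<close>) are of this form.\<close>

locale descent_family = descent X p for X :: "('o, 'a) cat" (structure) and p :: 'a +
  fixes w c :: 'a and r :: "nat \<Rightarrow> 'a" and act :: "nat \<Rightarrow> 'a \<Rightarrow> 'a \<Rightarrow> 'a"
  assumes c: "c \<in> Arr X" and w: "w \<in> Arr X" "Cod X c = Dom X w"
    and r: "\<And>n. n \<noteq> 0 \<Longrightarrow> r n \<in> Arr X \<and> Dom X (r n) = pw n \<and> Cod X (r n) = Cod X c \<and> w \<cdot> r n = leg n"
    and act: "\<And>n e z. ok_elt w c n e z \<Longrightarrow> act n e z \<in> Arr X \<and> Dom X (act n e z) = Dom X e \<and>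
      Cod X (act n e z) = Dom X c \<and> c \<cdot> act n e z = r n \<cdot> e"
    and act_Cmp: "\<And>n e z k. ok_elt w c n e z \<Longrightarrow> k \<in> Arr X \<Longrightarrow> Cod X k = Dom X e \<Longrightarrow>
      act n e z \<cdot> k = act n (e \<cdot> k) (z \<cdot> k)"
    and act_unit: "\<And>n e z. ok_elt w c n e z \<Longrightarrow> c \<cdot> z = r n \<cdot> e \<Longrightarrow> act n e z = z"
    and act_act: "\<And>n m e e' z. ok_elt w c n e z \<Longrightarrow> ok_elt w c m e' z \<Longrightarrow> act n e (act m e' z) = act n e z"
begin

abbreviation "ok \<equiv> ok_elt w c"

definition fam_ob :: "nat \<Rightarrow> 'a" where "fam_ob n = pb1 X (r n) c"

text \<open>On elements, (e, z) goes to (e, act e z). Acting is necessary because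
  \<open>r (src \<phi>) \<cdot> dg \<phi>\<close> and \<open>r (tgt \<phi>)\<close> may differ: for
  \<open>r n = prj n 0\<close> they are the projections with index \<phi>(0) and 0.\<close>

definition fam_tr :: "nat \<times> (nat \<Rightarrow> nat) \<times> nat \<Rightarrow> 'a" where
  "fam_tr \<phi> = (let e = pb1 X (dg \<phi>) (fam_ob (src \<phi>)) in
     pb_lift X (r (tgt \<phi>)) c e (act (tgt \<phi>) e (pb2 X (r (src \<phi>)) c \<cdot> pb2 X (dg \<phi>) (fam_ob (src \<phi>)))))"

lemma r_simps [simp]:
  assumes "n \<noteq> 0" shows "r n \<in> Arr X" "Dom X (r n) = pw n" "Cod X (r n) = Cod X c" "w \<cdot> r n = leg n"
  using r assms by auto

lemma w_r_reassoc [simp]: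
  assumes "n \<noteq> 0" "x \<in> Arr X" "Cod X x = pw n" shows "w \<cdot> (r n \<cdot> x) = leg n \<cdot> x"
  using assms reassoc[OF r_simps(4)[OF assms(1)]] w by simp

lemmas cw_simps [simp] = c w

lemma fam_ob_simps [simp]:
  assumes "n \<noteq> 0"
  shows "fam_ob n \<in> Arr X" "Cod X (fam_ob n) = pw n"
    "pb2 X (r n) c \<in> Arr X" "Dom X (pb2 X (r n) c) = Dom X (fam_ob n)" "Cod X (pb2 X (r n) c) = Dom X c"
    "c \<cdot> pb2 X (r n) c = r n \<cdot> fam_ob n"
  using assms by (simp_all add: fam_ob_def)

lemma fam_ob_reassoc [simp]:
  assumes "n \<noteq> 0" "x \<in> Arr X" "Cod X x = Dom X (fam_ob n)"
  shows "c \<cdot> (pb2 X (r n) c \<cdot> x) = r n \<cdot> (fam_ob n \<cdot> x)"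
  using assms by (simp add: fam_ob_def)

lemma fam_lift:
  assumes "n \<noteq> 0" "e \<in> Arr X" "Cod X e = pw n" "z \<in> Arr X" "Dom X z = Dom X e" "Cod X z = Dom X c"
    "c \<cdot> z = r n \<cdot> e"
  shows "pb_lift X (r n) c e z \<in> Arr X" "Dom X (pb_lift X (r n) c e z) = Dom X e"
    "Cod X (pb_lift X (r n) c e z) = Dom X (fam_ob n)" "fam_ob n \<cdot> pb_lift X (r n) c e z = e"
    "pb2 X (r n) c \<cdot> pb_lift X (r n) c e z = z"
  using assms by (simp_all add: fam_ob_def)

lemma fam_ext:
  assumes "fam_ob n \<cdot> h = fam_ob n \<cdot> k" "pb2 X (r n) c \<cdot> h = pb2 X (r n) c \<cdot> k" "n \<noteq> 0"
    "h \<in> Arr X" "k \<in> Arr X" "Dom X h = Dom X k" "Cod X h = Dom X (fam_ob n)" "Cod X k = Dom X (fam_ob n)"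
  shows "h = k"
  using pb_ext[of "r n" c h k] assms unfolding fam_ob_def by simp

lemmas fam_fold [simp] = fam_ob_def[symmetric]

text \<open>Composition with \<open>w\<close> turns every \<open>r n\<close> into the leg, so an
  element over any reindexing of \<open>e\<close> is admissible for \<open>act\<close>.\<close>

lemma ok_eltI:
  assumes "\<phi> \<in> Arr Delta_dot" "src \<phi> \<noteq> 0" "tgt \<phi> \<noteq> 0" "e \<in> Arr X" "Cod X e = pw (tgt \<phi>)"
    "x \<in> Arr X" "Dom X x = Dom X e" "Cod X x = Dom X (fam_ob (src \<phi>))" "fam_ob (src \<phi>) \<cdot> x = dg \<phi> \<cdot> e"
  shows "ok (tgt \<phi>) e (pb2 X (r (src \<phi>)) c \<cdot> x)"
  using assms unfolding ok_elt_def by simp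

lemma fam_tr_props:
  assumes "\<phi> \<in> Arr Delta_dot" "src \<phi> \<noteq> 0" "tgt \<phi> \<noteq> 0"
  shows "fam_tr \<phi> \<in> Arr X" "Dom X (fam_tr \<phi>) = Dom X (pb1 X (dg \<phi>) (fam_ob (src \<phi>)))"
    "Cod X (fam_tr \<phi>) = Dom X (fam_ob (tgt \<phi>))" "fam_ob (tgt \<phi>) \<cdot> fam_tr \<phi> = pb1 X (dg \<phi>) (fam_ob (src \<phi>))"
    "pb2 X (r (tgt \<phi>)) c \<cdot> fam_tr \<phi> =
      act (tgt \<phi>) (pb1 X (dg \<phi>) (fam_ob (src \<phi>))) (pb2 X (r (src \<phi>)) c \<cdot> pb2 X (dg \<phi>) (fam_ob (src \<phi>)))"
proof -
  let ?e = "pb1 X (dg \<phi>) (fam_ob (src \<phi>))" and ?z = "pb2 X (r (src \<phi>)) c \<cdot> pb2 X (dg \<phi>) (fam_ob (src \<phi>))"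
  have "ok (tgt \<phi>) ?e ?z" by (rule ok_eltI) (use assms in simp_all)
  then show "fam_tr \<phi> \<in> Arr X" "Dom X (fam_tr \<phi>) = Dom X ?e"
    "Cod X (fam_tr \<phi>) = Dom X (fam_ob (tgt \<phi>))" "fam_ob (tgt \<phi>) \<cdot> fam_tr \<phi> = ?e"
    "pb2 X (r (tgt \<phi>)) c \<cdot> fam_tr \<phi> = act (tgt \<phi>) ?e ?z"
    using act[of "tgt \<phi>" ?e ?z] fam_lift[of "tgt \<phi>" ?e "act (tgt \<phi>) ?e ?z"] assms
    unfolding fam_tr_def Let_def by simp_all
qed

text \<open>Evaluates \<open>fam_tr\<close> at an arbitrary element, using that \<open>act\<close>
  is natural in the stage.\<close>

lemma fam_tr_Cmp:
  assumes "\<phi> \<in> Arr Delta_dot" "src \<phi> \<noteq> 0" "tgt \<phi> \<noteq> 0" "e \<in> Arr X" "Cod X e = pw (tgt \<phi>)"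
    "x \<in> Arr X" "Dom X x = Dom X e" "Cod X x = Dom X (fam_ob (src \<phi>))" "fam_ob (src \<phi>) \<cdot> x = dg \<phi> \<cdot> e"
  defines "l \<equiv> pb_lift X (dg \<phi>) (fam_ob (src \<phi>)) e x"
  shows "fam_tr \<phi> \<cdot> l \<in> Arr X" "Dom X (fam_tr \<phi> \<cdot> l) = Dom X e" "Cod X (fam_tr \<phi> \<cdot> l) = Dom X (fam_ob (tgt \<phi>))"
    "fam_ob (tgt \<phi>) \<cdot> (fam_tr \<phi> \<cdot> l) = e"
    "pb2 X (r (tgt \<phi>)) c \<cdot> (fam_tr \<phi> \<cdot> l) = act (tgt \<phi>) e (pb2 X (r (src \<phi>)) c \<cdot> x)"
proof -
  note T = fam_tr_props[OF assms(1-3)]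
  let ?e = "pb1 X (dg \<phi>) (fam_ob (src \<phi>))" and ?z = "pb2 X (r (src \<phi>)) c \<cdot> pb2 X (dg \<phi>) (fam_ob (src \<phi>))"
  have l: "l \<in> Arr X" "Dom X l = Dom X e" "Cod X l = Dom X ?e" "?e \<cdot> l = e" "pb2 X (dg \<phi>) (fam_ob (src \<phi>)) \<cdot> l = x"
    using assms unfolding l_def by simp_all
  have ok: "ok (tgt \<phi>) ?e ?z" by (rule ok_eltI) (use assms in simp_all)
  show "fam_tr \<phi> \<cdot> l \<in> Arr X" "Dom X (fam_tr \<phi> \<cdot> l) = Dom X e" "Cod X (fam_tr \<phi> \<cdot> l) = Dom X (fam_ob (tgt \<phi>))"
    "fam_ob (tgt \<phi>) \<cdot> (fam_tr \<phi> \<cdot> l) = e"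
    "pb2 X (r (tgt \<phi>)) c \<cdot> (fam_tr \<phi> \<cdot> l) = act (tgt \<phi>) e (pb2 X (r (src \<phi>)) c \<cdot> x)"
    using T l reassoc[OF T(4)] reassoc[OF T(5)] act_Cmp[OF ok l(1)] assms(1-9) by simp_all
qed

text \<open>Everything is checked on the coordinate in the domain of \<open>c\<close>. There acting
  twice is the same as the last action alone, by \<open>act_act\<close>; this gives the composition
  law and, with \<open>act_unit\<close>, the inverses.\<close>

lemma ddata_fam: "ddata fam_ob fam_tr"
  unfolding ddata_def
proof (intro conjI allI ballI impI)
  fix n :: nat assume "n \<noteq> 0"
  then show "fam_ob n \<in> Arr X" "Cod X (fam_ob n) = pw n" by auto
next
  fix \<phi> assume f: "\<phi> \<in> Arr Delta"
  then have f': "\<phi> \<in> Arr Delta_dot" "src \<phi> \<noteq> 0" "tgt \<phi> \<noteq> 0" by auto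
  note T = fam_tr_props[OF f']
  show "fam_tr \<phi> \<in> hom X (Dom X (pb1 X (dg \<phi>) (fam_ob (src \<phi>)))) (Dom X (fam_ob (tgt \<phi>)))"
    "fam_ob (tgt \<phi>) \<cdot> fam_tr \<phi> = pb1 X (dg \<phi>) (fam_ob (src \<phi>))" using T by auto
  let ?e = "fam_ob (tgt \<phi>)" and ?z = "pb2 X (r (tgt \<phi>)) c"
  \<comment> \<open>The inverse moves the second coordinate back to the point selected at the source
    of \<phi>; acting forward again returns the original element.\<close>
  let ?z' = "act (src \<phi>) (dg \<phi> \<cdot> ?e) ?z"
  have ok: "ok (src \<phi>) (dg \<phi> \<cdot> ?e) ?z" using f' unfolding ok_elt_def by simp
  note a = act[OF ok]
  define x where "x = pb_lift X (r (src \<phi>)) c (dg \<phi> \<cdot> ?e) ?z'"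
  have x: "x \<in> Arr X" "Dom X x = Dom X ?e" "Cod X x = Dom X (fam_ob (src \<phi>))" "fam_ob (src \<phi>) \<cdot> x = dg \<phi> \<cdot> ?e"
    "pb2 X (r (src \<phi>)) c \<cdot> x = ?z'"
    using fam_lift[of "src \<phi>" "dg \<phi> \<cdot> ?e" ?z'] f' a unfolding x_def by simp_all
  define l where "l = pb_lift X (dg \<phi>) (fam_ob (src \<phi>)) ?e x"
  have l: "l \<in> Arr X" "Dom X l = Dom X ?e" "Cod X l = Dom X (pb1 X (dg \<phi>) (fam_ob (src \<phi>)))"
    "pb1 X (dg \<phi>) (fam_ob (src \<phi>)) \<cdot> l = ?e" "pb2 X (dg \<phi>) (fam_ob (src \<phi>)) \<cdot> l = x"
    using x f' unfolding l_def by simp_all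
  note C = fam_tr_Cmp[OF f' _ _ x(1-4), folded l_def]
  have ok': "ok (tgt \<phi>) ?e ?z" using f' unfolding ok_elt_def by simp
  have aa: "act (tgt \<phi>) ?e ?z' = ?z"
    using act_act[OF ok' ok] act_unit[OF ok'] f' by simp
  have 1: "fam_tr \<phi> \<cdot> l = Ide X (Dom X ?e)"
    by (rule fam_ext[of "tgt \<phi>"]) (use C f' aa x in simp_all)
  let ?P = "pb1 X (dg \<phi>) (fam_ob (src \<phi>))" and ?Q = "pb2 X (dg \<phi>) (fam_ob (src \<phi>))"
  let ?q = "pb2 X (r (src \<phi>)) c \<cdot> ?Q"
  have okq: "ok (tgt \<phi>) ?P ?q" by (rule ok_eltI) (use f' in simp_all)
  have okq': "ok (src \<phi>) (dg \<phi> \<cdot> ?P) ?q" using f' unfolding ok_elt_def by simp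
  have "pb2 X (r (src \<phi>)) c \<cdot> (x \<cdot> fam_tr \<phi>) = act (src \<phi>) (dg \<phi> \<cdot> ?P) (act (tgt \<phi>) ?P ?q)"
    using reassoc[OF x(5)] act_Cmp[OF ok T(1)] T x f' by simp
  also have "\<dots> = ?q"
    using act_act[OF okq' okq] act_unit[OF okq'] f' by simp
  finally have q: "pb2 X (r (src \<phi>)) c \<cdot> (x \<cdot> fam_tr \<phi>) = ?q" .
  have Q: "x \<cdot> fam_tr \<phi> = ?Q"
    by (rule fam_ext[of "src \<phi>"]) (use q T x f' reassoc[OF x(4)] in simp_all)
  have "l \<cdot> fam_tr \<phi> = Ide X (Dom X ?P)"
    by (rule pb_ext[of "dg \<phi>" "fam_ob (src \<phi>)"]) (use Q T l f' reassoc[OF l(4)] reassoc[OF l(5)] in simp_all)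
  with 1 show "iso X (fam_tr \<phi>)" using T l by (intro isoI[of _ l]) simp_all
next
  fix n :: nat assume n: "n \<noteq> 0"
  let ?l = "pb_lift X (Ide X (pw n)) (fam_ob n) (fam_ob n) (Ide X (Dom X (fam_ob n)))"
  have C: "fam_tr (Ide Delta_dot n) \<cdot> ?l \<in> Arr X" "Dom X (fam_tr (Ide Delta_dot n) \<cdot> ?l) = Dom X (fam_ob n)"
    "Cod X (fam_tr (Ide Delta_dot n) \<cdot> ?l) = Dom X (fam_ob n)"
    "fam_ob n \<cdot> (fam_tr (Ide Delta_dot n) \<cdot> ?l) = fam_ob n"
    "pb2 X (r n) c \<cdot> (fam_tr (Ide Delta_dot n) \<cdot> ?l) = act n (fam_ob n) (pb2 X (r n) c)"
    using fam_tr_Cmp[of "Ide Delta_dot n" "fam_ob n" "Ide X (Dom X (fam_ob n))"] n by simp_all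
  have ok: "ok n (fam_ob n) (pb2 X (r n) c)" using n unfolding ok_elt_def by simp
  have "fam_tr (Ide Delta_dot n) \<cdot> ?l = Ide X (Dom X (fam_ob n))"
    by (rule fam_ext[of n]) (use C n act_unit[OF ok] in simp_all)
  then show "fam_tr (Ide Delta n) \<cdot> ?l = Ide X (Dom X (fam_ob n))" by simp
next
  fix \<phi> \<psi> assume f: "\<phi> \<in> Arr Delta" "\<psi> \<in> Arr Delta" "tgt \<phi> = src \<psi>"
  then have f': "\<phi> \<in> Arr Delta_dot" "src \<phi> \<noteq> 0" "tgt \<phi> \<noteq> 0" "\<psi> \<in> Arr Delta_dot" "src \<psi> \<noteq> 0" "tgt \<psi> \<noteq> 0" by auto
  define b where "b = pb1 X (dg \<phi>) (fam_ob (src \<phi>))"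
  define b2 where "b2 = pb2 X (dg \<phi>) (fam_ob (src \<phi>))"
  \<comment> \<open>\<open>x\<close> is the universal element of the iterated pullback and
    \<open>y\<close> its transport along \<phi>. Both sides get the second coordinate
    \<open>act (tgt \<psi>) ?e ?q\<close>, since the detour through \<open>tgt \<phi>\<close> adds
    an action that the later one forgets.\<close>
  define x where "x = b2 \<cdot> pb2 X (dg \<psi>) b"
  define y where "y = fam_tr \<phi> \<cdot> pb2 X (dg \<psi>) b"
  note T = fam_tr_props[OF f'(1-3), folded b_def b2_def]
  have b: "b \<in> Arr X" "Cod X b = pw (src \<psi>)" "b2 \<in> Arr X" "Dom X b2 = Dom X b" "Cod X b2 = Dom X (fam_ob (src \<phi>))"
    "fam_ob (src \<phi>) \<cdot> b2 = dg \<phi> \<cdot> b"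
    using f' f(3) unfolding b_def b2_def by simp_all
  let ?e = "pb1 X (dg \<psi>) b"
  have x: "x \<in> Arr X" "Dom X x = Dom X ?e" "Cod X x = Dom X (fam_ob (src \<phi>))"
    "fam_ob (src \<phi>) \<cdot> x = dg (\<psi> \<cdot>\<^bsub>Delta_dot\<^esub> \<phi>) \<cdot> ?e"
    using b f' f(3) reassoc[OF b(6)] unfolding x_def by simp_all
  have y: "y \<in> Arr X" "Dom X y = Dom X ?e" "Cod X y = Dom X (fam_ob (src \<psi>))"
    "fam_ob (src \<psi>) \<cdot> y = dg \<psi> \<cdot> ?e" "pb2 X (r (src \<psi>)) c \<cdot> y = act (tgt \<phi>) (dg \<psi> \<cdot> ?e) (pb2 X (r (src \<phi>)) c \<cdot> x)"
  proof -
    have ok: "ok (tgt \<phi>) b (pb2 X (r (src \<phi>)) c \<cdot> b2)"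
      by (rule ok_eltI) (use b f' f(3) in simp_all)
    show "y \<in> Arr X" "Dom X y = Dom X ?e" "Cod X y = Dom X (fam_ob (src \<psi>))" "fam_ob (src \<psi>) \<cdot> y = dg \<psi> \<cdot> ?e"
      using b f' T f(3) reassoc[OF T(4)] unfolding y_def by simp_all
    have "pb2 X (r (src \<psi>)) c \<cdot> y = act (tgt \<phi>) b (pb2 X (r (src \<phi>)) c \<cdot> b2) \<cdot> pb2 X (dg \<psi>) b"
      using b f' T f(3) reassoc[OF T(5)] unfolding y_def by simp
    also have "\<dots> = act (tgt \<phi>) (dg \<psi> \<cdot> ?e) (pb2 X (r (src \<phi>)) c \<cdot> x)"
      using b f' f(3) act_Cmp[OF ok, of "pb2 X (dg \<psi>) b"] unfolding x_def by simp
    finally show "pb2 X (r (src \<psi>)) c \<cdot> y = act (tgt \<phi>) (dg \<psi> \<cdot> ?e) (pb2 X (r (src \<phi>)) c \<cdot> x)" .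
  qed
  have e: "?e \<in> Arr X" "Cod X ?e = pw (tgt \<psi>)" using b f' by simp_all
  let ?q = "pb2 X (r (src \<phi>)) c \<cdot> x"
  have ok1: "ok (tgt \<psi>) ?e ?q"
    using ok_eltI[of "\<psi> \<cdot>\<^bsub>Delta_dot\<^esub> \<phi>" ?e x] f' f(3) e x by simp
  have ok2: "ok (tgt \<phi>) (dg \<psi> \<cdot> ?e) ?q"
    by (rule ok_eltI) (use f' f(3) e x in simp_all)
  let ?lhs = "fam_tr (\<psi> \<cdot>\<^bsub>Delta_dot\<^esub> \<phi>) \<cdot> pb_lift X (dg \<phi> \<cdot> dg \<psi>) (fam_ob (src \<phi>)) ?e x"
  have L: "?lhs \<in> Arr X" "Dom X ?lhs = Dom X ?e" "Cod X ?lhs = Dom X (fam_ob (tgt \<psi>))"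
    "fam_ob (tgt \<psi>) \<cdot> ?lhs = ?e" "pb2 X (r (tgt \<psi>)) c \<cdot> ?lhs = act (tgt \<psi>) ?e ?q"
    using fam_tr_Cmp[of "\<psi> \<cdot>\<^bsub>Delta_dot\<^esub> \<phi>" ?e x] e x f' f(3) by simp_all
  let ?rhs = "fam_tr \<psi> \<cdot> pb_lift X (dg \<psi>) (fam_ob (src \<psi>)) ?e y"
  have R: "?rhs \<in> Arr X" "Dom X ?rhs = Dom X ?e" "Cod X ?rhs = Dom X (fam_ob (tgt \<psi>))"
    "fam_ob (tgt \<psi>) \<cdot> ?rhs = ?e" "pb2 X (r (tgt \<psi>)) c \<cdot> ?rhs = act (tgt \<psi>) ?e ?q"
    using fam_tr_Cmp[of "\<psi>" ?e y] e y f' f(3) act_act[OF ok1 ok2] by simp_all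
  have "?lhs = ?rhs"
    by (rule fam_ext[of "tgt \<psi>"]) (use L R f' in \<open>simp_all only: not_False_eq_True\<close>)
  then show "let b = pb1 X (dg \<phi>) (fam_ob (src \<phi>)) in
       fam_tr (\<psi> \<cdot>\<^bsub>Delta\<^esub> \<phi>) \<cdot> pb_lift X (dg \<phi> \<cdot> dg \<psi>) (fam_ob (src \<phi>)) (pb1 X (dg \<psi>) b)
             (pb2 X (dg \<phi>) (fam_ob (src \<phi>)) \<cdot> pb2 X (dg \<psi>) b)
         = fam_tr \<psi> \<cdot> pb_lift X (dg \<psi>) (fam_ob (tgt \<phi>)) (pb1 X (dg \<psi>) b) (fam_tr \<phi> \<cdot> pb2 X (dg \<psi>) b)"
    unfolding Let_def x_def y_def b_def b2_def Delta_simps using f(3) by simp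
qed

lemma push_fam:
  assumes "element fam_ob \<phi> e x"
  shows "pb2 X (r (tgt \<phi>)) c \<cdot> transport fam_ob fam_tr \<phi> e x = act (tgt \<phi>) e (pb2 X (r (src \<phi>)) c \<cdot> x)"
proof -
  interpret F: descent_data X p fam_ob fam_tr by (rule descent_dataI[OF ddata_fam])
  show ?thesis using assms unfolding F.elt_def F.push_def by (intro fam_tr_Cmp) auto
qed

end

section \<open>Equivalences of categories\<close>

lemma is_functorD:
  assumes "is_functor C D F"
  shows "category C" "category D" "x \<in> Obj C \<Longrightarrow> FOb F x \<in> Obj D"
    "f \<in> Arr C \<Longrightarrow> FAr F f \<in> Arr D" "f \<in> Arr C \<Longrightarrow> Dom D (FAr F f) = FOb F (Dom C f)"
    "f \<in> Arr C \<Longrightarrow> Cod D (FAr F f) = FOb F (Cod C f)"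
    "x \<in> Obj C \<Longrightarrow> FAr F (Ide C x) = Ide D (FOb F x)"
    "f \<in> Arr C \<Longrightarrow> g \<in> Arr C \<Longrightarrow> Cod C f = Dom C g \<Longrightarrow> FAr F (g \<cdot>\<^bsub>C\<^esub> f) = FAr F g \<cdot>\<^bsub>D\<^esub> FAr F f"
  using assms unfolding is_functor_def by auto

lemma (in category) iso_cancel_right:
  assumes "iso C i" "h \<in> Arr C" "k \<in> Arr C" "Cod C h = Cod C k" "Dom C h = Cod C i" "Dom C k = Cod C i"
    "h \<cdot> i = k \<cdot> i"
  shows "h = k"
proof -
  obtain j where j: "i \<in> Arr C" "j \<in> Arr C" "Dom C j = Cod C i" "Cod C j = Dom C i" "i \<cdot> j = Ide C (Cod C i)"
    using assms(1) isoE by metis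
  have "(h \<cdot> i) \<cdot> j = (k \<cdot> i) \<cdot> j" using assms by simp
  then show ?thesis using j assms(1-6) by simp
qed

text \<open>\<open>is_equivalence\<close> asks for no triangle identities. F is faithful by \<eta>
  and G by \<epsilon>. For fullness, conjugating \<open>G h\<close> by \<eta> gives an arrow whose
  image under F agrees with \<open>h\<close> after G, and faithfulness of G finishes.\<close>

lemma equivalence_fully_faithful:
  assumes "is_equivalence C D F"
  shows "fully_faithful C D F"
proof -
  obtain G \<eta> \<epsilon> where FG: "is_functor C D F" "is_functor D C G"
    and n: "nat_iso C C id_funct (G \<circ>\<^sub>F F) \<eta>" "nat_iso D D (F \<circ>\<^sub>F G) id_funct \<epsilon>"
    using assms unfolding is_equivalence_def by blast
  note F = is_functorD[OF FG(1)] and G = is_functorD[OF FG(2)]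
  interpret C: category C by (fact F(1))
  interpret D: category D by (fact F(2))
  have e: "\<eta> x \<in> Arr C" "Dom C (\<eta> x) = x" "Cod C (\<eta> x) = FOb G (FOb F x)" "iso C (\<eta> x)" if "x \<in> Obj C" for x
    using n that unfolding nat_iso_def nat_trans_def by auto
  have en: "\<eta> (Cod C f) \<cdot>\<^bsub>C\<^esub> f = FAr G (FAr F f) \<cdot>\<^bsub>C\<^esub> \<eta> (Dom C f)" if "f \<in> Arr C" for f
    using n that unfolding nat_iso_def nat_trans_def by auto
  have d: "\<epsilon> x \<in> Arr D" "Dom D (\<epsilon> x) = FOb F (FOb G x)" "Cod D (\<epsilon> x) = x" "iso D (\<epsilon> x)" if "x \<in> Obj D" for x
    using n that unfolding nat_iso_def nat_trans_def by auto
  have dn: "\<epsilon> (Cod D f) \<cdot>\<^bsub>D\<^esub> FAr F (FAr G f) = f \<cdot>\<^bsub>D\<^esub> \<epsilon> (Dom D f)" if "f \<in> Arr D" for f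
    using n that unfolding nat_iso_def nat_trans_def by auto
  have Ff: "f = g" if "f \<in> Arr C" "g \<in> Arr C" "Dom C f = Dom C g" "Cod C f = Cod C g" "FAr F f = FAr F g" for f g
    by (rule C.iso_cancel[of "\<eta> (Cod C f)"]) (use that e[of "Cod C f"] e[of "Cod C g"] en[of f] en[of g] in simp_all)
  have Gf: "f = g" if "f \<in> Arr D" "g \<in> Arr D" "Dom D f = Dom D g" "Cod D f = Cod D g" "FAr G f = FAr G g" for f g
    by (rule D.iso_cancel_right[of "\<epsilon> (Dom D f)"])
      (use that d[of "Dom D f"] d[of "Dom D g"] dn[of f] dn[of g] in simp_all)
  have full: "\<exists>k \<in> hom C x y. FAr F k = h" if h: "h \<in> hom D (FOb F x) (FOb F y)" "x \<in> Obj C" "y \<in> Obj C" for h x y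
  proof -
    obtain i where i: "i \<in> Arr C" "Dom C i = FOb G (FOb F y)" "Cod C i = y"
      "\<eta> y \<cdot>\<^bsub>C\<^esub> i = Ide C (FOb G (FOb F y))"
      using C.isoE[OF e(4)[OF h(3)]] e[OF h(3)] by metis
    let ?k = "i \<cdot>\<^bsub>C\<^esub> (FAr G h \<cdot>\<^bsub>C\<^esub> \<eta> x)"
    have Gh: "FAr G h \<in> Arr C" "Dom C (FAr G h) = FOb G (FOb F x)" "Cod C (FAr G h) = FOb G (FOb F y)"
      using h G by auto
    have k: "?k \<in> Arr C" "Dom C ?k = x" "Cod C ?k = y" using Gh i e h by simp_all
    have 1: "FAr G (FAr F ?k) \<cdot>\<^bsub>C\<^esub> \<eta> x = FAr G h \<cdot>\<^bsub>C\<^esub> \<eta> x"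
      using en[OF k(1)] unfolding k using Gh i e h C.reassoc[OF i(4)] by simp
    have FGk: "FAr F ?k \<in> Arr D" "Dom D (FAr F ?k) = FOb F x" "Cod D (FAr F ?k) = FOb F y"
      "FAr G (FAr F ?k) \<in> Arr C" "Dom C (FAr G (FAr F ?k)) = FOb G (FOb F x)" "Cod C (FAr G (FAr F ?k)) = FOb G (FOb F y)"
      using k F(4-6)[OF k(1)] G(4-6)[of "FAr F ?k"] by simp_all
    have "FAr G (FAr F ?k) = FAr G h"
      by (rule C.iso_cancel_right[OF e(4)[OF h(2)]]) (use 1 FGk Gh e[OF h(2)] in simp_all)
    then have "FAr F ?k = h" by (intro Gf) (use h FGk in simp_all)
    then show ?thesis using k by (intro bexI[of _ ?k]) simp_all
  qed
  show ?thesis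
    unfolding fully_faithful_def bij_betw_def inj_on_def
  proof (intro conjI ballI impI FG(1))
    fix x y f g assume "f \<in> hom C x y" "g \<in> hom C x y" "FAr F f = FAr F g"
    then show "f = g" by (intro Ff) auto
  next
    fix x y assume xy: "x \<in> Obj C" "y \<in> Obj C"
    have "FAr F f \<in> hom D (FOb F x) (FOb F y)" if "f \<in> hom C x y" for f using that F(4-6) by auto
    then show "FAr F ` hom C x y = hom D (FOb F x) (FOb F y)" using full xy by blast
  qed
qed

lemma equivalence_essentially_surjective:
  assumes "is_equivalence C D F" "y \<in> Obj D"
  shows "\<exists>x \<in> Obj C. \<exists>i \<in> hom D (FOb F x) y. iso D i"
proof -
  obtain G \<epsilon> where "is_functor D C G" "nat_iso D D (F \<circ>\<^sub>F G) id_funct \<epsilon>"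
    using assms unfolding is_equivalence_def by blast
  then show ?thesis using assms(2) is_functorD(3)[of D C G y] unfolding nat_iso_def nat_trans_def
    by (intro bexI[of _ "FOb G y"] bexI[of _ "\<epsilon> y"]) auto
qed

lemma fully_faithfulD:
  assumes "fully_faithful C D F" "x \<in> Obj C" "y \<in> Obj C"
  shows "f \<in> hom C x y \<Longrightarrow> g \<in> hom C x y \<Longrightarrow> FAr F f = FAr F g \<Longrightarrow> f = g"
    "h \<in> hom D (FOb F x) (FOb F y) \<Longrightarrow> \<exists>f \<in> hom C x y. FAr F f = h"
proof -
  have i: "inj_on (FAr F) (hom C x y)" and s: "FAr F ` hom C x y = hom D (FOb F x) (FOb F y)"
    using assms unfolding fully_faithful_def bij_betw_def by blast+
  show "f \<in> hom C x y \<Longrightarrow> g \<in> hom C x y \<Longrightarrow> FAr F f = FAr F g \<Longrightarrow> f = g"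
    by (rule inj_onD[OF i])
  show "h \<in> hom D (FOb F x) (FOb F y) \<Longrightarrow> \<exists>f \<in> hom C x y. FAr F f = h"
    unfolding s[symmetric] by blast
qed

text \<open>The quasi-inverse conjugates by chosen isomorphisms
  \<open>i y : F (g y) \<rightarrow> y\<close> with inverses \<open>j y\<close> and takes preimages
  under F. The counit is \<open>i\<close>, the unit is the preimage of \<open>j\<close>, and
  equations in C are checked after applying F.\<close>

lemma fully_faithful_essentially_surjective:
  assumes ff: "fully_faithful C D F" and es: "\<And>y. y \<in> Obj D \<Longrightarrow> \<exists>x \<in> Obj C. \<exists>i \<in> hom D (FOb F x) y. iso D i"
  shows "is_equivalence C D F"
proof -
  have FF: "is_functor C D F" using ff unfolding fully_faithful_def by blast
  note F = is_functorD[OF FF]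
  interpret C: category C by (fact F(1))
  interpret D: category D by (fact F(2))
  have "\<forall>y. \<exists>x i j. y \<in> Obj D \<longrightarrow> x \<in> Obj C \<and> i \<in> hom D (FOb F x) y \<and> j \<in> hom D y (FOb F x) \<and>
      i \<cdot>\<^bsub>D\<^esub> j = Ide D y \<and> j \<cdot>\<^bsub>D\<^esub> i = Ide D (FOb F x) \<and> iso D i"
  proof
    fix y
    show "\<exists>x i j. y \<in> Obj D \<longrightarrow> x \<in> Obj C \<and> i \<in> hom D (FOb F x) y \<and> j \<in> hom D y (FOb F x) \<and>
      i \<cdot>\<^bsub>D\<^esub> j = Ide D y \<and> j \<cdot>\<^bsub>D\<^esub> i = Ide D (FOb F x) \<and> iso D i"
    proof (cases "y \<in> Obj D")
      case True
      then obtain x i where x: "x \<in> Obj C" "i \<in> hom D (FOb F x) y" "iso D i" using es by blast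
      obtain j where "j \<in> hom D y (FOb F x)" "i \<cdot>\<^bsub>D\<^esub> j = Ide D y" "j \<cdot>\<^bsub>D\<^esub> i = Ide D (FOb F x)"
        using D.isoE[OF x(3)] x(2) by auto
      with x show ?thesis by blast
    qed blast
  qed
  then obtain g i j where "\<And>y. y \<in> Obj D \<Longrightarrow> g y \<in> Obj C \<and> i y \<in> hom D (FOb F (g y)) y \<and> j y \<in> hom D y (FOb F (g y)) \<and>
      i y \<cdot>\<^bsub>D\<^esub> j y = Ide D y \<and> j y \<cdot>\<^bsub>D\<^esub> i y = Ide D (FOb F (g y)) \<and> iso D (i y)"
    by (metis (full_types))
  then have g: "g y \<in> Obj C" "i y \<in> Arr D" "Dom D (i y) = FOb F (g y)" "Cod D (i y) = y"
      "j y \<in> Arr D" "Dom D (j y) = y" "Cod D (j y) = FOb F (g y)"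
      "i y \<cdot>\<^bsub>D\<^esub> j y = Ide D y" "j y \<cdot>\<^bsub>D\<^esub> i y = Ide D (FOb F (g y))" "iso D (i y)" if "y \<in> Obj D" for y
    using that by auto
  define pre where "pre x y h = inv_into (hom C x y) (FAr F) h" for x y h
  have pre: "pre x y h \<in> Arr C" "Dom C (pre x y h) = x" "Cod C (pre x y h) = y" "FAr F (pre x y h) = h"
    if "h \<in> Arr D" "Dom D h = FOb F x" "Cod D h = FOb F y" "x \<in> Obj C" "y \<in> Obj C" for x y h
  proof -
    have "bij_betw (FAr F) (hom C x y) (hom D (FOb F x) (FOb F y))" using ff that unfolding fully_faithful_def by blast
    then have "h \<in> FAr F ` hom C x y" using that unfolding bij_betw_def by auto
    from inv_into_into[OF this] f_inv_into_f[OF this]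
    show "pre x y h \<in> Arr C" "Dom C (pre x y h) = x" "Cod C (pre x y h) = y" "FAr F (pre x y h) = h"
      unfolding pre_def by auto
  qed
  have inj: "f = g" if "FAr F f = FAr F g" "f \<in> Arr C" "g \<in> Arr C" "Dom C f = Dom C g" "Cod C f = Cod C g" for f g
    using fully_faithfulD(1)[OF ff, of "Dom C f" "Cod C f" f g] that by simp
  define G where "G = \<lparr>FOb = g, FAr = (\<lambda>h. pre (g (Dom D h)) (g (Cod D h)) (j (Cod D h) \<cdot>\<^bsub>D\<^esub> (h \<cdot>\<^bsub>D\<^esub> i (Dom D h))))\<rparr>"
  have Gh: "FAr G h \<in> Arr C" "Dom C (FAr G h) = g (Dom D h)" "Cod C (FAr G h) = g (Cod D h)"
    "FAr F (FAr G h) = j (Cod D h) \<cdot>\<^bsub>D\<^esub> (h \<cdot>\<^bsub>D\<^esub> i (Dom D h))" if "h \<in> Arr D" for h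
    using that pre[of "j (Cod D h) \<cdot>\<^bsub>D\<^esub> (h \<cdot>\<^bsub>D\<^esub> i (Dom D h))" "g (Dom D h)" "g (Cod D h)"] g[of "Dom D h"] g[of "Cod D h"]
    unfolding G_def by simp_all
  have Gob: "FOb G y = g y" for y unfolding G_def by simp
  have GF: "is_functor D C G"
    unfolding is_functor_def
  proof (intro conjI ballI impI)
    fix y assume y: "y \<in> Obj D"
    then show "FOb G y \<in> Obj C" using g Gob by simp
    show "FAr G (Ide D y) = Ide C (FOb G y)"
      by (rule inj) (use y g[OF y] Gh[of "Ide D y"] Gob F(7) in simp_all)
  next
    fix h k assume h: "h \<in> Arr D" and k: "k \<in> Arr D" "Cod D h = Dom D k"
    have g1: "g (Dom D k) \<in> Obj C" "i (Dom D k) \<in> Arr D" "j (Dom D k) \<in> Arr D" "Dom D (i (Dom D k)) = FOb F (g (Dom D k))"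
      "Cod D (i (Dom D k)) = Dom D k" "Dom D (j (Dom D k)) = Dom D k" "Cod D (j (Dom D k)) = FOb F (g (Dom D k))"
      "i (Dom D k) \<cdot>\<^bsub>D\<^esub> j (Dom D k) = Ide D (Dom D k)" using g[of "Dom D k"] k by simp_all
    show "FAr G (k \<cdot>\<^bsub>D\<^esub> h) = FAr G k \<cdot>\<^bsub>C\<^esub> FAr G h"
      by (rule inj) (use Gh[OF h] Gh[OF k(1)] Gh[of "k \<cdot>\<^bsub>D\<^esub> h"] h k F(8)[of "FAr G h" "FAr G k"]
        g[of "Dom D h"] g[of "Cod D k"] g1 D.reassoc[OF g1(8)] in simp_all)
  next
    fix h assume "h \<in> Arr D"
    then show "FAr G h \<in> hom C (FOb G (Dom D h)) (FOb G (Cod D h))" using Gh Gob by simp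
  qed (fact F)+
  let ?\<eta> = "\<lambda>x. pre x (g (FOb F x)) (j (FOb F x))"
  have eta: "?\<eta> x \<in> Arr C" "Dom C (?\<eta> x) = x" "Cod C (?\<eta> x) = g (FOb F x)" "FAr F (?\<eta> x) = j (FOb F x)" if "x \<in> Obj C" for x
    using pre[of "j (FOb F x)" x "g (FOb F x)"] g[of "FOb F x"] F(3) that by simp_all
  have eta_iso: "iso C (?\<eta> x)" if x: "x \<in> Obj C" for x
  proof -
    let ?k = "pre (g (FOb F x)) x (i (FOb F x))"
    have k: "?k \<in> Arr C" "Dom C ?k = g (FOb F x)" "Cod C ?k = x" "FAr F ?k = i (FOb F x)"
      using pre[of "i (FOb F x)" "g (FOb F x)" x] g[of "FOb F x"] F(3) that by simp_all
    show ?thesis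
    proof (rule C.isoI[of _ ?k])
      show "?k \<cdot>\<^bsub>C\<^esub> ?\<eta> x = Ide C (Dom C (?\<eta> x))"
        by (rule inj) (use k eta[OF x] g[of "FOb F x"] x F(3,7) F(8)[of "?\<eta> x" ?k] in simp_all)
      show "?\<eta> x \<cdot>\<^bsub>C\<^esub> ?k = Ide C (Cod C (?\<eta> x))"
        by (rule inj) (use k eta[OF x] g[of "FOb F x"] x F(3,7) F(8)[of ?k "?\<eta> x"] in simp_all)
    qed (use k eta[OF x] in simp_all)
  qed
  have idC: "is_functor C C id_funct" and idD: "is_functor D D id_funct"
    unfolding is_functor_def using F(1,2) by auto
  have comp: "is_functor C C (G \<circ>\<^sub>F F)" "is_functor D D (F \<circ>\<^sub>F G)"
    unfolding is_functor_def[of C C] is_functor_def[of D D]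
    using F(1-2) F(3-8) is_functorD(3-8)[OF GF] by simp_all
  have "nat_iso C C id_funct (G \<circ>\<^sub>F F) ?\<eta>"
    unfolding nat_iso_def nat_trans_def
  proof (intro conjI ballI)
    fix f assume f: "f \<in> Arr C"
    let ?x = "FOb F (Dom C f)" and ?y = "FOb F (Cod C f)"
    have Ff: "FAr F f \<in> Arr D" "Dom D (FAr F f) = ?x" "Cod D (FAr F f) = ?y" using F f by auto
    have ob: "?x \<in> Obj D" "?y \<in> Obj D" using F(3) f by auto
    note gx = g[OF ob(1)] and gy = g[OF ob(2)]
    have "FAr F (?\<eta> (Cod C f) \<cdot>\<^bsub>C\<^esub> f) = j ?y \<cdot>\<^bsub>D\<^esub> FAr F f"
      using F(8)[of f "?\<eta> (Cod C f)"] eta[of "Cod C f"] f by simp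
    moreover have "FAr F (FAr G (FAr F f) \<cdot>\<^bsub>C\<^esub> ?\<eta> (Dom C f)) = j ?y \<cdot>\<^bsub>D\<^esub> FAr F f"
      using F(8)[of "?\<eta> (Dom C f)" "FAr G (FAr F f)"] eta[of "Dom C f"] f Gh[OF Ff(1)] Ff gx gy
      by simp
    ultimately have "?\<eta> (Cod C f) \<cdot>\<^bsub>C\<^esub> f = FAr G (FAr F f) \<cdot>\<^bsub>C\<^esub> ?\<eta> (Dom C f)"
      by (intro inj) (use eta[of "Cod C f"] eta[of "Dom C f"] f Gh[OF Ff(1)] Ff in simp_all)
    then show "?\<eta> (Cod C f) \<cdot>\<^bsub>C\<^esub> FAr id_funct f = FAr (G \<circ>\<^sub>F F) f \<cdot>\<^bsub>C\<^esub> ?\<eta> (Dom C f)" by simp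
  qed (use eta eta_iso Gob idC comp in simp_all)
  moreover have "nat_iso D D (F \<circ>\<^sub>F G) id_funct i"
    unfolding nat_iso_def nat_trans_def
  proof (intro conjI ballI)
    fix h assume h: "h \<in> Arr D"
    have ob: "Dom D h \<in> Obj D" "Cod D h \<in> Obj D" using h by auto
    show "i (Cod D h) \<cdot>\<^bsub>D\<^esub> FAr (F \<circ>\<^sub>F G) h = FAr id_funct h \<cdot>\<^bsub>D\<^esub> i (Dom D h)"
      using h Gh[OF h] g[OF ob(1)] g[OF ob(2)] D.reassoc[OF g(8)[OF ob(2)]] by simp
  qed (use g Gob idD comp in simp_all)
  ultimately show ?thesis unfolding is_equivalence_def using FF GF by blast
qed

section \<open>The comparison functor\<close>

context descent
begin

abbreviation "XB \<equiv> slice X (Cod X p)"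
abbreviation "CF \<equiv> comparison (descent_ps X p)"
abbreviation "K \<equiv> comparison_obj (descent_ps X p)"
abbreviation "Ca f \<equiv> descent_family.fam_ob X f leg"
abbreviation "Ct f \<equiv> descent_family.fam_tr X p f leg (\<lambda>n e z. z)"

text \<open>With \<open>w\<close> the identity of the base, being admissible already means lying
  over \<open>leg n \<cdot> e\<close>, so the trivial action is legitimate.\<close>

lemma family_leg:
  assumes "f \<in> Arr X" "Cod X f = Cod X p"
  shows "descent_family X p (Ide X (Cod X p)) f leg (\<lambda>n e z. z)"
proof
  fix n e z assume ok: "ok_elt (Ide X (Cod X p)) f n e z"
  then show "z \<in> Arr X \<and> Dom X z = Dom X e \<and> Cod X z = Dom X f \<and> f \<cdot> z = leg n \<cdot> e"
    using assms unfolding ok_elt_def by auto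
qed (use assms in simp_all)

text \<open>Because \<open>leg m \<cdot> dg \<phi> = leg n\<close>, the structure cell
  \<open>PMult\<close> at \<phi> : m \<rightarrow> n and 0 \<rightarrow> m is literally the lift
  \<open>fam_tr\<close> for the trivial action.\<close>

lemma K_eq:
  assumes "f \<in> Arr X" "Cod X f = Cod X p"
  shows "K f = mk_psnat (Ca f) (Ct f)"
proof -
  interpret F: descent_family X p "Ide X (Cod X p)" f leg "\<lambda>n e z. z" by (rule family_leg[OF assms])
  have "NAr (K f) \<phi> = NAr (mk_psnat (Ca f) (Ct f)) \<phi>" for \<phi>
    by (cases "\<phi> \<in> Arr Delta")
      (auto simp: comparison_obj_def mk_psnat_def F.fam_tr_def Let_def F.fam_ob_def simp del: F.fam_fold)
  moreover have "NOb (K f) n = NOb (mk_psnat (Ca f) (Ct f)) n" for n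
    by (cases "n = 0") (simp_all add: comparison_obj_def mk_psnat_def F.fam_ob_def del: F.fam_fold)
  ultimately show ?thesis by (intro psnat.equality) (auto simp: fun_eq_iff)
qed

lemma psn_K:
  assumes "f \<in> Arr X" "Cod X f = Cod X p"
  shows "psn (K f)"
proof -
  interpret F: descent_family X p "Ide X (Cod X p)" f leg "\<lambda>n e z. z" by (rule family_leg[OF assms])
  show ?thesis unfolding K_eq[OF assms] by (rule psn_mk_psnat[OF F.ddata_fam])
qed

text \<open>Needed because \<open>mk_psnat\<close> restricts its data: \<open>ob\<close> and
  \<open>tr\<close> agree with the given families only on \<open>Delta\<close>.\<close>

lemma push_cong:
  assumes "ddata a t" "ddata b s" "\<And>n. n \<noteq> 0 \<Longrightarrow> a n = b n" "\<And>\<phi>. \<phi> \<in> Arr Delta \<Longrightarrow> t \<phi> = s \<phi>"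
  shows "element a \<phi> e x \<longleftrightarrow> element b \<phi> e x" "element a \<phi> e x \<Longrightarrow> transport a t \<phi> e x = transport b s \<phi> e x"
proof -
  interpret A: descent_data X p a t by (rule descent_dataI) fact
  interpret B: descent_data X p b s by (rule descent_dataI) fact
  show "element a \<phi> e x \<longleftrightarrow> element b \<phi> e x"
    unfolding A.elt_def B.elt_def using assms(3) by auto
  show "element a \<phi> e x \<Longrightarrow> transport a t \<phi> e x = transport b s \<phi> e x"
    unfolding A.push_def B.push_def A.elt_def using assms(3)[of "src \<phi>"] assms(4)[of \<phi>] by simp
qed

lemma ob_K:
  assumes "f \<in> Arr X" "Cod X f = Cod X p" "n \<noteq> 0"
  shows "ob (K f) n = pb1 X (leg n) f"
proof -
  interpret F: descent_family X p "Ide X (Cod X p)" f leg "\<lambda>n e z. z" by (rule family_leg[OF assms(1,2)])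
  show ?thesis unfolding K_eq[OF assms(1,2)] using assms(3) by (simp add: F.fam_ob_def del: F.fam_fold)
qed

lemma elt_K:
  assumes "f \<in> Arr X" "Cod X f = Cod X p"
  shows "element (ob (K f)) \<phi> e x \<longleftrightarrow> \<phi> \<in> Arr Delta_dot \<and> src \<phi> \<noteq> 0 \<and> tgt \<phi> \<noteq> 0 \<and>
     e \<in> Arr X \<and> Cod X e = pw (tgt \<phi>) \<and> x \<in> Arr X \<and> Dom X x = Dom X e \<and>
     Cod X x = Dom X (pb1 X (leg (src \<phi>)) f) \<and> pb1 X (leg (src \<phi>)) f \<cdot> x = dg \<phi> \<cdot> e"
  unfolding elt_def'[OF psn_ddata[OF psn_K[OF assms]]] using ob_K[OF assms] by auto

text \<open>The action being trivial, transport in the image of \<open>f\<close> leaves the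
  coordinate in the domain of \<open>f\<close> unchanged.\<close>

lemma push_K:
  assumes f: "f \<in> Arr X" "Cod X f = Cod X p" and e: "element (ob (K f)) \<phi> e x"
  defines "y \<equiv> transport (ob (K f)) (tr (K f)) \<phi> e x"
  shows "y \<in> Arr X" "Dom X y = Dom X e" "Cod X y = Dom X (pb1 X (leg (tgt \<phi>)) f)"
    "pb1 X (leg (tgt \<phi>)) f \<cdot> y = e" "pb2 X (leg (tgt \<phi>)) f \<cdot> y = pb2 X (leg (src \<phi>)) f \<cdot> x"
proof -
  interpret F: descent_family X p "Ide X (Cod X p)" f leg "\<lambda>n e z. z" by (rule family_leg[OF f])
  have eq: "n \<noteq> 0 \<Longrightarrow> ob (K f) n = Ca f n" "\<phi> \<in> Arr Delta \<Longrightarrow> tr (K f) \<phi> = Ct f \<phi>" for n \<phi>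
    unfolding K_eq[OF f] by simp_all
  note dd = psn_ddata[OF psn_K[OF f]]
  interpret D: descent_data X p "Ca f" "Ct f" by (rule descent_dataI[OF F.ddata_fam])
  have e': "element (Ca f) \<phi> e x" and y: "y = transport (Ca f) (Ct f) \<phi> e x"
    using push_cong[OF dd F.ddata_fam, OF eq] e unfolding y_def by auto
  have "tgt \<phi> \<noteq> 0" "src \<phi> \<noteq> 0" using e' unfolding D.elt_def by auto
  then show "y \<in> Arr X" "Dom X y = Dom X e" "Cod X y = Dom X (pb1 X (leg (tgt \<phi>)) f)"
    "pb1 X (leg (tgt \<phi>)) f \<cdot> y = e" "pb2 X (leg (tgt \<phi>)) f \<cdot> y = pb2 X (leg (src \<phi>)) f \<cdot> x"
    using D.push_simps[OF e'] F.push_fam[OF e'] unfolding y by simp_all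
qed

text \<open>Morphisms from a descent datum \<open>\<alpha>\<close> to the image of \<open>f\<close> correspond to compatible families of
  arrows into the domain of \<open>f\<close>.\<close>

definition cone :: "('a, 'a \<times> 'a \<times> 'a) desc_obj \<Rightarrow> 'a \<Rightarrow> (nat \<Rightarrow> 'a) \<Rightarrow> bool" where
  "cone \<alpha> f v \<longleftrightarrow>
    (\<forall>n. n \<noteq> 0 \<longrightarrow> v n \<in> Arr X \<and> Dom X (v n) = Dom X (ob \<alpha> n) \<and> Cod X (v n) = Dom X f \<and>
       f \<cdot> v n = leg n \<cdot> ob \<alpha> n) \<and>
    (\<forall>\<phi> e x. element (ob \<alpha>) \<phi> e x \<longrightarrow> v (tgt \<phi>) \<cdot> transport (ob \<alpha>) (tr \<alpha>) \<phi> e x = v (src \<phi>) \<cdot> x)"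

lemma coneD:
  assumes "cone \<alpha> f v" "n \<noteq> 0"
  shows "v n \<in> Arr X" "Dom X (v n) = Dom X (ob \<alpha> n)" "Cod X (v n) = Dom X f" "f \<cdot> v n = leg n \<cdot> ob \<alpha> n"
  using assms unfolding cone_def by auto

lemma cone_push:
  "cone \<alpha> f v \<Longrightarrow> element (ob \<alpha>) \<phi> e x \<Longrightarrow> v (tgt \<phi>) \<cdot> transport (ob \<alpha>) (tr \<alpha>) \<phi> e x = v (src \<phi>) \<cdot> x"
  unfolding cone_def by blast

text \<open>An element of \<open>ob (K f) n\<close> is a pair, and by \<open>push_K\<close>
  transport affects only its first coordinate. So compatibility with transport is the cone equation
  for the second.\<close>

lemma cone_dmor:
  assumes \<alpha>: "psn \<alpha>" and f: "f \<in> Arr X" "Cod X f = Cod X p" and v: "cone \<alpha> f v"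
  shows "dmor (ob \<alpha>) (tr \<alpha>) (ob (K f)) (tr (K f)) (\<lambda>n. pb_lift X (leg n) f (ob \<alpha> n) (v n))"
    (is "dmor _ _ _ _ ?g")
proof -
  note dd = psn_ddata[OF \<alpha>] and dK = psn_ddata[OF psn_K[OF f]]
  interpret A: descent_data X p "ob \<alpha>" "tr \<alpha>" by (rule descent_dataI[OF dd])
  interpret B: descent_data X p "ob (K f)" "tr (K f)" by (rule descent_dataI[OF dK])
  note v' = coneD[OF v]
  have g: "?g n \<in> Arr X" "Dom X (?g n) = Dom X (ob \<alpha> n)" "Cod X (?g n) = Dom X (pb1 X (leg n) f)"
    "pb1 X (leg n) f \<cdot> ?g n = ob \<alpha> n" "pb2 X (leg n) f \<cdot> ?g n = v n" if "n \<noteq> 0" for n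
    using v'[OF that] A.a_simps[OF that] f by simp_all
  show ?thesis
    unfolding dmor_iff_push[OF dd dK]
  proof (intro conjI allI impI)
    fix n :: nat assume "n \<noteq> 0"
    then show "?g n \<in> hom X (Dom X (ob \<alpha> n)) (Dom X (ob (K f) n))" "ob (K f) n \<cdot> ?g n = ob \<alpha> n"
      using g ob_K[OF f] by simp_all
  next
    fix \<phi> e x assume e: "element (ob \<alpha>) \<phi> e x"
    note e' = e[unfolded A.elt_def]
    have st: "src \<phi> \<noteq> 0" "tgt \<phi> \<noteq> 0" using e' by auto
    note gs = g[OF st(1)] and gt = g[OF st(2)]
    have e2: "element (ob (K f)) \<phi> e (?g (src \<phi>) \<cdot> x)"
      unfolding elt_K[OF f] using e' gs(1-3) reassoc[OF gs(4)] f by simp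
    note P = A.push_simps[OF e] and Q = push_K[OF f e2]
    show "?g (tgt \<phi>) \<cdot> transport (ob \<alpha>) (tr \<alpha>) \<phi> e x = transport (ob (K f)) (tr (K f)) \<phi> e (?g (src \<phi>) \<cdot> x)"
    proof (rule pb_ext[of "leg (tgt \<phi>)" f])
      show "pb1 X (leg (tgt \<phi>)) f \<cdot> ?g (tgt \<phi>) \<cdot> transport (ob \<alpha>) (tr \<alpha>) \<phi> e x =
        pb1 X (leg (tgt \<phi>)) f \<cdot> transport (ob (K f)) (tr (K f)) \<phi> e (?g (src \<phi>) \<cdot> x)"
        unfolding Q(4) using reassoc[OF gt(4)] gt(1-3) P f by simp
      have "pb2 X (leg (tgt \<phi>)) f \<cdot> ?g (tgt \<phi>) \<cdot> transport (ob \<alpha>) (tr \<alpha>) \<phi> e x = v (tgt \<phi>) \<cdot> transport (ob \<alpha>) (tr \<alpha>) \<phi> e x"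
        using reassoc[OF gt(5)] gt(1-3) P f by simp
      also have "\<dots> = v (src \<phi>) \<cdot> x" by (rule cone_push[OF v e])
      also have "\<dots> = pb2 X (leg (src \<phi>)) f \<cdot> ?g (src \<phi>) \<cdot> x"
        using reassoc[OF gs(5)] gs(1-3) e' f by simp
      finally show "pb2 X (leg (tgt \<phi>)) f \<cdot> ?g (tgt \<phi>) \<cdot> transport (ob \<alpha>) (tr \<alpha>) \<phi> e x =
         pb2 X (leg (tgt \<phi>)) f \<cdot> transport (ob (K f)) (tr (K f)) \<phi> e (?g (src \<phi>) \<cdot> x)"
        unfolding Q(5) .
    qed (use f gt(1-3) P Q(1-3) in simp_all)
  qed
qed

lemma dmor_cone:
  assumes \<alpha>: "psn \<alpha>" and f: "f \<in> Arr X" "Cod X f = Cod X p"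
    and g: "dmor (ob \<alpha>) (tr \<alpha>) (ob (K f)) (tr (K f)) g"
  shows "cone \<alpha> f (\<lambda>n. pb2 X (leg n) f \<cdot> g n)"
    "\<And>n. n \<noteq> 0 \<Longrightarrow> g n = pb_lift X (leg n) f (ob \<alpha> n) (pb2 X (leg n) f \<cdot> g n)"
proof -
  note dd = psn_ddata[OF \<alpha>] and dK = psn_ddata[OF psn_K[OF f]]
  interpret A: descent_data X p "ob \<alpha>" "tr \<alpha>" by (rule descent_dataI[OF dd])
  note g' = g[unfolded dmor_iff_push[OF dd dK]]
  have g1: "g n \<in> Arr X" "Dom X (g n) = Dom X (ob \<alpha> n)" "Cod X (g n) = Dom X (pb1 X (leg n) f)"
    "pb1 X (leg n) f \<cdot> g n = ob \<alpha> n" if "n \<noteq> 0" for n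
    using g'[THEN conjunct1, rule_format, OF that] unfolding ob_K[OF f that] by simp_all
  have g2: "g (tgt \<phi>) \<cdot> transport (ob \<alpha>) (tr \<alpha>) \<phi> e x = transport (ob (K f)) (tr (K f)) \<phi> e (g (src \<phi>) \<cdot> x)"
    if "element (ob \<alpha>) \<phi> e x" for \<phi> e x using g' that by blast
  show "cone \<alpha> f (\<lambda>n. pb2 X (leg n) f \<cdot> g n)"
    unfolding cone_def
  proof (intro conjI allI impI)
    fix n :: nat assume "n \<noteq> 0"
    note h = g1[OF this]
    show "pb2 X (leg n) f \<cdot> g n \<in> Arr X" "Dom X (pb2 X (leg n) f \<cdot> g n) = Dom X (ob \<alpha> n)"
      "Cod X (pb2 X (leg n) f \<cdot> g n) = Dom X f" "f \<cdot> pb2 X (leg n) f \<cdot> g n = leg n \<cdot> ob \<alpha> n"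
      using h f by simp_all
  next
    fix \<phi> e x assume e: "element (ob \<alpha>) \<phi> e x"
    note e' = e[unfolded A.elt_def]
    have st: "src \<phi> \<noteq> 0" "tgt \<phi> \<noteq> 0" using e' by auto
    note gs = g1[OF st(1)] and gt = g1[OF st(2)]
    have e2: "element (ob (K f)) \<phi> e (g (src \<phi>) \<cdot> x)"
      unfolding elt_K[OF f] using e' gs(1-3) reassoc[OF gs(4)] f by simp
    show "(pb2 X (leg (tgt \<phi>)) f \<cdot> g (tgt \<phi>)) \<cdot> transport (ob \<alpha>) (tr \<alpha>) \<phi> e x = (pb2 X (leg (src \<phi>)) f \<cdot> g (src \<phi>)) \<cdot> x"
      using push_K(5)[OF f e2] g2[OF e] A.push_simps[OF e] gs gt e' f by simp
  qed
  fix n :: nat assume n: "n \<noteq> 0"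
  note h = g1[OF n]
  have "f \<cdot> pb2 X (leg n) f \<cdot> g n = leg n \<cdot> ob \<alpha> n" using h f by simp
  then show "g n = pb_lift X (leg n) f (ob \<alpha> n) (pb2 X (leg n) f \<cdot> g n)"
    by (intro pb_ext[of "leg n" f "g n"]) (use h f A.a_simps[OF n] in simp_all)
qed

text \<open>Transport along the point 0 : 1 \<rightarrow> n is bijective, so the identity of the
  domain of \<open>ob \<alpha> n\<close> is the transport of an element over 1. The cone equation
  then expresses the component at n through the one at 1.\<close>

lemma cone_unique:
  assumes \<alpha>: "psn \<alpha>" and v: "cone \<alpha> f v" and w: "cone \<alpha> f w" and 1: "v 1 = w 1" and n: "n \<noteq> 0"
  shows "v n = w n"
proof -
  interpret A: descent_data X p "ob \<alpha>" "tr \<alpha>" by (rule descent_dataI[OF psn_ddata[OF \<alpha>]])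
  let ?\<phi> = "map_of_list [0] n"
  obtain x where x: "element (ob \<alpha>) ?\<phi> (ob \<alpha> n) x" "transport (ob \<alpha>) (tr \<alpha>) ?\<phi> (ob \<alpha> n) x = Ide X (Dom X (ob \<alpha> n))"
    using A.push_surj[of ?\<phi> "Ide X (Dom X (ob \<alpha> n))" "ob \<alpha> n"] n A.a_simps[OF n] by auto
  show ?thesis
    using cone_push[OF v x(1)] cone_push[OF w x(1)] coneD[OF v n] coneD[OF w n] 1 x(2) by simp
qed

lemma comparison_FAr:
  assumes "(f, h, g) \<in> Arr XB"
  shows "FAr CF (f, h, g) =
    (K f, mk_mod (ob (K f)) (ob (K g)) (\<lambda>n. pb_lift X (leg n) g (ob (K f) n) (h \<cdot> pb2 X (leg n) f)), K g)"
  using assms ob_K[of f] ob_K[of g] by (auto simp: comparison_def mk_mod_def restrict_def fun_eq_iff)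

lemma comparison_FOb: "FOb CF = K"
  by (simp add: comparison_def)

lemma cone_K:
  assumes "(f, h, g) \<in> Arr XB"
  shows "cone (K f) g (\<lambda>n. h \<cdot> pb2 X (leg n) f)"
proof -
  have f: "f \<in> Arr X" "Cod X f = Cod X p" and g: "g \<in> Arr X" "Cod X g = Cod X p"
    and h: "h \<in> Arr X" "Dom X h = Dom X f" "Cod X h = Dom X g" "g \<cdot> h = f" using assms by auto
  show ?thesis unfolding cone_def
  proof (intro conjI allI impI)
    fix n :: nat assume "n \<noteq> 0"
    then show "h \<cdot> pb2 X (leg n) f \<in> Arr X" "Dom X (h \<cdot> pb2 X (leg n) f) = Dom X (ob (K f) n)"
      "Cod X (h \<cdot> pb2 X (leg n) f) = Dom X g" "g \<cdot> h \<cdot> pb2 X (leg n) f = leg n \<cdot> ob (K f) n"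
      using ob_K[OF f] f g h reassoc[OF h(4)] by simp_all
  next
    fix \<phi> e x assume e: "element (ob (K f)) \<phi> e x"
    show "(h \<cdot> pb2 X (leg (tgt \<phi>)) f) \<cdot> transport (ob (K f)) (tr (K f)) \<phi> e x = (h \<cdot> pb2 X (leg (src \<phi>)) f) \<cdot> x"
      using push_K[OF f e] e[unfolded elt_K[OF f]] f h by simp
  qed
qed

lemma is_functor_comparison:
  "is_functor XB DC CF"
  unfolding is_functor_def
proof (intro conjI ballI impI)
  fix f assume "f \<in> Obj XB"
  then have f: "f \<in> Arr X" "Cod X f = Cod X p" by auto
  show "FOb CF f \<in> Obj DC"
    using psn_K[OF f] by (simp add: comparison_FOb)
  have "pb_lift X (leg n) f (pb1 X (leg n) f) (pb2 X (leg n) f) = Ide X (Dom X (pb1 X (leg n) f))" for n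
    by (rule pb_ext[of "leg n" f]) (use f in simp_all)
  then show "FAr CF (Ide XB f) =
      Ide DC (FOb CF f)"
    using f comparison_FAr[of f "Ide X (Dom X f)" f] ob_K[OF f] by (simp add: comparison_FOb mk_mod_eq_iff)
next
  fix a assume a: "a \<in> Arr XB"
  obtain f h g where fhg: "a = (f, h, g)" by (cases a)
  have fg: "f \<in> Arr X" "Cod X f = Cod X p" "g \<in> Arr X" "Cod X g = Cod X p" using a fhg by auto
  show "FAr CF a \<in> hom DC (FOb CF (Dom XB a))
        (FOb CF (Cod XB a))"
    using a cone_dmor[OF psn_K fg(3,4) cone_K, of f h] fg unfolding fhg comparison_FAr[OF a[unfolded fhg]]
    by (simp add: comparison_FOb psn_K md_mk_mod)
next
  fix a b assume a: "a \<in> Arr XB" and b: "b \<in> Arr XB"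
    and ab: "Cod XB a = Dom XB b"
  obtain f h g where fhg: "a = (f, h, g)" by (cases a)
  obtain g' k q where gkq': "b = (g', k, q)" by (cases b)
  have gkq: "b = (g, k, q)" using ab unfolding fhg gkq' by simp
  have H: "f \<in> Arr X" "Cod X f = Cod X p" "g \<in> Arr X" "Cod X g = Cod X p" "q \<in> Arr X" "Cod X q = Cod X p"
    "h \<in> Arr X" "Dom X h = Dom X f" "Cod X h = Dom X g" "k \<in> Arr X" "Dom X k = Dom X g" "Cod X k = Dom X q"
    "g \<cdot> h = f" "q \<cdot> k = g"
    using a b unfolding fhg gkq by auto
  have hk: "q \<cdot> (k \<cdot> h) = f" using reassoc[OF H(14)] H by simp
  have c: "(f, k \<cdot> h, q) \<in> Arr XB" using H hk by simp
  have "pb_lift X (leg n) q (pb1 X (leg n) f) ((k \<cdot> h) \<cdot> pb2 X (leg n) f) =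
     pb_lift X (leg n) q (pb1 X (leg n) g) (k \<cdot> pb2 X (leg n) g) \<cdot> pb_lift X (leg n) g (pb1 X (leg n) f) (h \<cdot> pb2 X (leg n) f)" for n
    by (rule pb_ext[of "leg n" q]) (use H hk reassoc[OF hk] reassoc[OF H(14)] reassoc[OF H(13)] in simp_all)
  then show "FAr CF (b \<cdot>\<^bsub>XB\<^esub> a) =
      FAr CF b \<cdot>\<^bsub>DC\<^esub> FAr CF a"
    unfolding fhg gkq slice_simps comparison_FAr[OF a[unfolded fhg]] comparison_FAr[OF b[unfolded gkq]] comparison_FAr[OF c] DC_Cmp
    using ob_K[OF H(1,2)] ob_K[OF H(3,4)] by (simp add: mk_mod_eq_iff)
qed (fact category_slice category_DC)+

end

section \<open>An elementary characterization of effective descent\<close>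

text \<open>Compatibility with the kernel pair of \<open>a\<close>, phrased on all pairs so that no
  kernel pair has to be chosen; \<open>compat_iff\<close> specializes it to any given one.\<close>

definition compat :: "('o, 'a) cat \<Rightarrow> 'a \<Rightarrow> 'a \<Rightarrow> bool" where
  "compat X a v \<longleftrightarrow> (\<forall>s \<in> Arr X. \<forall>t \<in> Arr X. Dom X s = Dom X t \<longrightarrow> Cod X s = Dom X a \<longrightarrow> Cod X t = Dom X a \<longrightarrow>
     a \<cdot>\<^bsub>X\<^esub> s = a \<cdot>\<^bsub>X\<^esub> t \<longrightarrow> v \<cdot>\<^bsub>X\<^esub> s = v \<cdot>\<^bsub>X\<^esub> t)"

text \<open>Here \<open>a\<close> is the pullback of \<open>p\<close> along \<open>f\<close>, and
  \<open>g\<close> ranges over test objects in the slice over the codomain of \<open>p\<close>.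
  Arbitrary squares are allowed so that images of squares under functors can be fed to it.\<close>

definition coequalizing :: "('o, 'a) cat \<Rightarrow> 'a \<Rightarrow> bool" where
  "coequalizing X p \<longleftrightarrow> (\<forall>f e a g v. is_pullback X p f e a \<longrightarrow> g \<in> Arr X \<longrightarrow> Cod X g = Cod X p \<longrightarrow>
     v \<in> hom X (Dom X a) (Dom X g) \<longrightarrow> g \<cdot>\<^bsub>X\<^esub> v = f \<cdot>\<^bsub>X\<^esub> a \<longrightarrow> compat X a v \<longrightarrow>
     (\<exists>!w. w \<in> hom X (Dom X f) (Dom X g) \<and> g \<cdot>\<^bsub>X\<^esub> w = f \<and> w \<cdot>\<^bsub>X\<^esub> a = v))"

text \<open>Algebras \<open>\<xi> : C \<times>\<^sub>B E \<rightarrow> C\<close> of the monad of \<open>p\<close>, on \<open>c : C \<rightarrow> E\<close>, with \<open>u\<close> and \<open>v\<close> the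
  projections of \<open>C \<times>\<^sub>B E\<close>: on generalized elements \<open>c (\<xi>(x, e)) = e\<close>, \<open>\<xi>(x, c x) = x\<close> and
  \<open>\<xi>(\<xi>(x, e), e') = \<xi>(x, e')\<close>.\<close>

definition action :: "('o, 'a) cat \<Rightarrow> 'a \<Rightarrow> 'a \<Rightarrow> 'a \<Rightarrow> 'a \<Rightarrow> 'a \<Rightarrow> bool" where
  "action X p c u v \<xi> \<longleftrightarrow> c \<in> Arr X \<and> Cod X c = Dom X p \<and> is_pullback X (p \<cdot>\<^bsub>X\<^esub> c) p u v \<and>
     \<xi> \<in> hom X (Dom X u) (Dom X c) \<and> c \<cdot>\<^bsub>X\<^esub> \<xi> = v \<and>
     (\<forall>h \<in> Arr X. Cod X h = Dom X u \<longrightarrow> v \<cdot>\<^bsub>X\<^esub> h = c \<cdot>\<^bsub>X\<^esub> (u \<cdot>\<^bsub>X\<^esub> h) \<longrightarrow> \<xi> \<cdot>\<^bsub>X\<^esub> h = u \<cdot>\<^bsub>X\<^esub> h) \<and>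
     (\<forall>h \<in> Arr X. \<forall>h' \<in> Arr X. \<forall>h'' \<in> Arr X. Dom X h' = Dom X h \<longrightarrow> Dom X h'' = Dom X h \<longrightarrow>
        Cod X h = Dom X u \<longrightarrow> Cod X h' = Dom X u \<longrightarrow> Cod X h'' = Dom X u \<longrightarrow>
        u \<cdot>\<^bsub>X\<^esub> h' = \<xi> \<cdot>\<^bsub>X\<^esub> h \<longrightarrow> u \<cdot>\<^bsub>X\<^esub> h'' = u \<cdot>\<^bsub>X\<^esub> h \<longrightarrow> v \<cdot>\<^bsub>X\<^esub> h' = v \<cdot>\<^bsub>X\<^esub> h'' \<longrightarrow>
        \<xi> \<cdot>\<^bsub>X\<^esub> h' = \<xi> \<cdot>\<^bsub>X\<^esub> h'')"

definition actions_effective :: "('o, 'a) cat \<Rightarrow> 'a \<Rightarrow> bool" where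
  "actions_effective X p \<longleftrightarrow> (\<forall>c u v \<xi>. action X p c u v \<xi> \<longrightarrow>
     (\<exists>f q. is_pullback X p f c q \<and> q \<cdot>\<^bsub>X\<^esub> \<xi> = q \<cdot>\<^bsub>X\<^esub> u))"

lemma actionD:
  assumes "action X p c u v \<xi>"
  shows "c \<in> Arr X" "Cod X c = Dom X p" "is_pullback X (p \<cdot>\<^bsub>X\<^esub> c) p u v"
    "\<xi> \<in> Arr X" "Dom X \<xi> = Dom X u" "Cod X \<xi> = Dom X c" "c \<cdot>\<^bsub>X\<^esub> \<xi> = v"
  using assms unfolding action_def by auto

lemma action_unit:
  assumes "action X p c u v \<xi>" "h \<in> Arr X" "Cod X h = Dom X u" "v \<cdot>\<^bsub>X\<^esub> h = c \<cdot>\<^bsub>X\<^esub> (u \<cdot>\<^bsub>X\<^esub> h)"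
  shows "\<xi> \<cdot>\<^bsub>X\<^esub> h = u \<cdot>\<^bsub>X\<^esub> h"
  using assms unfolding action_def by blast

lemma action_assoc:
  assumes "action X p c u v \<xi>" "h \<in> Arr X" "h' \<in> Arr X" "h'' \<in> Arr X" "Dom X h' = Dom X h" "Dom X h'' = Dom X h"
    "Cod X h = Dom X u" "Cod X h' = Dom X u" "Cod X h'' = Dom X u"
    "u \<cdot>\<^bsub>X\<^esub> h' = \<xi> \<cdot>\<^bsub>X\<^esub> h" "u \<cdot>\<^bsub>X\<^esub> h'' = u \<cdot>\<^bsub>X\<^esub> h" "v \<cdot>\<^bsub>X\<^esub> h' = v \<cdot>\<^bsub>X\<^esub> h''"
  shows "\<xi> \<cdot>\<^bsub>X\<^esub> h' = \<xi> \<cdot>\<^bsub>X\<^esub> h''"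
  using assms unfolding action_def by blast

lemma coequalizingD:
  assumes "coequalizing X p" "is_pullback X p f e a" "g \<in> Arr X" "Cod X g = Cod X p"
    "v \<in> Arr X" "Dom X v = Dom X a" "Cod X v = Dom X g" "g \<cdot>\<^bsub>X\<^esub> v = f \<cdot>\<^bsub>X\<^esub> a" "compat X a v"
  shows "\<exists>w. w \<in> Arr X \<and> Dom X w = Dom X f \<and> Cod X w = Dom X g \<and> g \<cdot>\<^bsub>X\<^esub> w = f \<and> w \<cdot>\<^bsub>X\<^esub> a = v"
    "\<And>w w'. w \<in> Arr X \<Longrightarrow> w' \<in> Arr X \<Longrightarrow> Dom X w = Dom X f \<Longrightarrow> Dom X w' = Dom X f \<Longrightarrow> Cod X w = Dom X g \<Longrightarrow>
       Cod X w' = Dom X g \<Longrightarrow> g \<cdot>\<^bsub>X\<^esub> w = f \<Longrightarrow> g \<cdot>\<^bsub>X\<^esub> w' = f \<Longrightarrow> w \<cdot>\<^bsub>X\<^esub> a = v \<Longrightarrow> w' \<cdot>\<^bsub>X\<^esub> a = v \<Longrightarrow> w = w'"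
proof -
  have "\<exists>!w. w \<in> hom X (Dom X f) (Dom X g) \<and> g \<cdot>\<^bsub>X\<^esub> w = f \<and> w \<cdot>\<^bsub>X\<^esub> a = v"
    using assms unfolding coequalizing_def by (simp del: hom_def) (simp add: hom_def)
  then show "\<exists>w. w \<in> Arr X \<and> Dom X w = Dom X f \<and> Cod X w = Dom X g \<and> g \<cdot>\<^bsub>X\<^esub> w = f \<and> w \<cdot>\<^bsub>X\<^esub> a = v"
    "\<And>w w'. w \<in> Arr X \<Longrightarrow> w' \<in> Arr X \<Longrightarrow> Dom X w = Dom X f \<Longrightarrow> Dom X w' = Dom X f \<Longrightarrow> Cod X w = Dom X g \<Longrightarrow>
       Cod X w' = Dom X g \<Longrightarrow> g \<cdot>\<^bsub>X\<^esub> w = f \<Longrightarrow> g \<cdot>\<^bsub>X\<^esub> w' = f \<Longrightarrow> w \<cdot>\<^bsub>X\<^esub> a = v \<Longrightarrow> w' \<cdot>\<^bsub>X\<^esub> a = v \<Longrightarrow> w = w'"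
    by auto
qed

text \<open>A composite \<open>w \<cdot> a\<close> is compatible automatically, so the uniqueness
  clause makes \<open>a\<close> epimorphic among arrows over the base.\<close>

lemma (in category) coequalizing_epi:
  assumes "coequalizing C p" "is_pullback C p f e a" "g \<in> Arr C" "Cod C g = Cod C p"
    "w \<in> Arr C" "w' \<in> Arr C" "Dom C w = Dom C f" "Dom C w' = Dom C f" "Cod C w = Dom C g"
    "Cod C w' = Dom C g" "g \<cdot> w = f" "g \<cdot> w' = f" "w \<cdot> a = w' \<cdot> a"
  shows "w = w'"
proof -
  note P = is_pullbackD[OF assms(2)]
  have "compat C a (w \<cdot> a)" unfolding compat_def using P assms(5,7) by auto
  moreover have "g \<cdot> (w \<cdot> a) = f \<cdot> a" using P assms(3-9) reassoc[OF assms(11)] by simp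
  ultimately show ?thesis
    by (intro coequalizingD(2)[OF assms(1-4), of "w \<cdot> a" w w']) (use P assms(5-13) in simp_all)
qed

section \<open>Full faithfulness of the comparison and coequalizers\<close>

context descent
begin

text \<open>A compatible \<open>v\<close> yields a cone on \<open>K f\<close>. Fullness turns it
  into \<open>w\<close>, whose equation with \<open>v\<close> is read off at the ordinal 1, where
  the leg is \<open>p\<close>; faithfulness gives uniqueness.\<close>

lemma fully_faithful_imp_coequalizing:
  assumes ff: "fully_faithful XB DC CF"
  shows "coequalizing X p"
  unfolding coequalizing_def
proof (intro allI impI)
  fix f e a g v
  assume pb: "is_pullback X p f e a" and g: "g \<in> Arr X" "Cod X g = Cod X p"
    and "v \<in> hom X (Dom X a) (Dom X g)" and gv: "g \<cdot> v = f \<cdot> a" and cv: "compat X a v"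
  then have v: "v \<in> Arr X" "Dom X v = Dom X a" "Cod X v = Dom X g" by auto
  note P = is_pullbackD[OF pb]
  have f: "f \<in> Arr X" "Cod X f = Cod X p" using P by auto
  \<comment> \<open>\<open>l n\<close> forgets all coordinates of the power except the 0-th and
    lands in the given pullback. The choice of coordinate does not affect
    \<open>v \<cdot> l n\<close>: it leaves \<open>a \<cdot> l n\<close> unchanged, and
    \<open>v\<close> is compatible. The cone condition rests on this.\<close>
  have "\<exists>l. \<forall>n. n \<noteq> 0 \<longrightarrow> l n \<in> Arr X \<and> Dom X (l n) = Dom X (pb1 X (leg n) f) \<and> Cod X (l n) = Dom X e \<and>
      e \<cdot> l n = prj n 0 \<cdot> pb1 X (leg n) f \<and> a \<cdot> l n = pb2 X (leg n) f"
  proof (rule choice, intro allI)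
    fix n :: nat
    show "\<exists>l. n \<noteq> 0 \<longrightarrow> l \<in> Arr X \<and> Dom X l = Dom X (pb1 X (leg n) f) \<and> Cod X l = Dom X e \<and>
      e \<cdot> l = prj n 0 \<cdot> pb1 X (leg n) f \<and> a \<cdot> l = pb2 X (leg n) f"
    proof (cases "n = 0")
      case False
      then obtain l where "l \<in> Arr X" "Dom X l = Dom X (prj n 0 \<cdot> pb1 X (leg n) f)" "Cod X l = Dom X e"
        "e \<cdot> l = prj n 0 \<cdot> pb1 X (leg n) f" "a \<cdot> l = pb2 X (leg n) f"
        using is_pullback_lift[OF pb, of "prj n 0 \<cdot> pb1 X (leg n) f" "pb2 X (leg n) f"] f by auto
      then show ?thesis using False f by auto
    qed simp
  qed
  then obtain l where l: "\<And>n. n \<noteq> 0 \<Longrightarrow> l n \<in> Arr X" "\<And>n. n \<noteq> 0 \<Longrightarrow> Dom X (l n) = Dom X (pb1 X (leg n) f)"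
    "\<And>n. n \<noteq> 0 \<Longrightarrow> Cod X (l n) = Dom X e" "\<And>n. n \<noteq> 0 \<Longrightarrow> e \<cdot> l n = prj n 0 \<cdot> pb1 X (leg n) f"
    "\<And>n. n \<noteq> 0 \<Longrightarrow> a \<cdot> l n = pb2 X (leg n) f" by auto
  have cone: "cone (K f) g (\<lambda>n. v \<cdot> l n)"
    unfolding cone_def
  proof (intro conjI allI impI)
    fix n :: nat assume n: "n \<noteq> 0"
    show "v \<cdot> l n \<in> Arr X" "Dom X (v \<cdot> l n) = Dom X (ob (K f) n)" "Cod X (v \<cdot> l n) = Dom X g"
      "g \<cdot> v \<cdot> l n = leg n \<cdot> ob (K f) n"
      using n l[OF n] v P f g ob_K[OF f n] reassoc[OF gv] by simp_all
  next
    fix \<phi> e' x assume e: "element (ob (K f)) \<phi> e' x"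
    note e' = e[unfolded elt_K[OF f]] and Q = push_K[OF f e]
    let ?y = "transport (ob (K f)) (tr (K f)) \<phi> e' x"
    have st: "src \<phi> \<noteq> 0" "tgt \<phi> \<noteq> 0" using e' by auto
    note ls = l[OF st(1)] and lt = l[OF st(2)]
    have "a \<cdot> (l (tgt \<phi>) \<cdot> ?y) = a \<cdot> (l (src \<phi>) \<cdot> x)"
      using reassoc[OF ls(5)] reassoc[OF lt(5)] ls(1-3) lt(1-3) Q e' P by simp
    then have "v \<cdot> (l (tgt \<phi>) \<cdot> ?y) = v \<cdot> (l (src \<phi>) \<cdot> x)"
      using cv[unfolded compat_def, rule_format, of "l (tgt \<phi>) \<cdot> ?y" "l (src \<phi>) \<cdot> x"] ls(1-3) lt(1-3) Q e' P by simp
    then show "(v \<cdot> l (tgt \<phi>)) \<cdot> ?y = (v \<cdot> l (src \<phi>)) \<cdot> x"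
      using ls(1-3) lt(1-3) Q e' v P by simp
  qed
  define G where "G = (K f, mk_mod (ob (K f)) (ob (K g)) (\<lambda>n. pb_lift X (leg n) g (ob (K f) n) (v \<cdot> l n)), K g)"
  have "G \<in> hom DC (FOb CF f) (FOb CF g)"
    using cone_dmor[OF psn_K[OF f] g cone] psn_K[OF f] psn_K[OF g]
    unfolding G_def by (simp add: comparison_FOb md_mk_mod)
  then obtain w0 where w0: "w0 \<in> hom XB f g" "FAr CF w0 = G"
    using fully_faithfulD(2)[OF ff] f g by (metis (mono_tags, lifting) CollectI slice_simps(1))
  obtain f' w g' where "w0 = (f', w, g')" by (cases w0)
  then have w0': "w0 = (f, w, g)" using w0(1) by simp
  have w: "w \<in> Arr X" "Dom X w = Dom X f" "Cod X w = Dom X g" "g \<cdot> w = f" using w0(1) unfolding w0' by simp_all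
  have fw: "(f, w, g) \<in> Arr XB" using f g w by simp
  have 1: "pb_lift X (leg 1) g (ob (K f) 1) (w \<cdot> pb2 X (leg 1) f) = pb_lift X (leg 1) g (ob (K f) 1) (v \<cdot> l 1)"
    using w0(2) unfolding w0' comparison_FAr[OF fw] G_def by (simp only: prod.inject mk_mod_eq_iff)
  have "pb2 X (leg 1) g \<cdot> pb_lift X (leg 1) g (ob (K f) 1) (w \<cdot> pb2 X (leg 1) f) =
     pb2 X (leg 1) g \<cdot> pb_lift X (leg 1) g (ob (K f) 1) (v \<cdot> l 1)" by (simp only: 1)
  then have w1: "w \<cdot> pb2 X p f = v \<cdot> l 1"
    using coneD[OF cone, of 1] coneD[OF cone_K[OF fw], of 1] g ob_K[OF f, of 1] f by simp
  \<comment> \<open>\<open>k\<close> compares the given pullback of \<open>p\<close> along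
    \<open>f\<close> with the chosen one; \<open>l 1\<close> is a left inverse of it, which frees
    the equation from the choice.\<close>
  obtain k where k: "k \<in> Arr X" "Dom X k = Dom X e" "Cod X k = Dom X (pb1 X p f)" "pb1 X p f \<cdot> k = e" "pb2 X p f \<cdot> k = a"
    using is_pullback_lift[OF pb_is_pullback[of p f], of e a] P f by auto
  have l1: "l 1 \<in> Arr X" "Dom X (l 1) = Dom X (pb1 X p f)" "Cod X (l 1) = Dom X e" "e \<cdot> l 1 = pb1 X p f" "a \<cdot> l 1 = pb2 X p f"
    using l[of 1] f by simp_all
  have lk: "l 1 \<cdot> k = Ide X (Dom X e)"
    by (rule is_pullback_ext[OF pb]) (use l1 k P reassoc[OF l1(4)] reassoc[OF l1(5)] in simp_all)
  have wa: "w \<cdot> a = v"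
  proof -
    have "w \<cdot> a = (w \<cdot> pb2 X p f) \<cdot> k" using w k f by simp
    also have "\<dots> = v" unfolding w1 using l1 k lk v P by simp
    finally show ?thesis .
  qed
  show "\<exists>!w. w \<in> hom X (Dom X f) (Dom X g) \<and> g \<cdot> w = f \<and> w \<cdot> a = v"
  proof (rule ex1I[of _ w])
    show "w \<in> hom X (Dom X f) (Dom X g) \<and> g \<cdot> w = f \<and> w \<cdot> a = v" using w wa by simp
    fix w' assume w'': "w' \<in> hom X (Dom X f) (Dom X g) \<and> g \<cdot> w' = f \<and> w' \<cdot> a = v"
    then have w': "w' \<in> Arr X" "Dom X w' = Dom X f" "Cod X w' = Dom X g" "g \<cdot> w' = f" "w' \<cdot> a = v" by auto
    have fw': "(f, w', g) \<in> Arr XB" using f g w' by simp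
    have "w' \<cdot> pb2 X (leg n) f = w \<cdot> pb2 X (leg n) f" if n: "n \<noteq> 0" for n
      using reassoc[OF w'(5), of "l n"] reassoc[OF wa, of "l n"] l[OF n] P w w' by simp
    then have "FAr CF (f, w', g) = FAr CF (f, w, g)"
      unfolding comparison_FAr[OF fw] comparison_FAr[OF fw'] by (simp add: mk_mod_eq_iff)
    then have "(f, w', g) = (f, w, g)"
      by (intro fully_faithfulD(1)[OF ff, of f g]) (use f g fw fw' in simp_all)
    then show "w' = w" by simp
  qed
qed

text \<open>Faithfulness is \<open>coequalizing_epi\<close> applied at the ordinal 1. For fullness,
  the component at 1 of an arrow from \<open>K f\<close> to \<open>K g\<close> is descended along
  \<open>pb2 X p f\<close>, and \<open>cone_unique\<close> shows the result to be right at every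
  ordinal.\<close>

lemma coequalizing_imp_fully_faithful:
  assumes co: "coequalizing X p"
  shows "fully_faithful XB DC CF"
  unfolding fully_faithful_def bij_betw_def inj_on_def
proof (intro conjI ballI impI is_functor_comparison)
  fix f g x y
  assume f: "f \<in> Obj XB" and g: "g \<in> Obj XB"
    and x: "x \<in> hom XB f g" and y: "y \<in> hom XB f g"
    and eq: "FAr CF x = FAr CF y"
  have f': "f \<in> Arr X" "Cod X f = Cod X p" and g': "g \<in> Arr X" "Cod X g = Cod X p" using f g by auto
  obtain w where w: "x = (f, w, g)" "w \<in> Arr X" "Dom X w = Dom X f" "Cod X w = Dom X g" "g \<cdot> w = f"
    using x by (cases x) auto
  obtain w' where w': "y = (f, w', g)" "w' \<in> Arr X" "Dom X w' = Dom X f" "Cod X w' = Dom X g" "g \<cdot> w' = f"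
    using y by (cases y) auto
  have fw: "(f, w, g) \<in> Arr XB" and fw': "(f, w', g) \<in> Arr XB"
    using f' g' w w' by simp_all
  have 1: "pb_lift X (leg 1) g (ob (K f) 1) (w \<cdot> pb2 X (leg 1) f) = pb_lift X (leg 1) g (ob (K f) 1) (w' \<cdot> pb2 X (leg 1) f)"
    using eq unfolding w(1) w'(1) comparison_FAr[OF fw] comparison_FAr[OF fw'] by (simp only: prod.inject mk_mod_eq_iff)
  have "pb2 X (leg 1) g \<cdot> pb_lift X (leg 1) g (ob (K f) 1) (w \<cdot> pb2 X (leg 1) f) =
      pb2 X (leg 1) g \<cdot> pb_lift X (leg 1) g (ob (K f) 1) (w' \<cdot> pb2 X (leg 1) f)" by (simp only: 1)
  then have ww: "w \<cdot> pb2 X p f = w' \<cdot> pb2 X p f"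
    using coneD[OF cone_K[OF fw], of 1] coneD[OF cone_K[OF fw'], of 1] g' ob_K[OF f', of 1] f' by simp
  have "w = w'"
    by (rule coequalizing_epi[OF co pb_is_pullback[of p f], of g]) (use f' g' w w' ww in simp_all)
  then show "x = y" unfolding w w' by simp
next
  fix f g assume f: "f \<in> Obj XB" and g: "g \<in> Obj XB"
  have f': "f \<in> Arr X" "Cod X f = Cod X p" and g': "g \<in> Arr X" "Cod X g = Cod X p" using f g by auto
  let ?F = "CF"
  show "FAr ?F ` hom XB f g = hom DC (FOb ?F f) (FOb ?F g)"
  proof (intro equalityI subsetI)
    fix y assume "y \<in> FAr ?F ` hom XB f g"
    then obtain x where x: "y = FAr ?F x" "x \<in> hom XB f g" by blast
    have "x \<in> Arr XB" "Dom XB x = f" "Cod XB x = g"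
      using x(2) unfolding hom_def by blast+
    then show "y \<in> hom DC (FOb ?F f) (FOb ?F g)"
      using is_functorD(4-6)[OF is_functor_comparison, of x] unfolding x(1) hom_def by blast
  next
    fix y assume y: "y \<in> hom DC (FOb ?F f) (FOb ?F g)"
    obtain h where h: "y = (K f, mk_mod (ob (K f)) (ob (K g)) h, K g)"
        "dmor (ob (K f)) (tr (K f)) (ob (K g)) (tr (K g)) h"
      using y unfolding comparison_FOb by (auto elim!: Arr_DC)
    note D = dmor_cone[OF psn_K[OF f'] g' h(2)]
    let ?v = "pb2 X (leg 1) g \<cdot> h 1"
    have v: "?v \<in> Arr X" "Dom X ?v = Dom X (pb1 X p f)" "Cod X ?v = Dom X g" "g \<cdot> ?v = p \<cdot> pb1 X p f"
      using coneD[OF D(1), of 1] ob_K[OF f', of 1] by simp_all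
    have "compat X (pb2 X p f) ?v"
      unfolding compat_def
    proof (intro ballI impI)
      fix s t assume st: "s \<in> Arr X" "t \<in> Arr X" "Dom X s = Dom X t" "Cod X s = Dom X (pb2 X p f)" "Cod X t = Dom X (pb2 X p f)"
        and eq: "pb2 X p f \<cdot> s = pb2 X p f \<cdot> t"
      have st': "Cod X s = Dom X (pb1 X p f)" "Cod X t = Dom X (pb1 X p f)" using st f' by simp_all
      have "f \<cdot> (pb2 X p f \<cdot> s) = f \<cdot> (pb2 X p f \<cdot> t)" unfolding eq ..
      then have pst: "p \<cdot> (pb1 X p f \<cdot> t) = p \<cdot> (pb1 X p f \<cdot> s)" using f' st(1-3) st' by simp
      \<comment> \<open>\<open>s\<close> and \<open>t\<close> have the same image in the domain of
        \<open>f\<close>, so their first coordinates lie over one point of the base and form a pair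
        \<open>e\<close>. Over \<open>e\<close>, the transports of \<open>s\<close> along the point
        0 and of \<open>t\<close> along the point 1 coincide, so the cone identifies
        \<open>s\<close> and \<open>t\<close>.\<close>
      obtain e where e: "e \<in> Arr X" "Dom X e = Dom X s" "Cod X e = pw 2" "leg 2 \<cdot> e = p \<cdot> (pb1 X p f \<cdot> s)"
        "prj 2 0 \<cdot> e = pb1 X p f \<cdot> s" "prj 2 1 \<cdot> e = pb1 X p f \<cdot> t"
        using pow_pair[of "pb1 X p f \<cdot> s" "pb1 X p f \<cdot> t"] f' st(1-3) st' pst by auto
      have e0: "element (ob (K f)) (map_of_list [0] 2) e s" and e1: "element (ob (K f)) (map_of_list [1] 2) e t"
        unfolding elt_K[OF f'] using e st st' f' dg_point[of 0 2] dg_point[of 1 2] by simp_all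
      note Q0 = push_K[OF f' e0] and Q1 = push_K[OF f' e1]
      have "transport (ob (K f)) (tr (K f)) (map_of_list [0] 2) e s = transport (ob (K f)) (tr (K f)) (map_of_list [1] 2) e t"
        by (rule pb_ext[of "leg 2" f]) (use Q0 Q1 eq f' in \<open>simp_all del: pow_leg.simps\<close>, simp_all)
      then show "?v \<cdot> s = ?v \<cdot> t"
        using cone_push[OF D(1) e0] cone_push[OF D(1) e1] by simp
    qed
    then obtain w where w: "w \<in> Arr X" "Dom X w = Dom X f" "Cod X w = Dom X g" "g \<cdot> w = f" "w \<cdot> pb2 X p f = ?v"
      using coequalizingD(1)[OF co pb_is_pullback[of p f], of g ?v] f' g' v by auto
    have fw: "(f, w, g) \<in> Arr XB" using f' g' w by simp
    have "pb2 X (leg n) g \<cdot> h n = w \<cdot> pb2 X (leg n) f" if n: "n \<noteq> 0" for n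
      by (rule cone_unique[OF psn_K[OF f'] D(1) cone_K[OF fw] _ n]) (use w(5) in simp)
    then have "FAr ?F (f, w, g) = y"
      unfolding h(1) comparison_FAr[OF fw] using D(2) by (simp add: mk_mod_eq_iff)
    then show "y \<in> FAr ?F ` hom XB f g" using f g fw by force
  qed
qed

end

context category
begin

lemma is_pullback_iso:
  assumes pb: "is_pullback C f g u v" and j: "iso C j" "Cod C j = Dom C u"
  shows "is_pullback C f g (u \<cdot> j) (v \<cdot> j)"
proof -
  note P = is_pullbackD[OF pb]
  obtain k where k: "j \<in> Arr C" "k \<in> Arr C" "Dom C k = Cod C j" "Cod C k = Dom C j"
    "k \<cdot> j = Ide C (Dom C j)" "j \<cdot> k = Ide C (Cod C j)" using j(1) isoE by metis
  show ?thesis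
  proof (rule is_pullbackI)
    fix s t assume st: "s \<in> Arr C" "t \<in> Arr C" "Dom C t = Dom C s" "Cod C s = Dom C f" "Cod C t = Dom C g" "f \<cdot> s = g \<cdot> t"
    obtain h where h: "h \<in> Arr C" "Dom C h = Dom C s" "Cod C h = Dom C u" "u \<cdot> h = s" "v \<cdot> h = t"
      by (rule is_pullback_lift[OF pb, of s t]) (use st in auto)
    show "\<exists>h\<in>Arr C. Dom C h = Dom C s \<and> Cod C h = Dom C (u \<cdot> j) \<and> (u \<cdot> j) \<cdot> h = s \<and> (v \<cdot> j) \<cdot> h = t"
      by (rule bexI[of _ "k \<cdot> h"]) (use h k j P reassoc[OF k(6)] in simp_all)
  next
    fix h h' assume h: "h \<in> Arr C" "h' \<in> Arr C" "Dom C h' = Dom C h" "Cod C h = Dom C (u \<cdot> j)"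
      "Cod C h' = Dom C (u \<cdot> j)" "(u \<cdot> j) \<cdot> h = (u \<cdot> j) \<cdot> h'" "(v \<cdot> j) \<cdot> h = (v \<cdot> j) \<cdot> h'"
    have jh: "j \<cdot> h = j \<cdot> h'"
      by (rule is_pullback_ext[OF pb]) (use h k j P in simp_all)
    show "h = h'"
      by (rule iso_cancel[OF j(1)]) (use jh h k j P in simp_all)
  qed (use P k j reassoc[OF P(9)] in simp_all)
qed

end

section \<open>From an equivalence to effective actions\<close>

context descent
begin

text \<open>The family acts by \<xi>(z, e0), where e0 is the 0-th coordinate of \<open>e\<close>;
  the pair lies in the pullback because p c z = leg n e = p e0. The laws of an action become
  \<open>act_unit\<close> and \<open>act_act\<close>. The second conjunct evaluates the action at
  any lift \<open>h\<close>, hiding the choice made by \<open>SOME\<close>.\<close>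

lemma action_family:
  assumes act: "action X p c u v \<xi>"
  shows "\<exists>act. descent_family X p p c (\<lambda>n. prj n 0) act \<and>
    (\<forall>n e z h. ok_elt p c n e z \<longrightarrow> h \<in> Arr X \<longrightarrow> Dom X h = Dom X e \<longrightarrow> Cod X h = Dom X u \<longrightarrow>
       u \<cdot> h = z \<longrightarrow> v \<cdot> h = prj n 0 \<cdot> e \<longrightarrow> act n e z = \<xi> \<cdot> h)"
proof -
  note A = actionD[OF act] and P = is_pullbackD[OF actionD(3)[OF act]]
  define is_lift where "is_lift n e z h \<longleftrightarrow> h \<in> Arr X \<and> Dom X h = Dom X e \<and> Cod X h = Dom X u \<and>
    u \<cdot> h = z \<and> v \<cdot> h = prj n 0 \<cdot> e" for n e z h
  have ex: "\<exists>h. is_lift n e z h" if ok: "ok_elt p c n e z" for n e z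
  proof -
    have ok': "n \<noteq> 0" "e \<in> Arr X" "Cod X e = pw n" "z \<in> Arr X" "Cod X z = Dom X c" "Dom X z = Dom X e"
      "p \<cdot> (c \<cdot> z) = leg n \<cdot> e" using ok unfolding ok_elt_def by auto
    obtain h where "h \<in> Arr X" "Dom X h = Dom X z" "Cod X h = Dom X u" "u \<cdot> h = z" "v \<cdot> h = prj n 0 \<cdot> e"
      by (rule is_pullback_lift[OF A(3), of z "prj n 0 \<cdot> e"]) (use ok' A P in auto)
    then show ?thesis using ok'(6) unfolding is_lift_def by auto
  qed
  have uniq: "h = h'" if "is_lift n e z h" "is_lift n e z h'" for n e z h h'
    by (rule is_pullback_ext[OF A(3)]) (use that in \<open>auto simp: is_lift_def\<close>)
  define op where "op n e z = \<xi> \<cdot> (SOME h. is_lift n e z h)" for n e z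
  have op: "op n e z = \<xi> \<cdot> h" if "is_lift n e z h" for n e z h
    using someI[of "is_lift n e z", OF that] uniq[OF _ that] unfolding op_def by metis
  have "descent_family X p p c (\<lambda>n. prj n 0) op"
  proof
    fix n e z assume ok: "ok_elt p c n e z"
    then obtain h where h: "is_lift n e z h" using ex by blast
    note h' = h[unfolded is_lift_def]
    have ok': "n \<noteq> 0" "e \<in> Arr X" "Cod X e = pw n" "z \<in> Arr X" "Cod X z = Dom X c" "Dom X z = Dom X e"
      "p \<cdot> (c \<cdot> z) = leg n \<cdot> e" using ok unfolding ok_elt_def by auto
    show "op n e z \<in> Arr X \<and> Dom X (op n e z) = Dom X e \<and> Cod X (op n e z) = Dom X c \<and> c \<cdot> op n e z = prj n 0 \<cdot> e"
      unfolding op[OF h] using h' A P reassoc[OF A(7)] by simp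
    show "op n e z = z" if "c \<cdot> z = prj n 0 \<cdot> e"
      unfolding op[OF h] using action_unit[OF act, of h] h' that by simp
    fix k assume k: "k \<in> Arr X" "Cod X k = Dom X e"
    have "is_lift n (e \<cdot> k) (z \<cdot> k) (h \<cdot> k)"
      unfolding is_lift_def using h' k A P ok' reassoc[of u h z k] reassoc[of v h _ k] by simp
    then show "op n e z \<cdot> k = op n (e \<cdot> k) (z \<cdot> k)"
      using op[OF h] op h' k A by simp
  next
    fix n m e e' z assume ok: "ok_elt p c n e z" "ok_elt p c m e' z"
    obtain h where h: "is_lift m e' z h" using ex[OF ok(2)] by blast
    obtain h'' where h'': "is_lift n e z h''" using ex[OF ok(1)] by blast
    note H = h[unfolded is_lift_def] h''[unfolded is_lift_def]
    have d: "Dom X e = Dom X e'" using ok unfolding ok_elt_def by simp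
    have "ok_elt p c n e (\<xi> \<cdot> h)"
      using ok H A P reassoc[OF A(7)] unfolding ok_elt_def by auto
    then obtain h' where h': "is_lift n e (\<xi> \<cdot> h) h'" using ex by blast
    \<comment> \<open>With e0 and e0' the 0-th coordinates of \<open>e\<close> and
      \<open>e'\<close>, associativity is used for \<open>h\<close> = (z, e0'), \<open>h'\<close> =
      (\<xi> h, e0) and \<open>h''\<close> = (z, e0).\<close>
    have "\<xi> \<cdot> h' = \<xi> \<cdot> h''"
      by (rule action_assoc[OF act, of h]) (use H h'[unfolded is_lift_def] d in simp_all)
    then show "op n e (op m e' z) = op n e z"
      unfolding op[OF h] op[OF h'] op[OF h''] .
  next
    fix n :: nat assume "n \<noteq> 0"
    then show "prj n 0 \<in> Arr X \<and> Dom X (prj n 0) = pw n \<and> Cod X (prj n 0) = Cod X c \<and> p \<cdot> prj n 0 = leg n"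
      using A by simp
  qed (use A in simp_all)
  then show ?thesis using op unfolding is_lift_def by blast
qed

text \<open>The descent datum of the action is isomorphic to some \<open>K f\<close>. At the ordinal
  1 the isomorphism presents \<open>c\<close> as a pullback of \<open>f\<close> along
  \<open>p\<close>; at the ordinal 2 its compatibility with transport is the equation between
  \<open>q \<cdot> \<xi>\<close> and \<open>q \<cdot> u\<close>.\<close>

lemma equivalence_imp_actions_effective:
  assumes eq: "is_equivalence XB DC CF"
  shows "actions_effective X p"
  unfolding actions_effective_def
proof (intro allI impI)
  fix c u v \<xi> assume act: "action X p c u v \<xi>"
  note A = actionD[OF act] and P = is_pullbackD[OF actionD(3)[OF act]]
  obtain op where fam: "descent_family X p p c (\<lambda>n. prj n 0) op"
    and op: "\<And>n e z h. ok_elt p c n e z \<Longrightarrow> h \<in> Arr X \<Longrightarrow> Dom X h = Dom X e \<Longrightarrow> Cod X h = Dom X u \<Longrightarrow>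
       u \<cdot> h = z \<Longrightarrow> v \<cdot> h = prj n 0 \<cdot> e \<Longrightarrow> op n e z = \<xi> \<cdot> h"
    using action_family[OF act] by blast
  interpret F: descent_family X p p c "\<lambda>n. prj n 0" op by (fact fam)
  interpret D: descent_data X p F.fam_ob F.fam_tr by (rule descent_dataI[OF F.ddata_fam])
  define \<alpha> where "\<alpha> = mk_psnat F.fam_ob F.fam_tr"
  have \<alpha>: "psn \<alpha>" unfolding \<alpha>_def by (rule psn_mk_psnat[OF F.ddata_fam])
  have ob\<alpha>: "n \<noteq> 0 \<Longrightarrow> ob \<alpha> n = F.fam_ob n" and tr\<alpha>: "\<phi> \<in> Arr Delta \<Longrightarrow> tr \<alpha> \<phi> = F.fam_tr \<phi>" for n \<phi>
    unfolding \<alpha>_def by simp_all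
  note pc = push_cong[OF psn_ddata[OF \<alpha>] F.ddata_fam, OF ob\<alpha> tr\<alpha>]
  obtain f i where f0: "f \<in> Obj XB" and i: "i \<in> hom DC (K f) \<alpha>" "iso DC i"
    using equivalence_essentially_surjective[OF eq, of \<alpha>] \<alpha> unfolding comparison_FOb by auto
  have f: "f \<in> Arr X" "Cod X f = Cod X p" using f0 by auto
  \<comment> \<open>The inverse is taken because \<open>dmor_cone\<close> describes arrows into
    \<open>K f\<close>.\<close>
  obtain j where j: "j \<in> hom DC \<alpha> (K f)" "iso DC j"
  proof -
    obtain j where "j \<in> Arr DC" "Dom DC j = Cod DC i" "Cod DC j = Dom DC i" "iso DC j"
      using category.isoE[OF category_DC i(2)] by metis
    then show thesis using that[of j] i(1) by simp
  qed
  obtain g where g: "j = (\<alpha>, mk_mod (ob \<alpha>) (ob (K f)) g, K f)" "dmor (ob \<alpha>) (tr \<alpha>) (ob (K f)) (tr (K f)) g"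
    using j(1) by (auto elim!: Arr_DC)
  have gi: "iso X (g n)" if "n \<noteq> 0" for n
    using j(2) iso_DC[OF \<alpha> psn_K[OF f] g(2)] that unfolding g(1) by blast
  note C = dmor_cone[OF \<alpha> f g(2)]
  let ?V = "\<lambda>n. pb2 X (leg n) f \<cdot> g n"
  have g1: "g 1 \<in> Arr X" "Dom X (g 1) = Dom X (F.fam_ob 1)" "Cod X (g 1) = Dom X (pb1 X p f)"
    "pb1 X p f \<cdot> g 1 = F.fam_ob 1"
    using g(2)[unfolded dmor_def, THEN conjunct1, rule_format, of 1]
    unfolding ob\<alpha>[OF one_neq_zero] ob_K[OF f one_neq_zero] by simp_all
  have V1: "?V 1 = pb2 X p f \<cdot> g 1" by simp
  \<comment> \<open>\<open>F.fam_ob 1\<close> is a chosen pullback of \<open>c\<close> along the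
    identity \<open>prj 1 0\<close> and need not be \<open>c\<close> itself; \<open>s\<close> is the
    resulting isomorphism from the domain of \<open>c\<close>.\<close>
  define s where "s = pb_lift X (prj 1 0) c c (Ide X (Dom X c))"
  have s: "s \<in> Arr X" "Dom X s = Dom X c" "Cod X s = Dom X (F.fam_ob 1)" "F.fam_ob 1 \<cdot> s = c"
    "pb2 X (prj 1 0) c \<cdot> s = Ide X (Dom X c)"
  proof -
    have "c \<cdot> Ide X (Dom X c) = prj 1 0 \<cdot> c" "Cod X c = pw 1" unfolding leg_1 using A by simp_all
    note L = F.fam_lift[OF one_neq_zero A(1) this(2) _ _ _ this(1)]
    show "s \<in> Arr X" "Dom X s = Dom X c" "Cod X s = Dom X (F.fam_ob 1)" "F.fam_ob 1 \<cdot> s = c"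
      "pb2 X (prj 1 0) c \<cdot> s = Ide X (Dom X c)"
      unfolding s_def using A(1) by (auto intro!: L simp del: One_nat_def)
  qed
  have fam1: "F.fam_ob 1 \<in> Arr X" "Cod X (F.fam_ob 1) = Dom X p"
    "pb2 X (prj 1 0) c \<in> Arr X" "Dom X (pb2 X (prj 1 0) c) = Dom X (F.fam_ob 1)" "Cod X (pb2 X (prj 1 0) c) = Dom X c"
    "c \<cdot> pb2 X (prj 1 0) c = F.fam_ob 1"
  proof -
    note F1 = F.fam_ob_simps[OF one_neq_zero]
    show "F.fam_ob 1 \<in> Arr X" "Cod X (F.fam_ob 1) = Dom X p"
      "pb2 X (prj 1 0) c \<in> Arr X" "Dom X (pb2 X (prj 1 0) c) = Dom X (F.fam_ob 1)" "Cod X (pb2 X (prj 1 0) c) = Dom X c"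
      using F1(1-5) unfolding leg_1 by simp_all
    show "c \<cdot> pb2 X (prj 1 0) c = F.fam_ob 1"
      unfolding F1(6) using F1(1,2) unfolding leg_1 by simp
  qed
  define t where "t = pb2 X (prj 1 0) c"
  note t = fam1(3-6)[folded t_def] s(5)[folded t_def]
  have ss: "s \<cdot> t = Ide X (Dom X (F.fam_ob 1))"
    by (rule F.fam_ext[of 1, folded t_def])
      (use s(1-4) t fam1(1,2) reassoc[OF s(4)] reassoc[OF t(5)] in \<open>simp_all del: One_nat_def\<close>)
  have "iso X s"
    by (rule isoI[of s t]) (use s(1-4) ss t in \<open>simp_all del: One_nat_def\<close>)
  then have gs: "iso X (g 1 \<cdot> s)" using iso_Cmp[of s "g 1"] gi[of 1] s g1 by simp
  define q where "q = ?V 1 \<cdot> s"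
  have q: "q = pb2 X p f \<cdot> (g 1 \<cdot> s)" unfolding q_def V1 using g1 s f by simp
  have c': "c = pb1 X p f \<cdot> (g 1 \<cdot> s)" using reassoc[OF g1(4)] g1 s f by simp
  have pb: "is_pullback X p f c q"
    unfolding q by (subst c') (rule is_pullback_iso[OF pb_is_pullback[of p f] gs], use f g1 s in simp_all)
  let ?l0 = "map_of_list [0] 2" and ?l1 = "map_of_list [1] 2"
  have uv: "u \<in> Arr X" "v \<in> Arr X" "Cod X u = Dom X c" "Dom X v = Dom X u" "Cod X v = Dom X p" "p \<cdot> (c \<cdot> u) = p \<cdot> v"
    "c \<in> Arr X" "Cod X c = Dom X p" "\<xi> \<in> Arr X" "Dom X \<xi> = Dom X u" "Cod X \<xi> = Dom X c" "c \<cdot> \<xi> = v"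
    using A P by simp_all
  \<comment> \<open>The target \<open>v\<close> of the action is placed at coordinate 0 and the
    source \<open>c \<cdot> u\<close> at coordinate 1. The family acts through coordinate 0 only, so
    \<open>u\<close> at coordinate 1 and \<xi> at coordinate 0 have the same transport over
    \<open>e\<close>.\<close>
  obtain e where e: "e \<in> Arr X" "Dom X e = Dom X u" "Cod X e = pw 2" "leg 2 \<cdot> e = p \<cdot> v"
    and e2: "prj 2 0 \<cdot> e = v" "prj 2 1 \<cdot> e = c \<cdot> u"
    using pow_pair[of v "c \<cdot> u"] uv by auto
  have el1: "element F.fam_ob ?l1 e (s \<cdot> u)"
    unfolding D.elt_def using e(1-3) e2(2) s(1-4) uv reassoc[OF s(4), of u] fam1(1,2) dg_point[of 1 2] by simp
  have el0: "element F.fam_ob ?l0 e (s \<cdot> \<xi>)"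
    unfolding D.elt_def using e(1-3) e2(1) s(1-4) uv reassoc[OF s(4), of \<xi>] fam1(1,2) dg_point[of 0 2] by simp
  have ok: "ok_elt p c 2 e u" "ok_elt p c 2 e \<xi>" unfolding ok_elt_def using e uv by simp_all
  have 1: "op 2 e u = \<xi>"
    using op[OF ok(1), of "Ide X (Dom X u)"] e(1-3) e2(1) uv by simp
  have 0: "op 2 e \<xi> = \<xi>" by (rule F.act_unit[OF ok(2)]) (use e2 uv in simp)
  have sd: "src ?l0 = 1" "tgt ?l0 = 2" "src ?l1 = 1" "tgt ?l1 = 2" by simp_all
  have p1: "pb2 X (prj 2 0) c \<cdot> transport F.fam_ob F.fam_tr ?l1 e (s \<cdot> u) = \<xi>"
  proof -
    have "t \<cdot> (s \<cdot> u) = u" using reassoc[OF t(5), of u] s(1-3) t(1-3) uv by simp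
    then show ?thesis using F.push_fam[OF el1] 1 unfolding t_def sd by (simp only:)
  qed
  have p0: "pb2 X (prj 2 0) c \<cdot> transport F.fam_ob F.fam_tr ?l0 e (s \<cdot> \<xi>) = \<xi>"
  proof -
    have "t \<cdot> (s \<cdot> \<xi>) = \<xi>" using reassoc[OF t(5), of \<xi>] s(1-3) t(1-3) uv by simp
    then show ?thesis using F.push_fam[OF el0] 0 unfolding t_def sd by (simp only:)
  qed
  have pp: "transport F.fam_ob F.fam_tr ?l1 e (s \<cdot> u) = transport F.fam_ob F.fam_tr ?l0 e (s \<cdot> \<xi>)"
    by (rule F.fam_ext[of 2]) (use D.push_simps[OF el0] D.push_simps[OF el1] p0 p1 in simp_all)
  have el': "element (ob \<alpha>) ?l1 e (s \<cdot> u)" "element (ob \<alpha>) ?l0 e (s \<cdot> \<xi>)" using el0 el1 pc(1) by simp_all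
  have "?V 1 \<cdot> (s \<cdot> u) = ?V 1 \<cdot> (s \<cdot> \<xi>)"
    using cone_push[OF C(1) el'(1)] cone_push[OF C(1) el'(2)] pc(2)[OF _ _ el'(1)] pc(2)[OF _ _ el'(2)] pp by simp
  then have "q \<cdot> \<xi> = q \<cdot> u" unfolding q_def V1 using g1 s(1-4) uv f by simp
  then show "\<exists>f q. is_pullback X p f c q \<and> q \<cdot> \<xi> = q \<cdot> u" using pb by blast
qed

end

section \<open>The action contained in a descent datum\<close>

context descent_data
begin

text \<open>Transport out of the ordinal 1, from the fibre over the i-th coordinate of
  \<open>e\<close> to the fibre over \<open>e\<close>.\<close>

abbreviation "pt n i e x \<equiv> push (map_of_list [i] n) e x"

lemma pt_elt:
  assumes "i < n" "e \<in> Arr X" "Cod X e = pw n" "x \<in> Arr X" "Dom X x = Dom X e" "Cod X x = Dom X (a 1)"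
    "a 1 \<cdot> x = prj n i \<cdot> e"
  shows "elt (map_of_list [i] n) e x"
  using assms dg_point[of i n] unfolding elt_def by simp

text \<open>Functoriality of transport: following the point k by \<phi> gives the point
  \<phi>(k).\<close>

lemma push_pt:
  assumes \<phi>: "\<phi> \<in> Arr Delta_dot" "k < src \<phi>" and e: "e \<in> Arr X" "Cod X e = pw (tgt \<phi>)"
    and x: "x \<in> Arr X" "Dom X x = Dom X e" "Cod X x = Dom X (a 1)" "a 1 \<cdot> x = prj (tgt \<phi>) (app \<phi> k) \<cdot> e"
  shows "push \<phi> e (pt (src \<phi>) k (dg \<phi> \<cdot> e) x) = pt (tgt \<phi>) (app \<phi> k) e x"
proof -
  have t: "app \<phi> k < tgt \<phi>" using \<phi> by simp
  have el: "elt (map_of_list [k] (src \<phi>)) (dg \<phi> \<cdot> e) x"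
    by (rule pt_elt) (use \<phi> e x in simp_all)
  have "\<phi> \<cdot>\<^bsub>Delta_dot\<^esub> map_of_list [k] (src \<phi>) = map_of_list [app \<phi> k] (tgt \<phi>)"
    by (rule Delta_dot_eqI) (use \<phi> t in simp_all)
  then show ?thesis using push_push[OF el \<phi>(1) _ _ e] t by simp
qed

lemma pt_inj:
  assumes "pt n i e x = pt n i e y" "i < n" "e \<in> Arr X" "Cod X e = pw n"
    "x \<in> Arr X" "Dom X x = Dom X e" "Cod X x = Dom X (a 1)" "a 1 \<cdot> x = prj n i \<cdot> e"
    "y \<in> Arr X" "Dom X y = Dom X e" "Cod X y = Dom X (a 1)" "a 1 \<cdot> y = prj n i \<cdot> e"
  shows "x = y"
  by (rule push_inj[OF assms(1)]) (use assms pt_elt in blast)+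

text \<open>\<xi> is found at the ordinal 2, as the element over \<open>v\<close> whose transport
  along 0 agrees with that of \<open>u\<close> along 1. The second clause spreads this to all
  ordinals and all i \<le> j. The laws follow by injectivity of transport, the unit at n = 1 and
  associativity at n = 3.\<close>

lemma exists_action:
  obtains u v \<xi> where "action X p (a 1) u v \<xi>"
    "\<And>n i j e h. i \<le> j \<Longrightarrow> j < n \<Longrightarrow> h \<in> Arr X \<Longrightarrow> Cod X h = Dom X u \<Longrightarrow> e \<in> Arr X \<Longrightarrow> Dom X e = Dom X h \<Longrightarrow>
      Cod X e = pw n \<Longrightarrow> prj n i \<cdot> e = v \<cdot> h \<Longrightarrow> prj n j \<cdot> e = a 1 \<cdot> (u \<cdot> h) \<Longrightarrow>
      pt n i e (\<xi> \<cdot> h) = pt n j e (u \<cdot> h)"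
proof -
  define c where "c = a 1"
  have c: "c \<in> Arr X" "Cod X c = Dom X p" using a_simps[of 1] unfolding c_def by simp_all
  define u v where uv: "u = pb1 X (p \<cdot> c) p" "v = pb2 X (p \<cdot> c) p"
  have pb: "is_pullback X (p \<cdot> c) p u v" unfolding uv by (rule pb_is_pullback) (use c in simp_all)
  have U: "u \<in> Arr X" "v \<in> Arr X" "Cod X u = Dom X c" "Dom X v = Dom X u" "Cod X v = Dom X p" "p \<cdot> v = p \<cdot> (c \<cdot> u)"
    using is_pullbackD[OF pb] c by simp_all
  obtain \<epsilon> where \<epsilon>: "\<epsilon> \<in> Arr X" "Dom X \<epsilon> = Dom X u" "Cod X \<epsilon> = pw 2" "leg 2 \<cdot> \<epsilon> = p \<cdot> v"
    and \<epsilon>2: "prj 2 0 \<cdot> \<epsilon> = v" "prj 2 1 \<cdot> \<epsilon> = c \<cdot> u"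
    using pow_pair[of v "c \<cdot> u"] U c by auto
  have el1: "elt (map_of_list [1] 2) \<epsilon> u"
    by (rule pt_elt) (use \<epsilon> \<epsilon>2 U in \<open>simp_all add: c_def\<close>)
  obtain \<xi> where \<xi>: "elt (map_of_list [0] 2) \<epsilon> \<xi>" "pt 2 0 \<epsilon> \<xi> = pt 2 1 \<epsilon> u"
    using push_surj[of "map_of_list [0] 2" "pt 2 1 \<epsilon> u" \<epsilon>] push_simps[OF el1] by auto
  have \<xi>': "\<xi> \<in> Arr X" "Dom X \<xi> = Dom X u" "Cod X \<xi> = Dom X c" "c \<cdot> \<xi> = v"
    using \<xi>(1) \<epsilon> \<epsilon>2(1) dg_point[of 0 2] unfolding elt_def c_def by simp_all
  have key: "pt n i e (\<xi> \<cdot> h) = pt n j e (u \<cdot> h)"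
    if ij: "i \<le> j" "j < n" and h: "h \<in> Arr X" "Cod X h = Dom X u" and e: "e \<in> Arr X" "Dom X e = Dom X h" "Cod X e = pw n"
      and pi: "prj n i \<cdot> e = v \<cdot> h" and pj: "prj n j \<cdot> e = c \<cdot> (u \<cdot> h)" for n i j e h
  proof -
    \<comment> \<open>The general case is the universal one pushed along the map with values i, j.
      This map is monotone only for i \<le> j, so the target of the action is listed before its
      source.\<close>
    define \<kappa> where "\<kappa> = map_of_list [i, j] n"
    have \<kappa>: "\<kappa> \<in> Arr Delta_dot" "src \<kappa> = 2" "tgt \<kappa> = n" "app \<kappa> 0 = i" "app \<kappa> 1 = j"
      unfolding \<kappa>_def using ij by simp_all
    have l: "leg 2 \<cdot> (dg \<kappa> \<cdot> e) = leg 2 \<cdot> (\<epsilon> \<cdot> h)"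
    proof -
      have "leg n \<cdot> e = p \<cdot> (prj n i \<cdot> e)" using ij e by simp
      also have "\<dots> = p \<cdot> (v \<cdot> h)" unfolding pi ..
      also have "\<dots> = leg 2 \<cdot> (\<epsilon> \<cdot> h)" using reassoc[OF \<epsilon>(4), of h] h \<epsilon>(1-3) U(1-5) by simp
      finally show ?thesis using \<kappa> e by simp
    qed
    have "dg \<kappa> \<cdot> e = \<epsilon> \<cdot> h"
    proof (rule pow_ext[OF l])
      fix k :: nat assume "k < 2"
      then consider "k = 0" | "k = 1" by linarith
      then show "prj 2 k \<cdot> dg \<kappa> \<cdot> e = prj 2 k \<cdot> \<epsilon> \<cdot> h"
      proof cases
        case 1
        have "prj 2 0 \<cdot> dg \<kappa> \<cdot> e = prj n i \<cdot> e" using \<kappa> e by simp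
        also have "\<dots> = prj 2 0 \<cdot> \<epsilon> \<cdot> h" unfolding pi using reassoc[OF \<epsilon>2(1)] \<epsilon> h by simp
        finally show ?thesis unfolding 1 .
      next
        case 2
        have "prj 2 1 \<cdot> dg \<kappa> \<cdot> e = prj n j \<cdot> e" using dg_reassoc(2)[OF \<kappa>(1), of e 2 1] \<kappa> e by simp
        also have "\<dots> = (c \<cdot> u) \<cdot> h" unfolding pj using c U h by simp
        also have "\<dots> = prj 2 1 \<cdot> \<epsilon> \<cdot> h" using reassoc[OF \<epsilon>2(2), of h] \<epsilon>(1-3) h by simp
        finally show ?thesis unfolding 2 .
      qed
    qed (use \<kappa> e \<epsilon> h in simp_all)
    then have d: "dg \<kappa> \<cdot> e = \<epsilon> \<cdot> h" .
    have "pt n i e (\<xi> \<cdot> h) = push \<kappa> e (pt 2 0 (\<epsilon> \<cdot> h) (\<xi> \<cdot> h))"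
      using push_pt[OF \<kappa>(1), of 0 e "\<xi> \<cdot> h"] \<kappa> e h \<xi>' pi reassoc[OF \<xi>'(4), of h] c unfolding d c_def by simp
    also have "pt 2 0 (\<epsilon> \<cdot> h) (\<xi> \<cdot> h) = pt 2 1 (\<epsilon> \<cdot> h) (u \<cdot> h)"
      using push_Cmp[OF \<xi>(1), of h] push_Cmp[OF el1, of h] \<xi>(2) h \<epsilon> by simp
    also have "push \<kappa> e (pt 2 1 (\<epsilon> \<cdot> h) (u \<cdot> h)) = pt n j e (u \<cdot> h)"
      using push_pt[OF \<kappa>(1), of 1 e "u \<cdot> h"] \<kappa> e h U pj unfolding d c_def by simp
    finally show ?thesis .
  qed
  have "action X p c u v \<xi>"
    unfolding action_def
  proof (intro conjI ballI impI c pb \<xi>'(4))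
    show "\<xi> \<in> hom X (Dom X u) (Dom X c)" using \<xi>' by simp
    fix h assume h: "h \<in> Arr X" "Cod X h = Dom X u" "v \<cdot> h = c \<cdot> u \<cdot> h"
    \<comment> \<open>The degenerate case i = j = 0: \<open>v \<cdot> h\<close> is both source and
      target, and the pair map collapses 2 to 1.\<close>
    have "pt 1 0 (v \<cdot> h) (\<xi> \<cdot> h) = pt 1 0 (v \<cdot> h) (u \<cdot> h)"
      by (rule key) (use h U c in simp_all)
    then show "\<xi> \<cdot> h = u \<cdot> h"
      by (rule pt_inj) (use h U c \<xi>' reassoc[OF \<xi>'(4), of h] in \<open>simp_all add: c_def\<close>)
  next
    fix h h' h'' assume h: "h \<in> Arr X" "Cod X h = Dom X u" and h': "h' \<in> Arr X" "Dom X h' = Dom X h" "Cod X h' = Dom X u"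
      and h'': "h'' \<in> Arr X" "Dom X h'' = Dom X h" "Cod X h'' = Dom X u"
      and e1: "u \<cdot> h' = \<xi> \<cdot> h" and e2: "u \<cdot> h'' = u \<cdot> h" and e3: "v \<cdot> h' = v \<cdot> h''"
    \<comment> \<open>The element over the ordinal 3 lists the final target, the intermediate point
      and the source. Over it \<open>h'\<close> uses the coordinates 0 and 1, \<open>h\<close> uses
      1 and 2, and \<open>h''\<close> uses 0 and 2.\<close>
    define w where "w i = (if i = 0 then v \<cdot> h' else if i = 1 then v \<cdot> h else c \<cdot> (u \<cdot> h))" for i :: nat
    have cuh': "c \<cdot> (u \<cdot> h') = v \<cdot> h" unfolding e1 using reassoc[OF \<xi>'(4), of h] h \<xi>' c by simp
    have pvh': "p \<cdot> (v \<cdot> h') = p \<cdot> (v \<cdot> h)"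
      using reassoc[OF U(6), of h'] cuh' U(1-5) c h' h by simp
    have pvh: "p \<cdot> (c \<cdot> (u \<cdot> h)) = p \<cdot> (v \<cdot> h)"
      using reassoc[OF U(6), of h] U(1-5) c h by simp
    have "w i \<in> Arr X \<and> Dom X (w i) = Dom X (p \<cdot> (v \<cdot> h)) \<and> Cod X (w i) = Dom X p \<and> p \<cdot> w i = p \<cdot> (v \<cdot> h)" for i
      unfolding w_def using U(1-5) c h h' pvh' pvh by simp
    moreover have pv: "p \<cdot> (v \<cdot> h) \<in> Arr X" "Cod X (p \<cdot> (v \<cdot> h)) = Cod X p" "Dom X (p \<cdot> (v \<cdot> h)) = Dom X h" using U(1-5) h by simp_all
    ultimately obtain e where e: "e \<in> Arr X" "Dom X e = Dom X h" "Cod X e = pw 3"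
        and "\<forall>i < 3. prj 3 i \<cdot> e = w i"
      using pow_lift[OF pv(1,2), of 3 w] unfolding pv(3) by blast
    then have e': "prj 3 0 \<cdot> e = v \<cdot> h'" "prj 3 1 \<cdot> e = v \<cdot> h" "prj 3 2 \<cdot> e = c \<cdot> (u \<cdot> h)" unfolding w_def by simp_all
    have "pt 3 0 e (\<xi> \<cdot> h') = pt 3 1 e (u \<cdot> h')"
      by (rule key) (use e e' h' cuh' in simp_all)
    also have "\<dots> = pt 3 1 e (\<xi> \<cdot> h)" unfolding e1 ..
    also have "\<dots> = pt 3 2 e (u \<cdot> h)"
      by (rule key) (use e e' h in simp_all)
    also have "\<dots> = pt 3 2 e (u \<cdot> h'')" unfolding e2 ..
    also have "\<dots> = pt 3 0 e (\<xi> \<cdot> h'')"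
      by (rule key[symmetric]) (use e e' h'' e2 e3 in simp_all)
    finally have eq: "pt 3 0 e (\<xi> \<cdot> h') = pt 3 0 e (\<xi> \<cdot> h'')" .
    have x': "c \<cdot> (\<xi> \<cdot> h') = v \<cdot> h'" "c \<cdot> (\<xi> \<cdot> h'') = v \<cdot> h''"
      using reassoc[OF \<xi>'(4)] h' h'' \<xi>' c by simp_all
    show "\<xi> \<cdot> h' = \<xi> \<cdot> h''"
      by (rule pt_inj[OF eq]) (use e e'(1) x' e3 h' h'' \<xi>' in \<open>simp_all add: c_def\<close>)
  qed
  then show thesis using that key unfolding c_def by blast
qed

end

section \<open>From effective actions to essential surjectivity\<close>

context descent
begin

text \<open>The action at the ordinal 1 yields \<open>f\<close> and \<open>q\<close>. Composing
  \<open>q\<close> with 0-th coordinates gives a cone, hence an arrow from \<alpha> to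
  \<open>K f\<close>, and the pullback property of the square inverts each of its
  components.\<close>

lemma actions_effective_imp_essentially_surjective:
  assumes eff: "actions_effective X p" and \<alpha>: "psn \<alpha>"
  shows "\<exists>f \<in> Obj XB. \<exists>i \<in> hom DC (K f) \<alpha>. iso DC i"
proof -
  interpret D: descent_data X p "ob \<alpha>" "tr \<alpha>" by (rule descent_dataI[OF psn_ddata[OF \<alpha>]])
  define c where "c = ob \<alpha> 1"
  have c: "c \<in> Arr X" "Cod X c = Dom X p" using D.a_simps[of 1] unfolding c_def by simp_all
  obtain u v \<xi> where act: "action X p c u v \<xi>"
    and key: "\<And>n i j e h. i \<le> j \<Longrightarrow> j < n \<Longrightarrow> h \<in> Arr X \<Longrightarrow> Cod X h = Dom X u \<Longrightarrow> e \<in> Arr X \<Longrightarrow> Dom X e = Dom X h \<Longrightarrow>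
      Cod X e = pw n \<Longrightarrow> prj n i \<cdot> e = v \<cdot> h \<Longrightarrow> prj n j \<cdot> e = c \<cdot> (u \<cdot> h) \<Longrightarrow>
      D.pt n i e (\<xi> \<cdot> h) = D.pt n j e (u \<cdot> h)"
    using D.exists_action unfolding c_def by blast
  note A = actionD[OF act]
  obtain f q where pb: "is_pullback X p f c q" and q\<xi>: "q \<cdot> \<xi> = q \<cdot> u"
    using eff act unfolding actions_effective_def by blast
  note P = is_pullbackD[OF pb]
  have f: "f \<in> Arr X" "Cod X f = Cod X p" using P by auto
  have q: "q \<in> Arr X" "Dom X q = Dom X c" "Cod X q = Dom X f" "f \<cdot> q = p \<cdot> c" using P by auto
  \<comment> \<open>\<open>x n\<close> is the 0-th coordinate of the universal element of
    \<open>ob \<alpha> n\<close>; it exists because transport along the point 0 is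
    surjective.\<close>
  have "\<forall>n. \<exists>x. n \<noteq> 0 \<longrightarrow> D.elt (map_of_list [0] n) (ob \<alpha> n) x \<and> D.pt n 0 (ob \<alpha> n) x = Ide X (Dom X (ob \<alpha> n))"
  proof
    fix n :: nat
    show "\<exists>x. n \<noteq> 0 \<longrightarrow> D.elt (map_of_list [0] n) (ob \<alpha> n) x \<and> D.pt n 0 (ob \<alpha> n) x = Ide X (Dom X (ob \<alpha> n))"
    proof (cases "n = 0")
      case False
      then show ?thesis using D.push_surj[of "map_of_list [0] n" "Ide X (Dom X (ob \<alpha> n))" "ob \<alpha> n"] D.a_simps[of n] by auto
    qed simp
  qed
  then obtain x where el: "\<And>n. n \<noteq> 0 \<Longrightarrow> D.elt (map_of_list [0] n) (ob \<alpha> n) (x n)"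
    and ptx: "\<And>n. n \<noteq> 0 \<Longrightarrow> D.pt n 0 (ob \<alpha> n) (x n) = Ide X (Dom X (ob \<alpha> n))" by metis
  have x: "x n \<in> Arr X" "Dom X (x n) = Dom X (ob \<alpha> n)" "Cod X (x n) = Dom X c" "c \<cdot> x n = prj n 0 \<cdot> ob \<alpha> n"
    if "n \<noteq> 0" for n
    using el[OF that] dg_point[of 0 n] that unfolding D.elt_def c_def by simp_all
  have xy: "D.pt n 0 (ob \<alpha> n \<cdot> y) (x n \<cdot> y) = y" if "n \<noteq> 0" "y \<in> Arr X" "Cod X y = Dom X (ob \<alpha> n)" for n y
    using D.push_Cmp[OF el[OF that(1)], of y] ptx[OF that(1)] that D.a_simps[OF that(1)] by simp
  have cxy: "c \<cdot> (x n \<cdot> y) = prj n 0 \<cdot> (ob \<alpha> n \<cdot> y)" if "n \<noteq> 0" "y \<in> Arr X" "Cod X y = Dom X (ob \<alpha> n)" for n y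
    using reassoc[OF x(4)[OF that(1)], of y] x[OF that(1)] c that D.a_simps[OF that(1)] by simp
  have cone: "cone \<alpha> f (\<lambda>n. q \<cdot> x n)"
    unfolding cone_def
  proof (intro conjI allI impI)
    fix n :: nat assume n: "n \<noteq> 0"
    show "q \<cdot> x n \<in> Arr X" "Dom X (q \<cdot> x n) = Dom X (ob \<alpha> n)" "Cod X (q \<cdot> x n) = Dom X f" "f \<cdot> q \<cdot> x n = leg n \<cdot> ob \<alpha> n"
      using x[OF n] q f c n D.a_simps[OF n] reassoc[OF q(4), of "x n"] by simp_all
  next
    fix \<phi> e z assume ez: "D.elt \<phi> e z"
    note e = ez[unfolded D.elt_def]
    have st: "src \<phi> \<noteq> 0" "tgt \<phi> \<noteq> 0" using e by auto
    let ?m = "src \<phi>" and ?n = "tgt \<phi>"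
    define y where "y = D.push \<phi> e z"
    have y: "y \<in> Arr X" "Dom X y = Dom X e" "Cod X y = Dom X (ob \<alpha> ?n)" "ob \<alpha> ?n \<cdot> y = e"
      using D.push_simps[OF ez] unfolding y_def by simp_all
    define z' where "z' = x ?m \<cdot> z"
    have z': "z' \<in> Arr X" "Dom X z' = Dom X e" "Cod X z' = Dom X c" "c \<cdot> z' = prj ?n (app \<phi> 0) \<cdot> e"
      using x[OF st(1)] e cxy[OF st(1), of z] st unfolding z'_def by simp_all
    have t: "app \<phi> 0 < ?n" using e by simp
    have "D.pt ?m 0 (dg \<phi> \<cdot> e) z' = z" using xy[OF st(1), of z] e unfolding z'_def by simp
    then have y1: "y = D.pt ?n (app \<phi> 0) e z'"
      using D.push_pt[of \<phi> 0 e z'] e z' unfolding y_def c_def by simp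
    have "(p \<cdot> c) \<cdot> z' = p \<cdot> (prj ?n 0 \<cdot> e)"
      using z' c e t st by simp
    then obtain h where h: "h \<in> Arr X" "Dom X h = Dom X e" "Cod X h = Dom X u" "u \<cdot> h = z'" "v \<cdot> h = prj ?n 0 \<cdot> e"
      using is_pullback_lift[OF A(3), of z' "prj ?n 0 \<cdot> e"] z' c e st by auto
    \<comment> \<open>Since 0 \<le> \<phi>(0), the clause \<open>key\<close> applies to these two
      coordinates; this is the reason for working with coordinate 0. So the 0-th coordinate of
      \<open>y\<close> arises from \<open>z'\<close> by the action, and \<open>q\<close> does not
      distinguish them.\<close>
    have "D.pt ?n 0 e (\<xi> \<cdot> h) = y"
      unfolding y1 h(4)[symmetric] by (rule key) (use h z' e t in simp_all)
    moreover have "D.pt ?n 0 e (x ?n \<cdot> y) = y" using xy[OF st(2) y(1,3)] y by simp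
    ultimately have eq: "D.pt ?n 0 e (\<xi> \<cdot> h) = D.pt ?n 0 e (x ?n \<cdot> y)" by simp
    have c\<xi>: "c \<cdot> (\<xi> \<cdot> h) = prj ?n 0 \<cdot> e" using reassoc[OF A(7), of h] A h by simp
    have \<xi>h: "\<xi> \<cdot> h = x ?n \<cdot> y"
      by (rule D.pt_inj[OF eq]) (use st e h A(4-6) c\<xi> cxy[OF st(2) y(1,3)] x[OF st(2)] y in \<open>simp_all add: c_def\<close>)
    have "q \<cdot> (x ?n \<cdot> y) = q \<cdot> (u \<cdot> h)"
      unfolding \<xi>h[symmetric] using reassoc[OF q\<xi>, of h] A is_pullbackD[OF A(3)] q h by simp
    also have "\<dots> = q \<cdot> (x ?m \<cdot> z)" unfolding h(4) z'_def ..
    finally show "(q \<cdot> x ?n) \<cdot> D.push \<phi> e z = (q \<cdot> x ?m) \<cdot> z"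
      unfolding y_def[symmetric] using x[OF st(1)] x[OF st(2)] q y e by simp
  qed
  define g where "g n = pb_lift X (leg n) f (ob \<alpha> n) (q \<cdot> x n)" for n
  have dm: "dmor (ob \<alpha>) (tr \<alpha>) (ob (K f)) (tr (K f)) g"
    using cone_dmor[OF \<alpha> f cone] unfolding g_def .
  have "iso X (g n)" if n: "n \<noteq> 0" for n
  proof -
    note C = coneD[OF cone n]
    have g: "g n \<in> Arr X" "Dom X (g n) = Dom X (ob \<alpha> n)" "Cod X (g n) = Dom X (pb1 X (leg n) f)"
      "pb1 X (leg n) f \<cdot> g n = ob \<alpha> n" "pb2 X (leg n) f \<cdot> g n = q \<cdot> x n"
      unfolding g_def using C f D.a_simps[OF n] by simp_all
    define e where "e = pb1 X (leg n) f"
    have e: "e \<in> Arr X" "Cod X e = pw n" unfolding e_def using f by simp_all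
    have z: "pb2 X (leg n) f \<in> Arr X" "Dom X (pb2 X (leg n) f) = Dom X e" "Cod X (pb2 X (leg n) f) = Dom X f"
      "f \<cdot> pb2 X (leg n) f = leg n \<cdot> e" unfolding e_def using f by simp_all
    \<comment> \<open>Construction of the inverse of \<open>g n\<close>: through the square p c = f
      q, an element of the pullback of \<open>f\<close> along \<open>leg n\<close> acquires a 0-th
      coordinate \<open>w\<close> in the domain of \<open>c\<close>, which is then transported to n
      along the point 0.\<close>
    obtain w where w: "w \<in> Arr X" "Dom X w = Dom X e" "Cod X w = Dom X c" "c \<cdot> w = prj n 0 \<cdot> e" "q \<cdot> w = pb2 X (leg n) f"
      using is_pullback_lift[OF pb, of "prj n 0 \<cdot> e" "pb2 X (leg n) f"] z e n by auto
    have ew: "D.elt (map_of_list [0] n) e w"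
      by (rule D.pt_elt) (use n e w in \<open>simp_all add: c_def\<close>)
    define k where "k = D.pt n 0 e w"
    have k: "k \<in> Arr X" "Dom X k = Dom X e" "Cod X k = Dom X (ob \<alpha> n)" "ob \<alpha> n \<cdot> k = e"
      using D.push_simps[OF ew] unfolding k_def by simp_all
    have "D.pt n 0 e (x n \<cdot> k) = D.pt n 0 e w"
      using xy[OF n k(1,3)] k unfolding k_def by simp
    then have xk: "x n \<cdot> k = w"
      by (rule D.pt_inj) (use n e x[OF n] k w cxy[OF n k(1,3)] in \<open>simp_all add: c_def\<close>)
    have gk: "g n \<cdot> k = Ide X (Dom X e)"
      by (rule pb_ext[of "leg n" f])
        (use g k f e z x[OF n] q w(5) xk reassoc[OF g(4)] reassoc[OF g(5)] in \<open>simp_all add: e_def[symmetric]\<close>)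
    have qw: "q \<cdot> (w \<cdot> g n) = q \<cdot> x n"
      using reassoc[OF w(5), of "g n"] w g q e_def by simp
    have cw: "c \<cdot> (w \<cdot> g n) = c \<cdot> x n"
      using reassoc[OF w(4), of "g n"] w g c e n x(4)[OF n] by (simp add: e_def)
    have wg: "w \<cdot> g n = x n"
      by (rule is_pullback_ext[OF pb]) (use qw cw w g x[OF n] e_def in simp_all)
    have "k \<cdot> g n = D.pt n 0 (e \<cdot> g n) (w \<cdot> g n)"
      unfolding k_def by (rule D.push_Cmp[OF ew]) (use g e_def in simp_all)
    also have "\<dots> = Ide X (Dom X (ob \<alpha> n))" using ptx[OF n] g unfolding wg e_def by simp
    finally show ?thesis using gk g k by (intro isoI[of "g n" k]) (simp_all add: e_def)
  qed
  then have i: "iso DC (\<alpha>, mk_mod (ob \<alpha>) (ob (K f)) g, K f)"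
    using iso_DC[OF \<alpha> psn_K[OF f] dm] by blast
  obtain j where "j \<in> Arr DC" "Dom DC j = K f" "Cod DC j = \<alpha>" "iso DC j"
    using category.isoE[OF category_DC i] by (metis DC_simps(3,4))
  then show ?thesis using f by (intro bexI[of _ f] bexI[of _ j]) simp_all
qed

end

context pb_category
begin

text \<open>The two halves of being an equivalence are treated separately: full faithfulness of the
  comparison matches \<open>coequalizing\<close>, and essential surjectivity matches
  \<open>actions_effective\<close>.\<close>

theorem effective_descent_iff:
  "effective_descent X p \<longleftrightarrow> p \<in> Arr X \<and> coequalizing X p \<and> actions_effective X p"
proof (cases "p \<in> Arr X")
  case True
  interpret descent X p by unfold_locales fact
  show ?thesis
  proof
    assume "effective_descent X p"
    then have eq: "is_equivalence XB DC CF"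
      unfolding effective_descent_def by blast
    show "p \<in> Arr X \<and> coequalizing X p \<and> actions_effective X p"
      using True fully_faithful_imp_coequalizing[OF equivalence_fully_faithful[OF eq]]
        equivalence_imp_actions_effective[OF eq] by blast
  next
    assume a: "p \<in> Arr X \<and> coequalizing X p \<and> actions_effective X p"
    have "is_equivalence XB DC CF"
    proof (rule fully_faithful_essentially_surjective)
      show "fully_faithful XB DC CF"
        using coequalizing_imp_fully_faithful a by blast
      fix \<alpha> assume "\<alpha> \<in> Obj DC"
      then show "\<exists>f\<in>Obj XB. \<exists>i\<in>hom DC (FOb CF f) \<alpha>. iso DC i"
        using actions_effective_imp_essentially_surjective[of \<alpha>] a unfolding comparison_FOb by simp
    qed
    then show "effective_descent X p" unfolding effective_descent_def using True by blast
  qed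
qed (simp add: effective_descent_def)

theorem descent_morphism_iff: "descent_morphism X p \<longleftrightarrow> p \<in> Arr X \<and> coequalizing X p"
proof (cases "p \<in> Arr X")
  case True
  interpret descent X p by unfold_locales fact
  show ?thesis
    unfolding descent_morphism_def
    using True fully_faithful_imp_coequalizing coequalizing_imp_fully_faithful by blast
qed (simp add: descent_morphism_def)

end

section \<open>Preservation by functors\<close>

context category
begin

text \<open>Every pair identified by \<open>a\<close> factors through the given kernel pair.
  Compatibility thus becomes a single equation, which functors preserve.\<close>

lemma compat_iff:
  assumes pb: "is_pullback C a a k l" and v: "v \<in> Arr C" "Dom C v = Dom C a"
  shows "compat C a v \<longleftrightarrow> v \<cdot> k = v \<cdot> l"
proof
  have P: "k \<in> Arr C" "l \<in> Arr C" "Dom C l = Dom C k" "Cod C k = Dom C a" "Cod C l = Dom C a" "a \<cdot> l = a \<cdot> k"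
    using is_pullbackD[OF pb] by blast+
  assume co: "compat C a v"
  show "v \<cdot> k = v \<cdot> l"
    by (rule co[unfolded compat_def, rule_format]) (use P in simp_all)
next
  note P = is_pullbackD[OF pb]
  assume vkl: "v \<cdot> k = v \<cdot> l"
  show "compat C a v"
    unfolding compat_def
  proof (intro ballI impI)
    fix s t assume st: "s \<in> Arr C" "t \<in> Arr C" "Dom C s = Dom C t" "Cod C s = Dom C a" "Cod C t = Dom C a" "a \<cdot> s = a \<cdot> t"
    obtain h where h: "h \<in> Arr C" "Dom C h = Dom C s" "Cod C h = Dom C k" "k \<cdot> h = s" "l \<cdot> h = t"
      by (rule is_pullback_lift[OF pb, of s t]) (use st in auto)
    have "v \<cdot> s = (v \<cdot> k) \<cdot> h" using h v P by simp
    also have "\<dots> = (v \<cdot> l) \<cdot> h" unfolding vkl ..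
    also have "\<dots> = v \<cdot> t" using h v P by simp
    finally show "v \<cdot> s = v \<cdot> t" .
  qed
qed

text \<open>Two elements \<open>s, t\<close> of \<open>C\<close> with the same image under \<open>q\<close> are related by the action:
  \<open>t = \<xi>(s, c t)\<close>.\<close>

lemma action_compat:
  assumes act: "action C p c u v \<xi>" and pb: "is_pullback C p f c q" and q: "q \<cdot> \<xi> = q \<cdot> u"
    and r: "r \<in> Arr C" "Dom C r = Dom C c" "r \<cdot> \<xi> = r \<cdot> u"
  shows "compat C q r"
  unfolding compat_def
proof (intro ballI impI)
  note A = actionD[OF act] and P = is_pullbackD[OF pb]
  have U: "u \<in> Arr C" "Cod C u = Dom C c" using is_pullbackD[OF A(3)] A(1,2) P(1) by simp_all
  fix s t assume st: "s \<in> Arr C" "t \<in> Arr C" "Dom C s = Dom C t" "Cod C s = Dom C q" "Cod C t = Dom C q" "q \<cdot> s = q \<cdot> t"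
  have st': "Cod C s = Dom C c" "Cod C t = Dom C c" using st P by simp_all
  have "f \<cdot> (q \<cdot> s) = f \<cdot> (q \<cdot> t)" unfolding st(6) ..
  then have "(p \<cdot> c) \<cdot> s = p \<cdot> (c \<cdot> t)"
    using P(1-8) st(1-3) st' reassoc[OF P(9), of s] reassoc[OF P(9), of t] by simp
  then obtain h where h: "h \<in> Arr C" "Dom C h = Dom C s" "Cod C h = Dom C u" "u \<cdot> h = s" "v \<cdot> h = c \<cdot> t"
    using is_pullback_lift[OF A(3), of s "c \<cdot> t"] st(1-3) st' A(1,2) P(1) by auto
  have "\<xi> \<cdot> h = t"
  proof (rule is_pullback_ext[OF pb])
    show "c \<cdot> \<xi> \<cdot> h = c \<cdot> t" using reassoc[OF A(7), of h] A(1,4-6) h by simp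
    show "q \<cdot> \<xi> \<cdot> h = q \<cdot> t"
      using reassoc[OF q, of h] A(4-6) h(1-4) P(4-8) U st(6) by simp
  qed (use h A(4-6) st(1-3) st' in simp_all)
  then show "r \<cdot> s = r \<cdot> t"
    using reassoc[OF r(3), of h] A(4-6) h(1-4) r(1,2) U by simp
qed

text \<open>By \<open>action_compat\<close> each of \<open>q\<close> and \<open>q'\<close> factors
  through the other, and the two comparisons are mutually inverse because \<open>q\<close> and
  \<open>q'\<close> are epimorphic over the base.\<close>

lemma action_presentations_iso:
  assumes co: "coequalizing C p" and act: "action C p c u v \<xi>"
    and pb: "is_pullback C p f c q" and q: "q \<cdot> \<xi> = q \<cdot> u"
    and pb': "is_pullback C p f' c q'" and q': "q' \<cdot> \<xi> = q' \<cdot> u"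
  shows "\<exists>\<theta>. iso C \<theta> \<and> Dom C \<theta> = Dom C f \<and> Cod C \<theta> = Dom C f' \<and> f' \<cdot> \<theta> = f \<and> \<theta> \<cdot> q = q'"
proof -
  note P = is_pullbackD[OF pb] and P' = is_pullbackD[OF pb']
  have "compat C q q'" by (rule action_compat[OF act pb q]) (use P' q' in simp_all)
  then obtain \<theta> where t: "\<theta> \<in> Arr C" "Dom C \<theta> = Dom C f" "Cod C \<theta> = Dom C f'" "f' \<cdot> \<theta> = f" "\<theta> \<cdot> q = q'"
    using coequalizingD(1)[OF co pb, of f' q'] P P' by auto
  have "compat C q' q" by (rule action_compat[OF act pb' q']) (use P q in simp_all)
  then obtain \<zeta> where z: "\<zeta> \<in> Arr C" "Dom C \<zeta> = Dom C f'" "Cod C \<zeta> = Dom C f" "f \<cdot> \<zeta> = f'" "\<zeta> \<cdot> q' = q"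
    using coequalizingD(1)[OF co pb', of f q] P P' by auto
  have 1: "\<zeta> \<cdot> \<theta> = Ide C (Dom C f)"
    by (rule coequalizing_epi[OF co pb, of f])
      (use P(1-8) P'(1-8) t z reassoc[OF z(4), of \<theta>] in simp_all)
  have 2: "\<theta> \<cdot> \<zeta> = Ide C (Dom C f')"
    by (rule coequalizing_epi[OF co pb', of f'])
      (use P(1-8) P'(1-8) t z reassoc[OF t(4), of \<zeta>] in simp_all)
  have "iso C \<theta>" by (rule isoI[of _ \<zeta>]) (use t z 1 2 in simp_all)
  then show ?thesis using t by blast
qed

text \<open>Used to replace the object found in C or D by the isomorphic image of an object of
  B.\<close>

lemma is_pullback_iso_base:
  assumes pb: "is_pullback C p f c q" and s: "s \<in> Arr C" "s' \<in> Arr C" "Cod C s = Dom C f" "Dom C s' = Dom C f"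
    "Cod C s' = Dom C s" "s' \<cdot> s = Ide C (Dom C s)" "s \<cdot> s' = Ide C (Dom C f)"
  shows "is_pullback C p (f \<cdot> s) c (s' \<cdot> q)"
proof -
  note P = is_pullbackD[OF pb]
  have sq: "s \<cdot> (s' \<cdot> y) = y" if "y \<in> Arr C" "Cod C y = Dom C f" for y
    using reassoc[OF s(7), of y] s(1-5) that by simp
  have sq': "s' \<cdot> (s \<cdot> y) = y" if "y \<in> Arr C" "Cod C y = Dom C s" for y
    using reassoc[OF s(6), of y] s(1-5) that by simp
  show ?thesis
  proof (rule is_pullbackI)
    fix x t assume xt: "x \<in> Arr C" "t \<in> Arr C" "Dom C t = Dom C x" "Cod C x = Dom C p" "Cod C t = Dom C (f \<cdot> s)"
      "p \<cdot> x = (f \<cdot> s) \<cdot> t"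
    obtain h where "h \<in> Arr C" "Dom C h = Dom C x" "Cod C h = Dom C c" "c \<cdot> h = x" "q \<cdot> h = s \<cdot> t"
      by (rule is_pullback_lift[OF pb, of x "s \<cdot> t"]) (use xt s(1-5) P(1-8) in auto)
    then show "\<exists>h\<in>Arr C. Dom C h = Dom C x \<and> Cod C h = Dom C c \<and> c \<cdot> h = x \<and> (s' \<cdot> q) \<cdot> h = t"
      using xt s(1-5) P(1-8) sq' by (intro bexI[of _ h]) simp_all
  next
    fix h k assume hk: "h \<in> Arr C" "k \<in> Arr C" "Dom C k = Dom C h" "Cod C h = Dom C c" "Cod C k = Dom C c"
      "c \<cdot> h = c \<cdot> k" "(s' \<cdot> q) \<cdot> h = (s' \<cdot> q) \<cdot> k"
    have "s \<cdot> ((s' \<cdot> q) \<cdot> h) = s \<cdot> ((s' \<cdot> q) \<cdot> k)" unfolding hk(7) ..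
    then have qq: "q \<cdot> h = q \<cdot> k" using hk(1-5) s(1-5) P(1-8) sq by simp
    show "h = k" by (rule is_pullback_ext[OF pb]) (use hk(1-6) qq in simp_all)
  qed (use P s(1-5) sq in simp_all)
qed

text \<open>Isomorphic cospans have isomorphic pullbacks; only the domain of \<open>y\<close> stays
  in place. Taking components of \<sigma> for \<open>b\<close>, \<open>e\<close> and
  \<open>d\<close> moves the image under G of a square over Z p to a square over F S p.\<close>

lemma is_pullback_transport:
  assumes pb: "is_pullback C x y m n"
    and P: "p \<in> Arr C" "c \<in> Arr C" "Cod C c = Dom C p"
    and b: "b \<in> Arr C" "b' \<in> Arr C" "Dom C b = Cod C p" "Cod C b = Cod C x" "Dom C b' = Cod C x" "Cod C b' = Cod C p"
      "b' \<cdot> b = Ide C (Cod C p)" "b \<cdot> b' = Ide C (Cod C x)"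
    and e: "iso C e" "Dom C e = Dom C p" "Cod C e = Dom C x" "x \<cdot> e = b \<cdot> p"
    and d: "iso C d" "Dom C d = Dom C c" "Cod C d = Dom C m" "m \<cdot> d = e \<cdot> c"
  shows "is_pullback C p (b' \<cdot> y) c (n \<cdot> d)"
proof -
  note Q = is_pullbackD[OF pb]
  have ea: "e \<in> Arr C" and da: "d \<in> Arr C" using e d isoE by metis+
  obtain d' where d': "d' \<in> Arr C" "Dom C d' = Dom C m" "Cod C d' = Dom C c" "d \<cdot> d' = Ide C (Dom C m)"
    using isoE[OF d(1)] d(2,3) by metis
  have dd: "d \<cdot> (d' \<cdot> z) = z" if "z \<in> Arr C" "Cod C z = Dom C m" for z
    using reassoc[OF d'(4), of z] da d d' that by simp
  have bb: "b \<cdot> (b' \<cdot> z) = z" if "z \<in> Arr C" "Cod C z = Cod C x" for z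
    using reassoc[OF b(8), of z] b(1-6) that by simp
  have bb': "b' \<cdot> (b \<cdot> z) = z" if "z \<in> Arr C" "Cod C z = Cod C p" for z
    using reassoc[OF b(7), of z] b(1-6) that by simp
  have md: "m \<cdot> (d \<cdot> z) = e \<cdot> (c \<cdot> z)" if "z \<in> Arr C" "Cod C z = Dom C c" for z
    using reassoc[OF d(4), of z] da d(2,3) Q(1-8) that e ea P by simp
  have xe: "x \<cdot> (e \<cdot> z) = b \<cdot> (p \<cdot> z)" if "z \<in> Arr C" "Cod C z = Dom C p" for z
    using reassoc[OF e(4), of z] ea e(2,3) Q(1-8) that b(1-6) P by simp
  show ?thesis
  proof (rule is_pullbackI)
    have "y \<cdot> (n \<cdot> d) = b \<cdot> (p \<cdot> c)"
      using reassoc[OF Q(9), of d] Q(1-8) da d xe[of c] P by simp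
    then show "p \<cdot> c = (b' \<cdot> y) \<cdot> (n \<cdot> d)"
      using bb'[of "p \<cdot> c"] Q(1-8) da d P b(1-6) by simp
    fix s t assume st: "s \<in> Arr C" "t \<in> Arr C" "Dom C t = Dom C s" "Cod C s = Dom C p" "Cod C t = Dom C (b' \<cdot> y)"
      "p \<cdot> s = (b' \<cdot> y) \<cdot> t"
    have t': "Cod C t = Dom C y" using st(5) b Q by simp
    have "x \<cdot> (e \<cdot> s) = b \<cdot> ((b' \<cdot> y) \<cdot> t)" using xe[of s] st by simp
    also have "\<dots> = y \<cdot> t" using bb[of "y \<cdot> t"] st(1-4) t' b(1-6) Q(1-8) by simp
    finally have xy: "x \<cdot> (e \<cdot> s) = y \<cdot> t" .
    obtain h where h: "h \<in> Arr C" "Dom C h = Dom C s" "Cod C h = Dom C m" "m \<cdot> h = e \<cdot> s" "n \<cdot> h = t"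
      using is_pullback_lift[OF pb, of "e \<cdot> s" t] st(1-4) t' ea e(2,3) xy by auto
    have "e \<cdot> (c \<cdot> (d' \<cdot> h)) = e \<cdot> s"
      using md[of "d' \<cdot> h"] dd[of h] h d' by simp
    then have "c \<cdot> (d' \<cdot> h) = s"
      using iso_cancel[OF e(1), of "c \<cdot> (d' \<cdot> h)" s] P h d' st(1-4) e(2) by simp
    then show "\<exists>h\<in>Arr C. Dom C h = Dom C s \<and> Cod C h = Dom C c \<and> c \<cdot> h = s \<and> (n \<cdot> d) \<cdot> h = t"
      using h d' da d(2,3) dd Q(1-8) by (intro bexI[of _ "d' \<cdot> h"]) simp_all
  next
    fix h k assume hk: "h \<in> Arr C" "k \<in> Arr C" "Dom C k = Dom C h" "Cod C h = Dom C c" "Cod C k = Dom C c"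
      "c \<cdot> h = c \<cdot> k" "(n \<cdot> d) \<cdot> h = (n \<cdot> d) \<cdot> k"
    have "d \<cdot> h = d \<cdot> k"
      by (rule is_pullback_ext[OF pb]) (use hk da d(2,3) md Q(1-8) in simp_all)
    then show "h = k" using iso_cancel[OF d(1), of h k] hk(1-5) d(2) by simp
  qed (use P b(1-6) Q(1-8) da d(2,3) in simp_all)
qed

end

text \<open>The functor preserves a kernel pair of \<open>a\<close>, on which compatibility is one
  equation by \<open>compat_iff\<close>.\<close>

lemma functor_compat:
  assumes X: "pb_category X" and FX: "is_functor X Y F" "preserves_pullbacks X Y F"
    and co: "compat X a v" "a \<in> Arr X" "v \<in> Arr X" "Dom X v = Dom X a"
  shows "compat Y (FAr F a) (FAr F v)"
proof -
  interpret X: pb_category X by fact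
  note F = is_functorD[OF FX(1)]
  interpret Y: category Y by (fact F(2))
  obtain k l where kl: "is_pullback X a a k l" using X.pb_is_pullback[of a a] co(2) by auto
  note P = X.is_pullbackD[OF kl]
  have pbF: "is_pullback Y (FAr F a) (FAr F a) (FAr F k) (FAr F l)"
    using FX(2) kl unfolding preserves_pullbacks_def by blast
  have "v \<cdot>\<^bsub>X\<^esub> k = v \<cdot>\<^bsub>X\<^esub> l" using X.compat_iff[OF kl co(3,4)] co(1) by simp
  then have "FAr F v \<cdot>\<^bsub>Y\<^esub> FAr F k = FAr F v \<cdot>\<^bsub>Y\<^esub> FAr F l"
    using F(8)[of k v] F(8)[of l v] P co by simp
  then show ?thesis using Y.compat_iff[OF pbF, of "FAr F v"] F(4-6) co by simp
qed

text \<open>Unit and associativity hold as soon as they hold for the universal elements, which are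
  described by pullbacks.\<close>

lemma functor_action:
  assumes X: "pb_category X" and FX: "is_functor X Y F" "preserves_pullbacks X Y F"
    and act: "action X p c u v \<xi>"
  shows "action Y (FAr F p) (FAr F c) (FAr F u) (FAr F v) (FAr F \<xi>)"
proof -
  interpret X: pb_category X by fact
  note F = is_functorD[OF FX(1)]
  interpret Y: category Y by (fact F(2))
  note A = actionD[OF act] and U0 = X.is_pullbackD[OF actionD(3)[OF act]]
  have p: "p \<in> Arr X" using U0 by simp
  have U: "u \<in> Arr X" "v \<in> Arr X" "Dom X v = Dom X u" "Cod X u = Dom X c" "Cod X v = Dom X p" "p \<cdot>\<^bsub>X\<^esub> v = p \<cdot>\<^bsub>X\<^esub> (c \<cdot>\<^bsub>X\<^esub> u)"
    using U0 A(1,2) p by simp_all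
  have pb: "is_pullback Y (FAr F p \<cdot>\<^bsub>Y\<^esub> FAr F c) (FAr F p) (FAr F u) (FAr F v)"
    using FX(2) A(3) F(8)[of c p] A(1,2) p unfolding preserves_pullbacks_def by metis
  note Fs = F(4-6)[OF p] F(4-6)[OF A(1)] F(4-6)[OF U(1)] F(4-6)[OF U(2)] F(4-6)[OF A(4)]
  have c\<xi>: "FAr F c \<cdot>\<^bsub>Y\<^esub> FAr F \<xi> = FAr F v" using F(8)[of \<xi> c] A by simp
  show ?thesis
    unfolding action_def
  proof (intro conjI ballI impI pb c\<xi>)
    show "FAr F c \<in> Arr Y" "Cod Y (FAr F c) = Dom Y (FAr F p)" "FAr F \<xi> \<in> hom Y (Dom Y (FAr F u)) (Dom Y (FAr F c))"
      using Fs A by simp_all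
  next
    fix h assume h: "h \<in> Arr Y" "Cod Y h = Dom Y (FAr F u)" "FAr F v \<cdot>\<^bsub>Y\<^esub> h = FAr F c \<cdot>\<^bsub>Y\<^esub> FAr F u \<cdot>\<^bsub>Y\<^esub> h"
    \<comment> \<open>The universal element for the unit law is \<open>d\<close> = (x, c x). Any
      \<open>h\<close> satisfying the premise equals the image of \<open>d\<close> precomposed with
      the first coordinate of \<open>h\<close>.\<close>
    obtain d where d: "d \<in> Arr X" "Dom X d = Dom X c" "Cod X d = Dom X u" "u \<cdot>\<^bsub>X\<^esub> d = Ide X (Dom X c)" "v \<cdot>\<^bsub>X\<^esub> d = c"
      by (rule X.is_pullback_lift[OF A(3), of "Ide X (Dom X c)" c]) (use A p in auto)
    have \<xi>d: "\<xi> \<cdot>\<^bsub>X\<^esub> d = Ide X (Dom X c)" using action_unit[OF act, of d] d A by simp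
    have e: "FAr F u \<cdot>\<^bsub>Y\<^esub> FAr F d = Ide Y (FOb F (Dom X c))" "FAr F v \<cdot>\<^bsub>Y\<^esub> FAr F d = FAr F c"
      "FAr F \<xi> \<cdot>\<^bsub>Y\<^esub> FAr F d = Ide Y (FOb F (Dom X c))"
      using F(8)[of d u] F(8)[of d v] F(8)[of d \<xi>] F(7)[of "Dom X c"] U A d \<xi>d by simp_all
    note Fd = F(4-6)[OF d(1)]
    have hd: "h = FAr F d \<cdot>\<^bsub>Y\<^esub> (FAr F u \<cdot>\<^bsub>Y\<^esub> h)"
      by (rule Y.is_pullback_ext[OF pb])
        (use h Fs Fd d(2,3) A U Y.reassoc[OF e(1), of "FAr F u \<cdot>\<^bsub>Y\<^esub> h"] Y.reassoc[OF e(2), of "FAr F u \<cdot>\<^bsub>Y\<^esub> h"] in simp_all)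
    have "FAr F \<xi> \<cdot>\<^bsub>Y\<^esub> (FAr F d \<cdot>\<^bsub>Y\<^esub> (FAr F u \<cdot>\<^bsub>Y\<^esub> h)) = FAr F u \<cdot>\<^bsub>Y\<^esub> h"
      using h(1,2) Fs Fd d(2,3) A(5,6) U(1-5) Y.reassoc[OF e(3), of "FAr F u \<cdot>\<^bsub>Y\<^esub> h"] by simp
    then show "FAr F \<xi> \<cdot>\<^bsub>Y\<^esub> h = FAr F u \<cdot>\<^bsub>Y\<^esub> h" unfolding hd[symmetric] .
  next
    fix h h' h''
    assume h: "h \<in> Arr Y" "Cod Y h = Dom Y (FAr F u)" and h': "h' \<in> Arr Y" "Dom Y h' = Dom Y h" "Cod Y h' = Dom Y (FAr F u)"
      and h'': "h'' \<in> Arr Y" "Dom Y h'' = Dom Y h" "Cod Y h'' = Dom Y (FAr F u)"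
      and e1: "FAr F u \<cdot>\<^bsub>Y\<^esub> h' = FAr F \<xi> \<cdot>\<^bsub>Y\<^esub> h" and e2: "FAr F u \<cdot>\<^bsub>Y\<^esub> h'' = FAr F u \<cdot>\<^bsub>Y\<^esub> h"
      and e3: "FAr F v \<cdot>\<^bsub>Y\<^esub> h' = FAr F v \<cdot>\<^bsub>Y\<^esub> h''"
    \<comment> \<open>This pullback classifies triples (x, e, e'); over it \<open>m\<close> is
      (\<xi>(x, e), e') and \<open>n\<close> is (x, e'). Its image classifies the triples in Y, so
      \<open>h'\<close> and \<open>h''\<close> factor through the images of \<open>m\<close> and
      \<open>n\<close> by one and the same \<open>r\<close>.\<close>
    obtain k l where kl: "is_pullback X (p \<cdot>\<^bsub>X\<^esub> v) p k l"
      using X.pb_is_pullback[of "p \<cdot>\<^bsub>X\<^esub> v" p] U(1-5) p by auto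
    have K: "k \<in> Arr X" "l \<in> Arr X" "Dom X l = Dom X k" "Cod X k = Dom X u" "Cod X l = Dom X p" "p \<cdot>\<^bsub>X\<^esub> l = p \<cdot>\<^bsub>X\<^esub> (v \<cdot>\<^bsub>X\<^esub> k)"
      using X.is_pullbackD[OF kl] U(1-5) p by simp_all
    have pvk: "p \<cdot>\<^bsub>X\<^esub> (v \<cdot>\<^bsub>X\<^esub> k) = p \<cdot>\<^bsub>X\<^esub> (c \<cdot>\<^bsub>X\<^esub> (u \<cdot>\<^bsub>X\<^esub> k))"
      using X.reassoc[OF U(6), of k] U(1-5) A(1,2) K(1-5) p by simp
    obtain m where m: "m \<in> Arr X" "Dom X m = Dom X k" "Cod X m = Dom X u" "u \<cdot>\<^bsub>X\<^esub> m = \<xi> \<cdot>\<^bsub>X\<^esub> k" "v \<cdot>\<^bsub>X\<^esub> m = l"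
      using X.is_pullback_lift[OF A(3), of "\<xi> \<cdot>\<^bsub>X\<^esub> k" l] A(1,2,4-6) K U(1-5) p X.reassoc[OF A(7), of k] by auto
    obtain n where n: "n \<in> Arr X" "Dom X n = Dom X k" "Cod X n = Dom X u" "u \<cdot>\<^bsub>X\<^esub> n = u \<cdot>\<^bsub>X\<^esub> k" "v \<cdot>\<^bsub>X\<^esub> n = l"
      using X.is_pullback_lift[OF A(3), of "u \<cdot>\<^bsub>X\<^esub> k" l] A(1,2) K U(1-5) p pvk by auto
    have mn: "\<xi> \<cdot>\<^bsub>X\<^esub> m = \<xi> \<cdot>\<^bsub>X\<^esub> n" by (rule action_assoc[OF act, of k]) (use m n K in simp_all)
    note Fk = F(4-6)[OF K(1)] and Fl = F(4-6)[OF K(2)] and Fm = F(4-6)[OF m(1)] and Fn = F(4-6)[OF n(1)]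
    have Fe: "FAr F u \<cdot>\<^bsub>Y\<^esub> FAr F m = FAr F \<xi> \<cdot>\<^bsub>Y\<^esub> FAr F k" "FAr F v \<cdot>\<^bsub>Y\<^esub> FAr F m = FAr F l"
      "FAr F u \<cdot>\<^bsub>Y\<^esub> FAr F n = FAr F u \<cdot>\<^bsub>Y\<^esub> FAr F k" "FAr F v \<cdot>\<^bsub>Y\<^esub> FAr F n = FAr F l"
      "FAr F \<xi> \<cdot>\<^bsub>Y\<^esub> FAr F m = FAr F \<xi> \<cdot>\<^bsub>Y\<^esub> FAr F n"
      using F(8)[of m u] F(8)[of k \<xi>] F(8)[of m v] F(8)[of n u] F(8)[of k u] F(8)[of n v] F(8)[of m \<xi>] F(8)[of n \<xi>]
        U(1-5) A(4-6) m n K(1-5) mn by simp_all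
    have pbk: "is_pullback Y (FAr F p \<cdot>\<^bsub>Y\<^esub> FAr F v) (FAr F p) (FAr F k) (FAr F l)"
      using FX(2) kl F(8)[of v p] U(2,5) p unfolding preserves_pullbacks_def by metis
    have pv: "FAr F p \<cdot>\<^bsub>Y\<^esub> (FAr F v \<cdot>\<^bsub>Y\<^esub> z) = FAr F p \<cdot>\<^bsub>Y\<^esub> (FAr F c \<cdot>\<^bsub>Y\<^esub> (FAr F u \<cdot>\<^bsub>Y\<^esub> z))"
      if "z \<in> Arr Y" "Cod Y z = Dom Y (FAr F u)" for z
      using Y.reassoc[OF Y.is_pullbackD(9)[OF pb], of z] that Fs U(1-5) A(1,2) by simp
    have "FAr F p \<cdot>\<^bsub>Y\<^esub> (FAr F v \<cdot>\<^bsub>Y\<^esub> h') = FAr F p \<cdot>\<^bsub>Y\<^esub> (FAr F c \<cdot>\<^bsub>Y\<^esub> (FAr F \<xi> \<cdot>\<^bsub>Y\<^esub> h))"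
      unfolding pv[OF h'(1,3)] e1 ..
    also have "\<dots> = FAr F p \<cdot>\<^bsub>Y\<^esub> (FAr F v \<cdot>\<^bsub>Y\<^esub> h)"
      using Y.reassoc[OF c\<xi>, of h] Fs A(1,2,4-6) h by simp
    finally have e4: "(FAr F p \<cdot>\<^bsub>Y\<^esub> FAr F v) \<cdot>\<^bsub>Y\<^esub> h = FAr F p \<cdot>\<^bsub>Y\<^esub> (FAr F v \<cdot>\<^bsub>Y\<^esub> h')"
      using Fs U(1-5) h by simp
    obtain r where r: "r \<in> Arr Y" "Dom Y r = Dom Y h" "Cod Y r = Dom Y (FAr F k)" "FAr F k \<cdot>\<^bsub>Y\<^esub> r = h" "FAr F l \<cdot>\<^bsub>Y\<^esub> r = FAr F v \<cdot>\<^bsub>Y\<^esub> h'"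
      using Y.is_pullback_lift[OF pbk, of h "FAr F v \<cdot>\<^bsub>Y\<^esub> h'"] e4 h h' Fs U(1-5) by auto
    have hm: "h' = FAr F m \<cdot>\<^bsub>Y\<^esub> r"
      by (rule Y.is_pullback_ext[OF pb])
        (use h' r Fs Fk Fl Fm K(1-5) m(2,3) U(1-5) A(4-6) e1 Y.reassoc[OF Fe(1), of r] Y.reassoc[OF Fe(2), of r] in simp_all)
    have hn: "h'' = FAr F n \<cdot>\<^bsub>Y\<^esub> r"
      by (rule Y.is_pullback_ext[OF pb])
        (use h'' r Fs Fk Fl Fn K(1-5) n(2,3) U(1-5) A(4-6) e2 e3 Y.reassoc[OF Fe(3), of r] Y.reassoc[OF Fe(4), of r] in simp_all)
    show "FAr F \<xi> \<cdot>\<^bsub>Y\<^esub> h' = FAr F \<xi> \<cdot>\<^bsub>Y\<^esub> h''"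
      unfolding hm hn using Y.reassoc[OF Fe(5), of r] Fs Fk Fm Fn m(2,3) n(2,3) r(1-3) A(4-6) K(1-5) by simp
  qed
qed

section \<open>Descent in a pseudopullback\<close>

locale pseudopullback =
  B: pb_category B + C: pb_category C + D: pb_category D + E: pb_category E
  for B :: "('b, 'ab) cat" and C :: "('c, 'ac) cat" and D :: "('d, 'ad) cat" and E :: "('e, 'ae) cat" +
  fixes S :: "('b, 'ab, 'c, 'ac) funct" and Z :: "('b, 'ab, 'd, 'ad) funct"
    and F :: "('c, 'ac, 'e, 'ae) funct" and G :: "('d, 'ad, 'e, 'ae) funct" and \<sigma> :: "'b \<Rightarrow> 'ae"
  assumes fun_S: "is_functor B C S" and fun_Z: "is_functor B D Z"
    and fun_F: "is_functor C E F" and fun_G: "is_functor D E G"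
    and pres_S: "preserves_pullbacks B C S" and pres_Z: "preserves_pullbacks B D Z"
    and pres_F: "preserves_pullbacks C E F" and pres_G: "preserves_pullbacks D E G"
    and pspb: "is_pseudopullback B C D E S Z F G \<sigma>"
begin

abbreviation cmp_B (infixr "\<cdot>\<^sub>B" 70) where "cmp_B \<equiv> Cmp B"
abbreviation cmp_C (infixr "\<cdot>\<^sub>C" 70) where "cmp_C \<equiv> Cmp C"
abbreviation cmp_D (infixr "\<cdot>\<^sub>D" 70) where "cmp_D \<equiv> Cmp D"
abbreviation cmp_E (infixr "\<cdot>\<^sub>E" 70) where "cmp_E \<equiv> Cmp E"
abbreviation "So \<equiv> FOb S" abbreviation "Zo \<equiv> FOb Z" abbreviation "Fo \<equiv> FOb F" abbreviation "Go \<equiv> FOb G"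
abbreviation "Sa \<equiv> FAr S" abbreviation "Za \<equiv> FAr Z" abbreviation "Fa \<equiv> FAr F" abbreviation "Ga \<equiv> FAr G"

lemmas S_simps [simp] = is_functorD(3-8)[OF fun_S]
lemmas Z_simps [simp] = is_functorD(3-8)[OF fun_Z]
lemmas F_simps [simp] = is_functorD(3-8)[OF fun_F]
lemmas G_simps [simp] = is_functorD(3-8)[OF fun_G]

lemma pres:
  "is_pullback B f g u v \<Longrightarrow> is_pullback C (Sa f) (Sa g) (Sa u) (Sa v)"
  "is_pullback B f g u v \<Longrightarrow> is_pullback D (Za f) (Za g) (Za u) (Za v)"
  "is_pullback C f' g' u' v' \<Longrightarrow> is_pullback E (Fa f') (Fa g') (Fa u') (Fa v')"
  "is_pullback D f'' g'' u'' v'' \<Longrightarrow> is_pullback E (Ga f'') (Ga g'') (Ga u'') (Ga v'')"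
  using pres_S pres_Z pres_F pres_G unfolding preserves_pullbacks_def by blast+

lemma \<sigma>_simps [simp]:
  assumes "x \<in> Obj B"
  shows "\<sigma> x \<in> Arr E" "Dom E (\<sigma> x) = Fo (So x)" "Cod E (\<sigma> x) = Go (Zo x)" "iso E (\<sigma> x)"
  using pspb assms unfolding is_pseudopullback_def nat_iso_def nat_trans_def by auto

lemma \<sigma>_nat:
  assumes "f \<in> Arr B" "Dom B f = x" "Cod B f = y"
  shows "\<sigma> y \<cdot>\<^sub>E Fa (Sa f) = Ga (Za f) \<cdot>\<^sub>E \<sigma> x"
  using pspb assms unfolding is_pseudopullback_def nat_iso_def nat_trans_def by auto

lemma \<sigma>_nat_reassoc:
  assumes "f \<in> Arr B" "Dom B f = x" "Cod B f = y" "z \<in> Arr E" "Cod E z = Fo (So x)"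
  shows "\<sigma> y \<cdot>\<^sub>E (Fa (Sa f) \<cdot>\<^sub>E z) = Ga (Za f) \<cdot>\<^sub>E (\<sigma> x \<cdot>\<^sub>E z)"
proof -
  have "x \<in> Obj B" "y \<in> Obj B" using assms by auto
  then show ?thesis using E.reassoc[OF \<sigma>_nat[OF assms(1-3)], of z] assms by simp
qed

lemma iso_comma_equivalence:
  "is_equivalence B (iso_comma C D E F G) (into_iso_comma B S Z \<sigma>)"
  using pspb unfolding is_pseudopullback_def by simp

lemmas iso_comma_ff = equivalence_fully_faithful[OF iso_comma_equivalence]
lemmas iso_comma_es = equivalence_essentially_surjective[OF iso_comma_equivalence]

text \<open>An arrow of \<open>iso_comma\<close> between given objects is just a pair of arrows, so
  faithfulness into it is joint faithfulness of S and Z.\<close>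

lemma faithful:
  assumes "Sa f = Sa g" "Za f = Za g" "f \<in> Arr B" "g \<in> Arr B" "Dom B f = Dom B g" "Cod B f = Cod B g"
  shows "f = g"
proof (rule fully_faithfulD(1)[OF iso_comma_ff, of "Dom B g" "Cod B g"])
  show "FAr (into_iso_comma B S Z \<sigma>) f = FAr (into_iso_comma B S Z \<sigma>) g"
    using assms by (simp add: into_iso_comma_def Let_def)
qed (use assms in simp_all)

text \<open>Compatibility with \<sigma> is all that a pair of arrows needs in order to come from B;
  gluing below is reduced to checking it.\<close>

lemma full:
  assumes "x \<in> Obj B" "y \<in> Obj B" "u \<in> Arr C" "Dom C u = So x" "Cod C u = So y"
    "v \<in> Arr D" "Dom D v = Zo x" "Cod D v = Zo y" "\<sigma> y \<cdot>\<^sub>E Fa u = Ga v \<cdot>\<^sub>E \<sigma> x"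
  obtains w where "w \<in> Arr B" "Dom B w = x" "Cod B w = y" "Sa w = u" "Za w = v"
proof -
  have "((So x, Zo x, \<sigma> x), (u, v), (So y, Zo y, \<sigma> y)) \<in>
      hom (iso_comma C D E F G) (FOb (into_iso_comma B S Z \<sigma>) x) (FOb (into_iso_comma B S Z \<sigma>) y)"
    using assms by (simp add: into_iso_comma_def iso_comma_def Let_def)
  then obtain w where "w \<in> hom B x y" "FAr (into_iso_comma B S Z \<sigma>) w = ((So x, Zo x, \<sigma> x), (u, v), (So y, Zo y, \<sigma> y))"
    using fully_faithfulD(2)[OF iso_comma_ff assms(1,2)] by blast
  then show thesis using that[of w] by (simp add: into_iso_comma_def Let_def)
qed

text \<open>An isomorphism of \<open>iso_comma\<close> is split into its components in C and D; the
  components of its inverse satisfy the square with \<theta> and \<sigma> as well.\<close>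

lemma essentially_surjective:
  assumes "c \<in> Obj C" "d \<in> Obj D" "iso E \<theta>" "Dom E \<theta> = Fo c" "Cod E \<theta> = Go d"
  obtains x s s' z z' where "x \<in> Obj B" "s \<in> Arr C" "Dom C s = So x" "Cod C s = c"
    "s' \<in> Arr C" "Dom C s' = c" "Cod C s' = So x" "s' \<cdot>\<^sub>C s = Ide C (So x)" "s \<cdot>\<^sub>C s' = Ide C c"
    "z \<in> Arr D" "Dom D z = Zo x" "Cod D z = d"
    "z' \<in> Arr D" "Dom D z' = d" "Cod D z' = Zo x" "z' \<cdot>\<^sub>D z = Ide D (Zo x)" "z \<cdot>\<^sub>D z' = Ide D d"
    "\<theta> \<cdot>\<^sub>E Fa s = Ga z \<cdot>\<^sub>E \<sigma> x" "\<sigma> x \<cdot>\<^sub>E Fa s' = Ga z' \<cdot>\<^sub>E \<theta>"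
proof -
  let ?I = "iso_comma C D E F G"
  have t: "\<theta> \<in> Arr E" using assms(3) E.isoE by metis
  have "(c, d, \<theta>) \<in> Obj ?I" using assms t by (simp add: iso_comma_def Let_def)
  then obtain x i where x: "x \<in> Obj B" and i: "i \<in> hom ?I (FOb (into_iso_comma B S Z \<sigma>) x) (c, d, \<theta>)" and ii: "iso ?I i"
    using iso_comma_es by blast
  have kx: "FOb (into_iso_comma B S Z \<sigma>) x = (So x, Zo x, \<sigma> x)" by (simp add: into_iso_comma_def Let_def)
  obtain i1 s z i3 where i': "i = (i1, (s, z), i3)" by (cases i) auto
  have i13: "i1 = (So x, Zo x, \<sigma> x)" "i3 = (c, d, \<theta>)" using i unfolding kx i' by (simp_all add: iso_comma_def Let_def)
  have ss: "s \<in> hom C (So x) c" "z \<in> hom D (Zo x) d" "\<theta> \<cdot>\<^sub>E Fa s = Ga z \<cdot>\<^sub>E \<sigma> x"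
    using i unfolding kx i' i13 by (simp_all add: iso_comma_def Let_def)
  obtain j where j: "j \<in> hom ?I (Cod ?I i) (Dom ?I i)" "j \<cdot>\<^bsub>?I\<^esub> i = Ide ?I (Dom ?I i)" "i \<cdot>\<^bsub>?I\<^esub> j = Ide ?I (Cod ?I i)"
    using ii unfolding iso_def by blast
  obtain j1 s' z' j3 where j': "j = (j1, (s', z'), j3)" by (cases j) auto
  have j13: "j1 = (c, d, \<theta>)" "j3 = (So x, Zo x, \<sigma> x)" using j(1) unfolding i' i13 j' by (simp_all add: iso_comma_def Let_def)
  have "s' \<in> hom C c (So x)" "z' \<in> hom D d (Zo x)" "\<sigma> x \<cdot>\<^sub>E Fa s' = Ga z' \<cdot>\<^sub>E \<theta>"
    "s' \<cdot>\<^sub>C s = Ide C (So x)" "z' \<cdot>\<^sub>D z = Ide D (Zo x)" "s \<cdot>\<^sub>C s' = Ide C c" "z \<cdot>\<^sub>D z' = Ide D d"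
    using j unfolding i' i13 j' j13 by (simp_all add: iso_comma_def Let_def)
  with x ss show thesis by (intro that[of x s s' z z']) simp_all
qed

lemma \<sigma>_inverse:
  assumes "x \<in> Obj B"
  obtains t where "t \<in> Arr E" "Dom E t = Go (Zo x)" "Cod E t = Fo (So x)"
    "t \<cdot>\<^sub>E \<sigma> x = Ide E (Fo (So x))" "\<sigma> x \<cdot>\<^sub>E t = Ide E (Go (Zo x))"
  using E.isoE[OF \<sigma>_simps(4)[OF assms]] \<sigma>_simps[OF assms] by metis

text \<open>The solutions \<open>w1\<close> in C and \<open>w2\<close> in D glue if they are
  compatible with \<sigma>. This is an equation in E between arrows over the base, and it suffices
  to check it after composing with F S a, which is epimorphic over the base because F S p is a
  descent morphism.\<close>

lemma coequalizing_lift: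
  assumes p: "p \<in> Arr B" and coC: "coequalizing C (Sa p)" and coD: "coequalizing D (Za p)"
    and coE: "coequalizing E (Fa (Sa p))"
  shows "coequalizing B p"
  unfolding coequalizing_def
proof (intro allI impI)
  fix f e a g v
  assume pb: "is_pullback B p f e a" and g: "g \<in> Arr B" "Cod B g = Cod B p"
    and "v \<in> hom B (Dom B a) (Dom B g)" and gv: "g \<cdot>\<^sub>B v = f \<cdot>\<^sub>B a" and cv: "compat B a v"
  then have v: "v \<in> Arr B" "Dom B v = Dom B a" "Cod B v = Dom B g" by auto
  note P = B.is_pullbackD[OF pb]
  have "Sa g \<cdot>\<^sub>C Sa v = Sa f \<cdot>\<^sub>C Sa a"
    using S_simps(6)[of v g] S_simps(6)[of a f] gv g v P by simp
  then obtain w1 where w1: "w1 \<in> Arr C" "Dom C w1 = Dom C (Sa f)" "Cod C w1 = Dom C (Sa g)" "Sa g \<cdot>\<^sub>C w1 = Sa f" "w1 \<cdot>\<^sub>C Sa a = Sa v"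
    using coequalizingD(1)[OF coC pres(1)[OF pb], of "Sa g" "Sa v"]
      functor_compat[OF B.pb_category_axioms fun_S pres_S cv] P g v by auto
  have "Za g \<cdot>\<^sub>D Za v = Za f \<cdot>\<^sub>D Za a"
    using Z_simps(6)[of v g] Z_simps(6)[of a f] gv g v P by simp
  then obtain w2 where w2: "w2 \<in> Arr D" "Dom D w2 = Dom D (Za f)" "Cod D w2 = Dom D (Za g)" "Za g \<cdot>\<^sub>D w2 = Za f" "w2 \<cdot>\<^sub>D Za a = Za v"
    using coequalizingD(1)[OF coD pres(2)[OF pb], of "Za g" "Za v"]
      functor_compat[OF B.pb_category_axioms fun_Z pres_Z cv] P g v by auto
  have w1': "Dom C w1 = So (Dom B f)" "Cod C w1 = So (Dom B g)" using w1 P g by simp_all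
  have w2': "Dom D w2 = Zo (Dom B f)" "Cod D w2 = Zo (Dom B g)" using w2 P g by simp_all
  have O: "Dom B f \<in> Obj B" "Dom B g \<in> Obj B" "Cod B p \<in> Obj B" "Dom B a \<in> Obj B" using P g p by simp_all
  \<comment> \<open>G Z g lives over G Z (Cod p). Composing with the inverse \<open>t\<close> of
    \<sigma> puts it over F S (Cod p), so that it can serve as test object for
    \<open>coE\<close>.\<close>
  obtain t where t: "t \<in> Arr E" "Dom E t = Go (Zo (Cod B p))" "Cod E t = Fo (So (Cod B p))"
    "t \<cdot>\<^sub>E \<sigma> (Cod B p) = Ide E (Fo (So (Cod B p)))"
    using \<sigma>_inverse[OF O(3)] by metis
  have t\<sigma>: "t \<cdot>\<^sub>E (\<sigma> (Cod B p) \<cdot>\<^sub>E y) = y" if "y \<in> Arr E" "Cod E y = Fo (So (Cod B p))" for y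
    using E.reassoc[OF t(4), of y] t(1-3) O that by simp
  have nf: "\<sigma> (Cod B p) \<cdot>\<^sub>E Fa (Sa f) = Ga (Za f) \<cdot>\<^sub>E \<sigma> (Dom B f)"
    by (rule \<sigma>_nat) (use P in simp_all)
  have ng: "\<sigma> (Cod B p) \<cdot>\<^sub>E (Fa (Sa g) \<cdot>\<^sub>E y) = Ga (Za g) \<cdot>\<^sub>E (\<sigma> (Dom B g) \<cdot>\<^sub>E y)"
    if "y \<in> Arr E" "Cod E y = Fo (So (Dom B g))" for y
    by (rule \<sigma>_nat_reassoc) (use that g in simp_all)
  have na: "\<sigma> (Dom B f) \<cdot>\<^sub>E Fa (Sa a) = Ga (Za a) \<cdot>\<^sub>E \<sigma> (Dom B a)"
    by (rule \<sigma>_nat) (use P in simp_all)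
  have nv: "\<sigma> (Dom B g) \<cdot>\<^sub>E Fa (Sa v) = Ga (Za v) \<cdot>\<^sub>E \<sigma> (Dom B a)"
    by (rule \<sigma>_nat) (use v in simp_all)
  have Fw: "Fa (Sa g) \<cdot>\<^sub>E Fa w1 = Fa (Sa f)" "Fa w1 \<cdot>\<^sub>E Fa (Sa a) = Fa (Sa v)"
    using F_simps(6)[of w1 "Sa g"] F_simps(6)[of "Sa a" w1] w1 w1' P g by simp_all
  have Gw: "Ga (Za g) \<cdot>\<^sub>E Ga w2 = Ga (Za f)" "Ga w2 \<cdot>\<^sub>E Ga (Za a) = Ga (Za v)"
    using G_simps(6)[of w2 "Za g"] G_simps(6)[of "Za a" w2] w2 w2' P g by simp_all
  have comm: "\<sigma> (Dom B g) \<cdot>\<^sub>E Fa w1 = Ga w2 \<cdot>\<^sub>E \<sigma> (Dom B f)"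
  proof (rule E.coequalizing_epi[OF coE pres(3)[OF pres(1)[OF pb]], of "t \<cdot>\<^sub>E Ga (Za g)"])
    show "(t \<cdot>\<^sub>E Ga (Za g)) \<cdot>\<^sub>E (\<sigma> (Dom B g) \<cdot>\<^sub>E Fa w1) = Fa (Sa f)"
      using ng[of "Fa w1"] Fw(1) t\<sigma>[of "Fa (Sa f)"] t(1-3) g P w1(1) w1' O by simp
    have "(t \<cdot>\<^sub>E Ga (Za g)) \<cdot>\<^sub>E (Ga w2 \<cdot>\<^sub>E \<sigma> (Dom B f)) = t \<cdot>\<^sub>E (Ga (Za f) \<cdot>\<^sub>E \<sigma> (Dom B f))"
      using E.reassoc[OF Gw(1), of "\<sigma> (Dom B f)"] t(1-3) g P w2(1) w2' O by simp
    also have "\<dots> = Fa (Sa f)"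
      unfolding nf[symmetric] using t\<sigma>[of "Fa (Sa f)"] P by simp
    finally show "(t \<cdot>\<^sub>E Ga (Za g)) \<cdot>\<^sub>E (Ga w2 \<cdot>\<^sub>E \<sigma> (Dom B f)) = Fa (Sa f)" .
    have "(\<sigma> (Dom B g) \<cdot>\<^sub>E Fa w1) \<cdot>\<^sub>E Fa (Sa a) = Ga (Za v) \<cdot>\<^sub>E \<sigma> (Dom B a)"
      unfolding nv[symmetric] Fw(2)[symmetric] using w1(1) w1' P O by simp
    also have "\<dots> = Ga w2 \<cdot>\<^sub>E (Ga (Za a) \<cdot>\<^sub>E \<sigma> (Dom B a))"
      unfolding Gw(2)[symmetric] using w2(1) w2' P O by simp
    also have "\<dots> = (Ga w2 \<cdot>\<^sub>E \<sigma> (Dom B f)) \<cdot>\<^sub>E Fa (Sa a)"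
      unfolding na[symmetric] using w2(1) w2' P O by simp
    finally show "(\<sigma> (Dom B g) \<cdot>\<^sub>E Fa w1) \<cdot>\<^sub>E Fa (Sa a) = (Ga w2 \<cdot>\<^sub>E \<sigma> (Dom B f)) \<cdot>\<^sub>E Fa (Sa a)" .
  qed (use t(1-3) g P w1(1) w1' w2(1) w2' O p in simp_all)
  obtain w where w: "w \<in> Arr B" "Dom B w = Dom B f" "Cod B w = Dom B g" "Sa w = w1" "Za w = w2"
    using full[OF O(1,2) w1(1) w1' w2(1) w2' comm] by metis
  have gw: "g \<cdot>\<^sub>B w = f" by (rule faithful) (use w w1 w2 g P in simp_all)
  have wa: "w \<cdot>\<^sub>B a = v" by (rule faithful) (use w w1 w2 v P in simp_all)
  show "\<exists>!w. w \<in> hom B (Dom B f) (Dom B g) \<and> g \<cdot>\<^sub>B w = f \<and> w \<cdot>\<^sub>B a = v"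
  proof (rule ex1I[of _ w])
    show "w \<in> hom B (Dom B f) (Dom B g) \<and> g \<cdot>\<^sub>B w = f \<and> w \<cdot>\<^sub>B a = v" using w gw wa by simp
    fix w' assume "w' \<in> hom B (Dom B f) (Dom B g) \<and> g \<cdot>\<^sub>B w' = f \<and> w' \<cdot>\<^sub>B a = v"
    then have w': "w' \<in> Arr B" "Dom B w' = Dom B f" "Cod B w' = Dom B g" "g \<cdot>\<^sub>B w' = f" "w' \<cdot>\<^sub>B a = v" by auto
    have s: "Sa w' = Sa w"
      by (rule C.coequalizing_epi[OF coC pres(1)[OF pb], of "Sa g"])
        (use w(1-3) w'(1-3) gw wa w'(4,5) S_simps(6)[of w' g] S_simps(6)[of w g] S_simps(6)[of a w] S_simps(6)[of a w'] g P(1-8) in \<open>simp_all del: S_simps(6)\<close>)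
    have z: "Za w' = Za w"
      by (rule D.coequalizing_epi[OF coD pres(2)[OF pb], of "Za g"])
        (use w(1-3) w'(1-3) gw wa w'(4,5) Z_simps(6)[of w' g] Z_simps(6)[of w g] Z_simps(6)[of a w] Z_simps(6)[of a w'] g P(1-8) in \<open>simp_all del: Z_simps(6)\<close>)
    show "w' = w" by (rule faithful[OF s z]) (use w w' in simp_all)
  qed
qed

text \<open>The lifts in C and D are compatible with \<sigma> because G preserves the square in D,
  whose projections are then jointly monic in E.\<close>

lemma reflects_pullback:
  assumes pC: "is_pullback C (Sa p) (Sa f) (Sa c) (Sa q)" and pD: "is_pullback D (Za p) (Za f) (Za c) (Za q)"
    and ar: "p \<in> Arr B" "f \<in> Arr B" "Cod B f = Cod B p" "c \<in> Arr B" "Cod B c = Dom B p" "q \<in> Arr B" "Dom B q = Dom B c" "Cod B q = Dom B f"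
  shows "is_pullback B p f c q"
proof (rule B.is_pullbackI)
  show "p \<cdot>\<^sub>B c = f \<cdot>\<^sub>B q"
    by (rule faithful) (use ar C.is_pullbackD(9)[OF pC] D.is_pullbackD(9)[OF pD] in simp_all)
next
  fix h k assume hk: "h \<in> Arr B" "k \<in> Arr B" "Dom B k = Dom B h" "Cod B h = Dom B c" "Cod B k = Dom B c"
    "c \<cdot>\<^sub>B h = c \<cdot>\<^sub>B k" "q \<cdot>\<^sub>B h = q \<cdot>\<^sub>B k"
  have s: "Sa h = Sa k"
    by (rule C.is_pullback_ext[OF pC])
      (use hk ar S_simps(6)[of h c] S_simps(6)[of k c] S_simps(6)[of h q] S_simps(6)[of k q] in \<open>simp_all del: S_simps(6)\<close>)
  have z: "Za h = Za k"
    by (rule D.is_pullback_ext[OF pD])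
      (use hk ar Z_simps(6)[of h c] Z_simps(6)[of k c] Z_simps(6)[of h q] Z_simps(6)[of k q] in \<open>simp_all del: Z_simps(6)\<close>)
  show "h = k" by (rule faithful[OF s z]) (use hk in simp_all)
next
  fix x y assume xy: "x \<in> Arr B" "y \<in> Arr B" "Dom B y = Dom B x" "Cod B x = Dom B p" "Cod B y = Dom B f" "p \<cdot>\<^sub>B x = f \<cdot>\<^sub>B y"
  have e: "Sa p \<cdot>\<^sub>C Sa x = Sa f \<cdot>\<^sub>C Sa y" "Za p \<cdot>\<^sub>D Za x = Za f \<cdot>\<^sub>D Za y"
    using S_simps(6)[of x p] S_simps(6)[of y f] Z_simps(6)[of x p] Z_simps(6)[of y f] xy ar by simp_all
  obtain h1 where h1: "h1 \<in> Arr C" "Dom C h1 = So (Dom B x)" "Cod C h1 = So (Dom B c)" "Sa c \<cdot>\<^sub>C h1 = Sa x" "Sa q \<cdot>\<^sub>C h1 = Sa y"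
    using C.is_pullback_lift[OF pC, of "Sa x" "Sa y"] e xy ar by auto
  obtain h2 where h2: "h2 \<in> Arr D" "Dom D h2 = Zo (Dom B x)" "Cod D h2 = Zo (Dom B c)" "Za c \<cdot>\<^sub>D h2 = Za x" "Za q \<cdot>\<^sub>D h2 = Za y"
    using D.is_pullback_lift[OF pD, of "Za x" "Za y"] e xy ar by auto
  have O: "Dom B x \<in> Obj B" "Dom B c \<in> Obj B" "Dom B p \<in> Obj B" "Dom B f \<in> Obj B" using xy ar by simp_all
  have Fh: "Fa (Sa c) \<cdot>\<^sub>E Fa h1 = Fa (Sa x)" "Fa (Sa q) \<cdot>\<^sub>E Fa h1 = Fa (Sa y)"
    using F_simps(6)[of h1 "Sa c"] F_simps(6)[of h1 "Sa q"] h1 ar by simp_all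
  have Gh: "Ga (Za c) \<cdot>\<^sub>E Ga h2 = Ga (Za x)" "Ga (Za q) \<cdot>\<^sub>E Ga h2 = Ga (Za y)"
    using G_simps(6)[of h2 "Za c"] G_simps(6)[of h2 "Za q"] h2 ar by simp_all
  have n: "\<sigma> (Dom B p) \<cdot>\<^sub>E Fa (Sa x) = Ga (Za x) \<cdot>\<^sub>E \<sigma> (Dom B x)" "\<sigma> (Dom B f) \<cdot>\<^sub>E Fa (Sa y) = Ga (Za y) \<cdot>\<^sub>E \<sigma> (Dom B x)"
    by (rule \<sigma>_nat; use xy in simp)+
  have m: "\<sigma> (Dom B p) \<cdot>\<^sub>E (Fa (Sa c) \<cdot>\<^sub>E Fa h1) = Ga (Za c) \<cdot>\<^sub>E (\<sigma> (Dom B c) \<cdot>\<^sub>E Fa h1)"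
    "\<sigma> (Dom B f) \<cdot>\<^sub>E (Fa (Sa q) \<cdot>\<^sub>E Fa h1) = Ga (Za q) \<cdot>\<^sub>E (\<sigma> (Dom B c) \<cdot>\<^sub>E Fa h1)"
    by (rule \<sigma>_nat_reassoc; use h1 ar in simp)+
  have k: "Ga (Za c) \<cdot>\<^sub>E (Ga h2 \<cdot>\<^sub>E \<sigma> (Dom B x)) = Ga (Za x) \<cdot>\<^sub>E \<sigma> (Dom B x)"
    "Ga (Za q) \<cdot>\<^sub>E (Ga h2 \<cdot>\<^sub>E \<sigma> (Dom B x)) = Ga (Za y) \<cdot>\<^sub>E \<sigma> (Dom B x)"
    using E.reassoc[OF Gh(1), of "\<sigma> (Dom B x)"] E.reassoc[OF Gh(2), of "\<sigma> (Dom B x)"] h2 ar O by simp_all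
  have comm: "\<sigma> (Dom B c) \<cdot>\<^sub>E Fa h1 = Ga h2 \<cdot>\<^sub>E \<sigma> (Dom B x)"
  proof (rule E.is_pullback_ext[OF pres(4)[OF pD]])
    show "Ga (Za c) \<cdot>\<^sub>E \<sigma> (Dom B c) \<cdot>\<^sub>E Fa h1 = Ga (Za c) \<cdot>\<^sub>E Ga h2 \<cdot>\<^sub>E \<sigma> (Dom B x)"
      unfolding m[symmetric] k Fh n ..
    show "Ga (Za q) \<cdot>\<^sub>E \<sigma> (Dom B c) \<cdot>\<^sub>E Fa h1 = Ga (Za q) \<cdot>\<^sub>E Ga h2 \<cdot>\<^sub>E \<sigma> (Dom B x)"
      unfolding m[symmetric] k Fh n ..
  qed (use h1(1-3) h2(1-3) O ar in simp_all)
  obtain h where h: "h \<in> Arr B" "Dom B h = Dom B x" "Cod B h = Dom B c" "Sa h = h1" "Za h = h2"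
    using full[OF O(1,2) h1(1-3) h2(1-3) comm] by metis
  have "c \<cdot>\<^sub>B h = x" by (rule faithful) (use h h1 h2 xy ar in simp_all)
  moreover have "q \<cdot>\<^sub>B h = y" by (rule faithful) (use h h1 h2 xy ar in simp_all)
  ultimately show "\<exists>h\<in>Arr B. Dom B h = Dom B x \<and> Cod B h = Dom B c \<and> c \<cdot>\<^sub>B h = x \<and> q \<cdot>\<^sub>B h = y"
    using h by blast
qed (use ar in simp_all)

text \<open>The presentations found in C and D give two presentations in E of one action, the image
  of \<xi> under F S. Their comparison \<theta> is the datum that the pseudopullback needs in order
  to glue the two objects.\<close>

lemma actions_effective_lift:
  assumes p: "p \<in> Arr B" and eC: "actions_effective C (Sa p)" and eD: "actions_effective D (Za p)"
    and coE: "coequalizing E (Fa (Sa p))"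
  shows "actions_effective B p"
  unfolding actions_effective_def
proof (intro allI impI)
  fix c u v \<xi> assume act: "action B p c u v \<xi>"
  note A = actionD[OF act]
  have u: "u \<in> Arr B" "Cod B u = Dom B c" using B.is_pullbackD[OF A(3)] A(1,2) p by simp_all
  note actC = functor_action[OF B.pb_category_axioms fun_S pres_S act]
  note actD = functor_action[OF B.pb_category_axioms fun_Z pres_Z act]
  note actE = functor_action[OF C.pb_category_axioms fun_F pres_F actC]
  obtain f1 q1 where pb1: "is_pullback C (Sa p) f1 (Sa c) q1" and q1: "q1 \<cdot>\<^sub>C Sa \<xi> = q1 \<cdot>\<^sub>C Sa u"
    using eC actC unfolding actions_effective_def by blast
  obtain f2 q2 where pb2: "is_pullback D (Za p) f2 (Za c) q2" and q2: "q2 \<cdot>\<^sub>D Za \<xi> = q2 \<cdot>\<^sub>D Za u"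
    using eD actD unfolding actions_effective_def by blast
  have P1: "f1 \<in> Arr C" "Cod C f1 = So (Cod B p)" "q1 \<in> Arr C" "Dom C q1 = So (Dom B c)" "Cod C q1 = Dom C f1"
    "f1 \<cdot>\<^sub>C q1 = Sa p \<cdot>\<^sub>C Sa c"
    using C.is_pullbackD[OF pb1] p A(1) by simp_all
  have P2: "f2 \<in> Arr D" "Cod D f2 = Zo (Cod B p)" "q2 \<in> Arr D" "Dom D q2 = Zo (Dom B c)" "Cod D q2 = Dom D f2"
    "f2 \<cdot>\<^sub>D q2 = Za p \<cdot>\<^sub>D Za c"
    using D.is_pullbackD[OF pb2] p A(1) by simp_all
  have O: "Cod B p \<in> Obj B" "Dom B p \<in> Obj B" "Dom B c \<in> Obj B" "Dom B u \<in> Obj B" using p A u by simp_all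
  obtain t where t: "t \<in> Arr E" "Dom E t = Go (Zo (Cod B p))" "Cod E t = Fo (So (Cod B p))"
    "t \<cdot>\<^sub>E \<sigma> (Cod B p) = Ide E (Fo (So (Cod B p)))" "\<sigma> (Cod B p) \<cdot>\<^sub>E t = Ide E (Go (Zo (Cod B p)))"
    using \<sigma>_inverse[OF O(1)] by metis
  have np: "\<sigma> (Cod B p) \<cdot>\<^sub>E Fa (Sa p) = Ga (Za p) \<cdot>\<^sub>E \<sigma> (Dom B p)" by (rule \<sigma>_nat) (use p in simp_all)
  have nc: "\<sigma> (Dom B p) \<cdot>\<^sub>E Fa (Sa c) = Ga (Za c) \<cdot>\<^sub>E \<sigma> (Dom B c)" by (rule \<sigma>_nat) (use A in simp_all)
  have nu: "\<sigma> (Dom B c) \<cdot>\<^sub>E Fa (Sa u) = Ga (Za u) \<cdot>\<^sub>E \<sigma> (Dom B u)" by (rule \<sigma>_nat) (use u in simp_all)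
  have n\<xi>: "\<sigma> (Dom B c) \<cdot>\<^sub>E Fa (Sa \<xi>) = Ga (Za \<xi>) \<cdot>\<^sub>E \<sigma> (Dom B u)" by (rule \<sigma>_nat) (use A in simp_all)
  \<comment> \<open>The presentation from D, moved along \<sigma> so that it presents the action on
    F S c.\<close>
  have pbE: "is_pullback E (Fa (Sa p)) (t \<cdot>\<^sub>E Ga f2) (Fa (Sa c)) (Ga q2 \<cdot>\<^sub>E \<sigma> (Dom B c))"
    by (rule E.is_pullback_transport[OF pres(4)[OF pb2], of _ _ "\<sigma> (Cod B p)" _ "\<sigma> (Dom B p)"])
      (use p A(1,2) O t np nc in simp_all)
  have Fq1: "Fa q1 \<cdot>\<^sub>E Fa (Sa \<xi>) = Fa q1 \<cdot>\<^sub>E Fa (Sa u)"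
    using F_simps(6)[of "Sa \<xi>" q1] F_simps(6)[of "Sa u" q1] q1 P1 A u by simp
  have Gq2: "Ga q2 \<cdot>\<^sub>E Ga (Za \<xi>) = Ga q2 \<cdot>\<^sub>E Ga (Za u)"
    using G_simps(6)[of "Za \<xi>" q2] G_simps(6)[of "Za u" q2] q2 P2 A u by simp
  have "(Ga q2 \<cdot>\<^sub>E \<sigma> (Dom B c)) \<cdot>\<^sub>E Fa (Sa \<xi>) = Ga q2 \<cdot>\<^sub>E (Ga (Za \<xi>) \<cdot>\<^sub>E \<sigma> (Dom B u))"
    unfolding n\<xi>[symmetric] using P2 A(4-6) O by simp
  also have "\<dots> = Ga q2 \<cdot>\<^sub>E (Ga (Za u) \<cdot>\<^sub>E \<sigma> (Dom B u))"
    using E.reassoc[OF Gq2, of "\<sigma> (Dom B u)"] P2 A(4-6) u O by simp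
  also have "\<dots> = (Ga q2 \<cdot>\<^sub>E \<sigma> (Dom B c)) \<cdot>\<^sub>E Fa (Sa u)"
    unfolding nu[symmetric] using P2 u O by simp
  finally have Eq2: "(Ga q2 \<cdot>\<^sub>E \<sigma> (Dom B c)) \<cdot>\<^sub>E Fa (Sa \<xi>) = (Ga q2 \<cdot>\<^sub>E \<sigma> (Dom B c)) \<cdot>\<^sub>E Fa (Sa u)" .
  obtain \<theta> where th: "iso E \<theta>" "Dom E \<theta> = Dom E (Fa f1)" "Cod E \<theta> = Dom E (t \<cdot>\<^sub>E Ga f2)"
    "(t \<cdot>\<^sub>E Ga f2) \<cdot>\<^sub>E \<theta> = Fa f1" "\<theta> \<cdot>\<^sub>E Fa q1 = Ga q2 \<cdot>\<^sub>E \<sigma> (Dom B c)"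
    using E.action_presentations_iso[OF coE actE pres(3)[OF pb1] Fq1 pbE Eq2] by blast
  have th': "\<theta> \<in> Arr E" "Dom E \<theta> = Fo (Dom C f1)" "Cod E \<theta> = Go (Dom D f2)"
    using E.isoE[OF th(1)] th(2,3) P1(1,2) P2(1,2) t(1,2) by (metis, simp_all)
  have tf: "Ga f2 \<cdot>\<^sub>E \<theta> = \<sigma> (Cod B p) \<cdot>\<^sub>E Fa f1"
    unfolding th(4)[symmetric] using E.reassoc[OF t(5), of "Ga f2 \<cdot>\<^sub>E \<theta>"] t(1-3) th' P2(1,2) O by simp
  \<comment> \<open>The glued object \<open>x\<close> corresponds to the triple of
    \<open>Dom C f1\<close>, \<open>Dom D f2\<close> and \<theta>, up to the isomorphisms
    \<open>s\<close> and \<open>z\<close>. Conjugating by them, \<open>f\<close> is glued from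
    \<open>f1\<close> and \<open>f2\<close> because \<theta> lies over the base, and
    \<open>q\<close> from \<open>q1\<close> and \<open>q2\<close> because \<theta> carries one
    quotient map to the other.\<close>
  obtain x s s' z z' where x: "x \<in> Obj B" and s: "s \<in> Arr C" "Dom C s = So x" "Cod C s = Dom C f1"
    "s' \<in> Arr C" "Dom C s' = Dom C f1" "Cod C s' = So x" "s' \<cdot>\<^sub>C s = Ide C (So x)" "s \<cdot>\<^sub>C s' = Ide C (Dom C f1)"
    and z: "z \<in> Arr D" "Dom D z = Zo x" "Cod D z = Dom D f2"
    "z' \<in> Arr D" "Dom D z' = Dom D f2" "Cod D z' = Zo x" "z' \<cdot>\<^sub>D z = Ide D (Zo x)" "z \<cdot>\<^sub>D z' = Ide D (Dom D f2)"
    and sz: "\<theta> \<cdot>\<^sub>E Fa s = Ga z \<cdot>\<^sub>E \<sigma> x" "\<sigma> x \<cdot>\<^sub>E Fa s' = Ga z' \<cdot>\<^sub>E \<theta>"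
    using essentially_surjective[OF _ _ th(1) th'(2,3)] P1(1) P2(1) by (metis C.Dom_Cod_Obj(1) D.Dom_Cod_Obj(1))
  have "\<sigma> (Cod B p) \<cdot>\<^sub>E Fa (f1 \<cdot>\<^sub>C s) = Ga f2 \<cdot>\<^sub>E (\<theta> \<cdot>\<^sub>E Fa s)"
    using E.reassoc[OF tf, of "Fa s"] th' P1(1,2) P2(1,2) s(1-3) O by simp
  also have "\<dots> = Ga (f2 \<cdot>\<^sub>D z) \<cdot>\<^sub>E \<sigma> x"
    unfolding sz(1) using P2(1,2) z(1-3) x by simp
  finally obtain f where f: "f \<in> Arr B" "Dom B f = x" "Cod B f = Cod B p" "Sa f = f1 \<cdot>\<^sub>C s" "Za f = f2 \<cdot>\<^sub>D z"
    using full[OF x O(1), of "f1 \<cdot>\<^sub>C s" "f2 \<cdot>\<^sub>D z"] P1(1,2) P2(1,2) s(1-3) z(1-3) by auto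
  have "\<sigma> x \<cdot>\<^sub>E Fa (s' \<cdot>\<^sub>C q1) = Ga z' \<cdot>\<^sub>E (\<theta> \<cdot>\<^sub>E Fa q1)"
    using E.reassoc[OF sz(2), of "Fa q1"] th' P1 s(4-6) z(4-6) x by simp
  also have "\<dots> = Ga (z' \<cdot>\<^sub>D q2) \<cdot>\<^sub>E \<sigma> (Dom B c)"
    unfolding th(5) using P2 z(4-6) O by simp
  finally obtain q where q: "q \<in> Arr B" "Dom B q = Dom B c" "Cod B q = x" "Sa q = s' \<cdot>\<^sub>C q1" "Za q = z' \<cdot>\<^sub>D q2"
    using full[OF O(3) x, of "s' \<cdot>\<^sub>C q1" "z' \<cdot>\<^sub>D q2"] P1 P2 s(4-6) z(4-6) by auto
  have "is_pullback B p f c q"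
  proof (rule reflects_pullback)
    show "is_pullback C (Sa p) (Sa f) (Sa c) (Sa q)"
      unfolding f(4) q(4) by (rule C.is_pullback_iso_base[OF pb1]) (use s in simp_all)
    show "is_pullback D (Za p) (Za f) (Za c) (Za q)"
      unfolding f(5) q(5) by (rule D.is_pullback_iso_base[OF pb2]) (use z in simp_all)
  qed (use p f(1-3) q(1-3) A(1,2) in simp_all)
  moreover have "q \<cdot>\<^sub>B \<xi> = q \<cdot>\<^sub>B u"
    by (rule faithful) (use q A(4-6) u q1 q2 P1 P2 s(4-6) z(4-6) in simp_all)
  ultimately show "\<exists>f q. is_pullback B p f c q \<and> q \<cdot>\<^sub>B \<xi> = q \<cdot>\<^sub>B u" by blast
qed

end

theorem theorem1p5:
  fixes B :: "('b, 'ab) cat" and C :: "('c, 'ac) cat"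
    and D :: "('d, 'ad) cat" and E :: "('e, 'ae) cat"
    and S :: "('b, 'ab, 'c, 'ac) funct" and Z :: "('b, 'ab, 'd, 'ad) funct"
    and F :: "('c, 'ac, 'e, 'ae) funct" and G :: "('d, 'ad, 'e, 'ae) funct"
    and \<sigma> :: "'b \<Rightarrow> 'ae" and p :: 'ab
  assumes "category B" "category C" "category D" "category E"
    and "has_pullbacks B" "has_pullbacks C" "has_pullbacks D" "has_pullbacks E"
    and "is_functor B C S" "is_functor B D Z" "is_functor C E F" "is_functor D E G"
    and "preserves_pullbacks B C S" "preserves_pullbacks B D Z"
      "preserves_pullbacks C E F" "preserves_pullbacks D E G"
    and "is_pseudopullback B C D E S Z F G \<sigma>"
    and "p \<in> Arr B"
    and "effective_descent C (FAr S p)" "effective_descent D (FAr Z p)"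
    and "descent_morphism E (FAr F (FAr S p))"
  shows "effective_descent B p"
proof -
  interpret pseudopullback B C D E S Z F G \<sigma>
    using assms by (intro pseudopullback.intro pseudopullback_axioms.intro pb_category.intro pb_category_axioms.intro)
  show ?thesis
    using assms(18-21) coequalizing_lift actions_effective_lift
    unfolding B.effective_descent_iff C.effective_descent_iff D.effective_descent_iff E.descent_morphism_iff
    by blast
qed

end
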